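(* Let $H$ be a finite-dimensional Hopf algebra and let $(X,\alpha,\beta)$ be a right-left $(H,\widehat H)$-Yetter--Drinfeld algebra. Then $(X,\alpha,\beta)$ is braided commutative (in the sense of the Heisenberg-algebra condition given in the context) if and only if the (right-right) Yetter--Drinfeld algebra $(X,\lhd_\beta,\alpha)$ over $H$ is braided commutative, i.e. $xy=(y\lhd_\beta S^{-1}(x_{[1]}))\,x_{[0]}$ for all $x,y\in X$, where $\alpha(x)=x_{[0]}\otimes x_{[1]}$ and $x\lhd_\beta h=(\mathbf p(h,\cdot)\otimes\mathrm{id}_X)(\beta(x))$.
   Context: $\Bbbk$ is a field, algebras are unital $\Bbbk$-algebras. $H$ has structure maps $\Delta,\varepsilon,S$ ($S$ bijective), with Sweedler notation; $\widehat H$ is the dual Hopf algebra and $\mathbf p(h,\theta)=\theta(h)$, with $\mathbf p(h,\theta\theta')=\mathbf p(h_{(1)},\theta)\mathbf p(h_{(2)},\theta')$, $\mathbf p(hh',\theta)=\mathbf p(h,\theta_{(1)})\mathbf p(h',\theta_{(2)})$. $U=\sum_ih_i\otimes\widehat h_i\in H\otimes\widehat H$ (dual bases), invertible with $U^{-1}=(S\otimes\mathrm{id})(U)$; $\Sigma$ is the flip; $\Sigma(U)^{-1}_{13}$ is $\Sigma(U)^{-1}\in\widehat H\otimes H$ placed in legs 1 and 3. $\mathrm{Ad}(W)(z)=WzW^{-1}$. A left coaction of a Hopf algebra $K$ on an algebra $X$ is an algebra homomorphism $\beta:X\to K\otimes X$ with $(\mathrm{id}\otimes\beta)\beta=(\Delta_K\otimes\mathrm{id})\beta$,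 $(\varepsilon_K\otimes\mathrm{id})\beta=\mathrm{id}$; right coactions are defined similarly. A right-left $(H,\widehat H)$-Yetter--Drinfeld algebra is a triple $(X,\alpha,\beta)$ with $\alpha:X\to X\otimes H$ a right coaction of $H$, $\beta:X\to\widehat H\otimes X$ a left coaction of $\widehat H$, and $(\mathrm{id}_{\widehat H}\otimes\alpha)\beta=\mathrm{Ad}(\Sigma(U)^{-1}_{13})(\beta\otimes\mathrm{id}_H)\alpha$. In that case $(X,\lhd_\beta,\alpha)$ is a (right-right) Yetter--Drinfeld algebra over $H$. The Heisenberg algebra $\mathcal H(\widehat H)=\widehat H\#H$ is $\widehat H\otimes H$ with product $(\theta\#h)(\theta'\#h')=\theta\,\theta'_{(1)}\,\mathbf p(h_{(1)},\theta'_{(2)})\#h_{(2)}h'$. $X\otimes\mathcal H(\widehat H)$ is the tensor product algebra with multiplication map $\mathfrak m_{X\otimes\mathcal H(\widehat H)}$. Put $\hat\iota_{X,1}:X\otimes\widehat H\to X\otimes\mathcal H(\widehat H)$, $x\otimes\theta\mapsto x\otimes\theta\#1$ and $\hat\iota_{X,2}:X\otimes H\to X\otimes\mathcal H(\widehat H)$, $x\otimes h\mapsto x\otimes1\#h$. $(X,\alpha,\beta)$ is called braided commutative if for all $x,y\in X$ $$\mathfrak m_{X\otimes\mathcal H(\widehat H)}(\hat\iota_{X,2}\otimes\hat\iota_{X,1})(\alpha(x)\otimes\Sigma\beta(y))=\mathfrak m_{X\otimes\mathcal H(\widehat H)}(\hat\iota_{X,1}\otimes\hat\iota_{X,2})(\Sigma\beta(y)\otimes\alpha(x)).$$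 *)

theory Defs
  imports "HOL-Algebra.Module" "HOL-Algebra.AbelCoset"
begin

section \<open>Algebras, linear maps and bases\<close>

text \<open>The locale \<^locale>\<open>algebra\<close> of the library is about commutative algebras.\<close>

locale unital_algebra = field K + module K A + ring A for K (structure) and A (structure) +
  assumes smult_mult_left:
      "\<lbrakk>k \<in> carrier K; a \<in> carrier A; b \<in> carrier A\<rbrakk>
        \<Longrightarrow> (k \<odot>\<^bsub>A\<^esub> a) \<otimes>\<^bsub>A\<^esub> b = k \<odot>\<^bsub>A\<^esub> (a \<otimes>\<^bsub>A\<^esub> b)"
    and smult_mult_right:
      "\<lbrakk>k \<in> carrier K; a \<in> carrier A; b \<in> carrier A\<rbrakk>
        \<Longrightarrow> a \<otimes>\<^bsub>A\<^esub> (k \<odot>\<^bsub>A\<^esub> b) = k \<odot>\<^bsub>A\<^esub> (a \<otimes>\<^bsub>A\<^esub> b)"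

definition linear_maps ::
  "('k, 'z) ring_scheme \<Rightarrow> ('k, 'a, 'm) module_scheme \<Rightarrow> ('k, 'b, 'n) module_scheme \<Rightarrow> ('a \<Rightarrow> 'b) set"
  where "linear_maps K M N =
    {f \<in> carrier M \<rightarrow> carrier N.
      (\<forall>x\<in>carrier M. \<forall>y\<in>carrier M. f (x \<oplus>\<^bsub>M\<^esub> y) = f x \<oplus>\<^bsub>N\<^esub> f y) \<and>
      (\<forall>k\<in>carrier K. \<forall>x\<in>carrier M. f (k \<odot>\<^bsub>M\<^esub> x) = k \<odot>\<^bsub>N\<^esub> f x)}"

definition algebra_homs ::
  "('k, 'z) ring_scheme \<Rightarrow> ('k, 'a, 'm) module_scheme \<Rightarrow> ('k, 'b, 'n) module_scheme \<Rightarrow> ('a \<Rightarrow> 'b) set"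
  where "algebra_homs K A B = linear_maps K A B \<inter> ring_hom A B"

definition base_module :: "('k, 'z) ring_scheme \<Rightarrow> ('k, 'k) module"
  where "base_module K =
    \<lparr>carrier = carrier K, monoid.mult = monoid.mult K, one = one K,
     zero = zero K, add = add K, smult = monoid.mult K\<rparr>"

definition finite_basis ::
  "('k, 'z) ring_scheme \<Rightarrow> ('k, 'a, 'm) module_scheme \<Rightarrow> 'a set \<Rightarrow> bool"
  where "finite_basis K M B \<longleftrightarrow> finite B \<and> B \<subseteq> carrier M \<and>
    (\<forall>x\<in>carrier M. \<exists>!c. c \<in> B \<rightarrow>\<^sub>E carrier K \<and> x = (\<Oplus>\<^bsub>M\<^esub>b\<in>B. c b \<odot>\<^bsub>M\<^esub> b))"

definition finite_dimensional :: "('k, 'z) ring_scheme \<Rightarrow> ('k, 'a, 'm) module_scheme \<Rightarrow> bool"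
  where "finite_dimensional K M \<longleftrightarrow> (\<exists>B. finite_basis K M B)"


section \<open>Tensor products over a field\<close>

text \<open>
  The tensor product of \<open>M\<close> and \<open>N\<close> is the free module on \<open>carrier M \<times> carrier N\<close> modulo the
  submodule generated by the bilinearity relations; its elements are cosets.
\<close>

type_synonym ('k, 'a, 'b) tensor = "('a \<times> 'b \<Rightarrow> 'k) set"

definition free_module :: "('k, 'z) ring_scheme \<Rightarrow> 's set \<Rightarrow> ('k, 's \<Rightarrow> 'k) module"
  where "free_module K S =
    \<lparr>carrier = {u. u ` S \<subseteq> carrier K \<and> (\<forall>s. s \<notin> S \<longrightarrow> u s = \<zero>\<^bsub>K\<^esub>) \<and> finite {s. u s \<noteq> \<zero>\<^bsub>K\<^esub>}},
     monoid.mult = undefined, one = undefined,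
     zero = (\<lambda>s. \<zero>\<^bsub>K\<^esub>), add = (\<lambda>u v s. u s \<oplus>\<^bsub>K\<^esub> v s), smult = (\<lambda>k u s. k \<otimes>\<^bsub>K\<^esub> u s)\<rparr>"

definition free_gen :: "('k, 'z) ring_scheme \<Rightarrow> 's \<Rightarrow> 's \<Rightarrow> 'k"
  where "free_gen K s = (\<lambda>t. if t = s then \<one>\<^bsub>K\<^esub> else \<zero>\<^bsub>K\<^esub>)"

abbreviation free_pairs ::
  "('k, 'z) ring_scheme \<Rightarrow> ('k, 'a, 'm) module_scheme \<Rightarrow> ('k, 'b, 'n) module_scheme
    \<Rightarrow> ('k, 'a \<times> 'b \<Rightarrow> 'k) module"
  where "free_pairs K M N \<equiv> free_module K (carrier M \<times> carrier N)"

inductive_set bilinear_relations ::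
  "('k, 'z) ring_scheme \<Rightarrow> ('k, 'a, 'm) module_scheme \<Rightarrow> ('k, 'b, 'n) module_scheme
    \<Rightarrow> ('a \<times> 'b \<Rightarrow> 'k) set"
  for K :: "('k, 'z) ring_scheme" and M :: "('k, 'a, 'm) module_scheme"
    and N :: "('k, 'b, 'n) module_scheme"
  where
    add_left: "\<lbrakk>a \<in> carrier M; a' \<in> carrier M; b \<in> carrier N\<rbrakk> \<Longrightarrow>
      free_gen K (a \<oplus>\<^bsub>M\<^esub> a', b) \<ominus>\<^bsub>free_pairs K M N\<^esub>
        (free_gen K (a, b) \<oplus>\<^bsub>free_pairs K M N\<^esub> free_gen K (a', b)) \<in> bilinear_relations K M N"
  | add_right: "\<lbrakk>a \<in> carrier M; b \<in> carrier N; b' \<in> carrier N\<rbrakk> \<Longrightarrow>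
      free_gen K (a, b \<oplus>\<^bsub>N\<^esub> b') \<ominus>\<^bsub>free_pairs K M N\<^esub>
        (free_gen K (a, b) \<oplus>\<^bsub>free_pairs K M N\<^esub> free_gen K (a, b')) \<in> bilinear_relations K M N"
  | smult_left: "\<lbrakk>k \<in> carrier K; a \<in> carrier M; b \<in> carrier N\<rbrakk> \<Longrightarrow>
      free_gen K (k \<odot>\<^bsub>M\<^esub> a, b) \<ominus>\<^bsub>free_pairs K M N\<^esub>
        k \<odot>\<^bsub>free_pairs K M N\<^esub> free_gen K (a, b) \<in> bilinear_relations K M N"
  | smult_right: "\<lbrakk>k \<in> carrier K; a \<in> carrier M; b \<in> carrier N\<rbrakk> \<Longrightarrow>
      free_gen K (a, k \<odot>\<^bsub>N\<^esub> b) \<ominus>\<^bsub>free_pairs K M N\<^esub>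
        k \<odot>\<^bsub>free_pairs K M N\<^esub> free_gen K (a, b) \<in> bilinear_relations K M N"
  | zero: "\<zero>\<^bsub>free_pairs K M N\<^esub> \<in> bilinear_relations K M N"
  | add: "\<lbrakk>u \<in> bilinear_relations K M N; v \<in> bilinear_relations K M N\<rbrakk> \<Longrightarrow>
      u \<oplus>\<^bsub>free_pairs K M N\<^esub> v \<in> bilinear_relations K M N"
  | smult: "\<lbrakk>k \<in> carrier K; u \<in> bilinear_relations K M N\<rbrakk> \<Longrightarrow>
      k \<odot>\<^bsub>free_pairs K M N\<^esub> u \<in> bilinear_relations K M N"

definition pure_tensor ::
  "('k, 'z) ring_scheme \<Rightarrow> ('k, 'a, 'm) module_scheme \<Rightarrow> ('k, 'b, 'n) module_scheme
    \<Rightarrow> 'a \<Rightarrow> 'b \<Rightarrow> ('k, 'a, 'b) tensor"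
  where "pure_tensor K M N a b = bilinear_relations K M N +>\<^bsub>free_pairs K M N\<^esub> free_gen K (a, b)"

definition tensor_module ::
  "('k, 'z) ring_scheme \<Rightarrow> ('k, 'a, 'm) module_scheme \<Rightarrow> ('k, 'b, 'n) module_scheme
    \<Rightarrow> ('k, ('k, 'a, 'b) tensor) module"
  where "tensor_module K M N =
    \<lparr>carrier = a_rcosets\<^bsub>free_pairs K M N\<^esub> (bilinear_relations K M N),
     monoid.mult = undefined, one = undefined,
     zero = bilinear_relations K M N,
     add = set_add (free_pairs K M N),
     smult = (\<lambda>k t. \<Union>u\<in>t. bilinear_relations K M N +>\<^bsub>free_pairs K M N\<^esub>
                              (k \<odot>\<^bsub>free_pairs K M N\<^esub> u))\<rparr>"

text \<open>
  \<open>tensor_lift K P f\<close> is the linear map into \<open>P\<close> induced by a bilinear map \<open>f\<close>, i.e. it sends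
  \<open>a \<otimes> b\<close> to \<open>f a b\<close>. It is evaluated on an arbitrary representative of the coset; bilinearity
  of \<open>f\<close> makes the value independent of that choice, and the definition is used
  for bilinear \<open>f\<close> only. Sweedler notation is rendered through it: an expression
  \<open>f t\<^sub>(\<^sub>1\<^sub>) t\<^sub>(\<^sub>2\<^sub>)\<close> is \<open>tensor_lift K P f\<close> applied to the tensor \<open>t\<close>.
\<close>

definition tensor_lift ::
  "('k, 'z) ring_scheme \<Rightarrow> ('k, 'c, 'p) module_scheme \<Rightarrow> ('a \<Rightarrow> 'b \<Rightarrow> 'c)
    \<Rightarrow> ('k, 'a, 'b) tensor \<Rightarrow> 'c"
  where "tensor_lift K P f t =
    (let u = (SOME u. u \<in> t)
      in \<Oplus>\<^bsub>P\<^esub>s\<in>{s. u s \<noteq> \<zero>\<^bsub>K\<^esub>}. u s \<odot>\<^bsub>P\<^esub> f (fst s) (snd s))"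

text \<open>
  For algebras \<open>A\<close> and \<open>B\<close>, the tensor product carries the product
  \<open>(a \<otimes> b) (a' \<otimes> b') = a a' \<otimes> b b'\<close>.
\<close>

definition tensor ::
  "('k, 'z) ring_scheme \<Rightarrow> ('k, 'a, 'm) module_scheme \<Rightarrow> ('k, 'b, 'n) module_scheme
    \<Rightarrow> ('k, ('k, 'a, 'b) tensor) module"
  where "tensor K A B = (tensor_module K A B)
    \<lparr>monoid.mult := (\<lambda>s t.
        tensor_lift K (tensor_module K A B) (\<lambda>a b.
          tensor_lift K (tensor_module K A B) (\<lambda>a' b'.
            pure_tensor K A B (a \<otimes>\<^bsub>A\<^esub> a') (b \<otimes>\<^bsub>B\<^esub> b')) t) s),
     one := pure_tensor K A B \<one>\<^bsub>A\<^esub> \<one>\<^bsub>B\<^esub>\<rparr>"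

definition tensor_map ::
  "('k, 'z) ring_scheme \<Rightarrow> ('k, 'c, 'p) module_scheme \<Rightarrow> ('k, 'd, 'q) module_scheme
    \<Rightarrow> ('a \<Rightarrow> 'c) \<Rightarrow> ('b \<Rightarrow> 'd) \<Rightarrow> ('k, 'a, 'b) tensor \<Rightarrow> ('k, 'c, 'd) tensor"
  \<comment> \<open>\<open>f \<otimes> g\<close>; \<open>P\<close> and \<open>Q\<close> are the codomains of \<open>f\<close> and \<open>g\<close>\<close>
  where "tensor_map K P Q f g =
    tensor_lift K (tensor K P Q) (\<lambda>a b. pure_tensor K P Q (f a) (g b))"

definition tensor_flip ::
  "('k, 'z) ring_scheme \<Rightarrow> ('k, 'a, 'm) module_scheme \<Rightarrow> ('k, 'b, 'n) module_scheme
    \<Rightarrow> ('k, 'a, 'b) tensor \<Rightarrow> ('k, 'b, 'a) tensor"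
  where "tensor_flip K M N =
    tensor_lift K (tensor K N M) (\<lambda>a b. pure_tensor K N M b a)"

definition tensor_assoc ::
  "('k, 'z) ring_scheme \<Rightarrow> ('k, 'a, 'm) module_scheme \<Rightarrow> ('k, 'b, 'n) module_scheme
    \<Rightarrow> ('k, 'c, 'p) module_scheme
    \<Rightarrow> ('k, ('k, 'a, 'b) tensor, 'c) tensor \<Rightarrow> ('k, 'a, ('k, 'b, 'c) tensor) tensor"
  \<comment> \<open>\<open>(a \<otimes> b) \<otimes> c \<mapsto> a \<otimes> (b \<otimes> c)\<close>\<close>
  where "tensor_assoc K L M N =
    tensor_lift K (tensor K L (tensor K M N)) (\<lambda>t c.
      tensor_lift K (tensor K L (tensor K M N)) (\<lambda>a b.
        pure_tensor K L (tensor K M N) a (pure_tensor K M N b c)) t)"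

definition mult_map ::
  "('k, 'z) ring_scheme \<Rightarrow> ('k, 'a, 'm) module_scheme \<Rightarrow> ('k, 'a, 'a) tensor \<Rightarrow> 'a"
  where "mult_map K A = tensor_lift K A (\<lambda>a b. a \<otimes>\<^bsub>A\<^esub> b)"


section \<open>Hopf algebras and their duals\<close>

record ('k, 'h) hopf = "('k, 'h) module" +
  comult :: "'h \<Rightarrow> ('k, 'h, 'h) tensor"
  counit :: "'h \<Rightarrow> 'k"
  antipode :: "'h \<Rightarrow> 'h"

locale hopf_algebra = unital_algebra K H
  for K :: "('k, 'z) ring_scheme" (structure) and H :: "('k, 'h, 'm) hopf_scheme" (structure) +
  assumes comult_hom: "comult H \<in> algebra_homs K H (tensor K H H)"
    and counit_hom: "counit H \<in> algebra_homs K H (base_module K)"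
    and coassoc: "h \<in> carrier H \<Longrightarrow>
      tensor_assoc K H H H (tensor_map K (tensor K H H) H (comult H) id (comult H h)) =
      tensor_map K H (tensor K H H) id (comult H) (comult H h)"
    and counit_left: "h \<in> carrier H \<Longrightarrow>
      tensor_lift K H (\<lambda>a b. counit H a \<odot>\<^bsub>H\<^esub> b) (comult H h) = h"
    and counit_right: "h \<in> carrier H \<Longrightarrow>
      tensor_lift K H (\<lambda>a b. counit H b \<odot>\<^bsub>H\<^esub> a) (comult H h) = h"
    and antipode_linear: "antipode H \<in> linear_maps K H H"
    and antipode_left: "h \<in> carrier H \<Longrightarrow>
      mult_map K H (tensor_map K H H (antipode H) id (comult H h)) = counit H h \<odot>\<^bsub>H\<^esub> \<one>\<^bsub>H\<^esub>"
    and antipode_right: "h \<in> carrier H \<Longrightarrow>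
      mult_map K H (tensor_map K H H id (antipode H) (comult H h)) = counit H h \<odot>\<^bsub>H\<^esub> \<one>\<^bsub>H\<^esub>"

definition antipode_inv :: "('k, 'h, 'm) hopf_scheme \<Rightarrow> 'h \<Rightarrow> 'h"
  where "antipode_inv H = inv_into (carrier H) (antipode H)"

definition pairing :: "'h \<Rightarrow> ('h \<Rightarrow> 'k) \<Rightarrow> 'k"
  where "pairing h \<theta> = \<theta> h"

definition dual_algebra ::
  "('k, 'z) ring_scheme \<Rightarrow> ('k, 'h, 'm) hopf_scheme \<Rightarrow> ('k, 'h \<Rightarrow> 'k) module"
  where "dual_algebra K H =
    \<lparr>carrier = linear_maps K H (base_module K) \<inter> extensional (carrier H),
     monoid.mult = (\<lambda>\<theta> \<theta>'. \<lambda>h\<in>carrier H.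
       tensor_lift K (base_module K) (\<lambda>h1 h2. pairing h1 \<theta> \<otimes>\<^bsub>K\<^esub> pairing h2 \<theta>') (comult H h)),
     one = restrict (counit H) (carrier H),
     zero = (\<lambda>h\<in>carrier H. \<zero>\<^bsub>K\<^esub>),
     add = (\<lambda>\<theta> \<theta>'. \<lambda>h\<in>carrier H. \<theta> h \<oplus>\<^bsub>K\<^esub> \<theta>' h),
     smult = (\<lambda>k \<theta>. \<lambda>h\<in>carrier H. k \<otimes>\<^bsub>K\<^esub> \<theta> h)\<rparr>"

text \<open>
  The comultiplication of the dual is characterised by
  \<open>p(h h', \<theta>) = p(h, \<theta>\<^sub>(\<^sub>1\<^sub>)) p(h', \<theta>\<^sub>(\<^sub>2\<^sub>))\<close>; such a tensor exists (uniquely) because \<open>H\<close> is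
  finite-dimensional.
\<close>

definition dual_hopf ::
  "('k, 'z) ring_scheme \<Rightarrow> ('k, 'h, 'm) hopf_scheme \<Rightarrow> ('k, 'h \<Rightarrow> 'k) hopf"
  where "dual_hopf K H = module.extend (dual_algebra K H)
    (hopf.fields
      (\<lambda>\<theta>. THE t. t \<in> carrier (tensor K (dual_algebra K H) (dual_algebra K H)) \<and>
        (\<forall>h\<in>carrier H. \<forall>h'\<in>carrier H.
          tensor_lift K (base_module K) (\<lambda>\<theta>1 \<theta>2. pairing h \<theta>1 \<otimes>\<^bsub>K\<^esub> pairing h' \<theta>2) t
            = pairing (h \<otimes>\<^bsub>H\<^esub> h') \<theta>))
      (\<lambda>\<theta>. pairing \<one>\<^bsub>H\<^esub> \<theta>)
      (\<lambda>\<theta>. \<lambda>h\<in>carrier H. pairing (antipode H h) \<theta>))"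

definition dual_vector ::
  "('k, 'z) ring_scheme \<Rightarrow> ('k, 'h, 'm) hopf_scheme \<Rightarrow> 'h set \<Rightarrow> 'h \<Rightarrow> 'h \<Rightarrow> 'k"
  where "dual_vector K H B b = (THE \<theta>. \<theta> \<in> carrier (dual_hopf K H) \<and>
    (\<forall>b'\<in>B. \<theta> b' = (if b' = b then \<one>\<^bsub>K\<^esub> else \<zero>\<^bsub>K\<^esub>)))"

definition canonical_element ::
  "('k, 'z) ring_scheme \<Rightarrow> ('k, 'h, 'm) hopf_scheme \<Rightarrow> ('k, 'h, 'h \<Rightarrow> 'k) tensor"
  \<comment> \<open>\<open>U\<close>; it does not depend on the chosen basis\<close>
  where "canonical_element K H =
    (let B = (SOME B. finite_basis K H B)
      in \<Oplus>\<^bsub>tensor K H (dual_hopf K H)\<^esub>b\<in>B. pure_tensor K H (dual_hopf K H) b (dual_vector K H B b))"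

text \<open>
  The Heisenberg algebra of the dual, with
  \<open>(\<theta> # h) (\<theta>' # h') = \<theta> \<theta>'\<^sub>(\<^sub>1\<^sub>) p(h\<^sub>(\<^sub>1\<^sub>), \<theta>'\<^sub>(\<^sub>2\<^sub>)) # h\<^sub>(\<^sub>2\<^sub>) h'\<close>.
\<close>

definition heisenberg ::
  "('k, 'z) ring_scheme \<Rightarrow> ('k, 'h, 'm) hopf_scheme \<Rightarrow> ('k, ('k, 'h \<Rightarrow> 'k, 'h) tensor) module"
  where "heisenberg K H =
    (let D = dual_hopf K H; V = tensor K D H in V
      \<lparr>monoid.mult := (\<lambda>s t.
        tensor_lift K V (\<lambda>\<theta> h.
          tensor_lift K V (\<lambda>\<theta>' h'.
            tensor_lift K V (\<lambda>\<theta>'1 \<theta>'2.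
              tensor_lift K V (\<lambda>h1 h2.
                pairing h1 \<theta>'2 \<odot>\<^bsub>V\<^esub> pure_tensor K D H (\<theta> \<otimes>\<^bsub>D\<^esub> \<theta>'1) (h2 \<otimes>\<^bsub>H\<^esub> h'))
              (comult H h))
            (comult D \<theta>'))
          t)
        s),
       one := pure_tensor K D H \<one>\<^bsub>D\<^esub> \<one>\<^bsub>H\<^esub>\<rparr>)"


section \<open>Coactions and Yetter-Drinfeld algebras\<close>

definition left_coaction ::
  "('k, 'z) ring_scheme \<Rightarrow> ('k, 'h, 'm) hopf_scheme \<Rightarrow> ('k, 'x, 'n) module_scheme
    \<Rightarrow> ('x \<Rightarrow> ('k, 'h, 'x) tensor) \<Rightarrow> bool"
  where "left_coaction K H X \<beta> \<longleftrightarrow> \<beta> \<in> algebra_homs K X (tensor K H X) \<and>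
    (\<forall>x\<in>carrier X.
      tensor_map K H (tensor K H X) id \<beta> (\<beta> x) =
        tensor_assoc K H H X (tensor_map K (tensor K H H) X (comult H) id (\<beta> x)) \<and>
      tensor_lift K X (\<lambda>h y. counit H h \<odot>\<^bsub>X\<^esub> y) (\<beta> x) = x)"

definition right_coaction ::
  "('k, 'z) ring_scheme \<Rightarrow> ('k, 'h, 'm) hopf_scheme \<Rightarrow> ('k, 'x, 'n) module_scheme
    \<Rightarrow> ('x \<Rightarrow> ('k, 'x, 'h) tensor) \<Rightarrow> bool"
  where "right_coaction K H X \<alpha> \<longleftrightarrow> \<alpha> \<in> algebra_homs K X (tensor K X H) \<and>
    (\<forall>x\<in>carrier X.
      tensor_assoc K X H H (tensor_map K (tensor K X H) H \<alpha> id (\<alpha> x)) =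
        tensor_map K X (tensor K H H) id (comult H) (\<alpha> x) \<and>
      tensor_lift K X (\<lambda>y h. counit H h \<odot>\<^bsub>X\<^esub> y) (\<alpha> x) = x)"

definition leg13 ::
  "('k, 'z) ring_scheme \<Rightarrow> ('k, 'a, 'm) module_scheme \<Rightarrow> ('k, 'x, 'n) module_scheme
    \<Rightarrow> ('k, 'b, 'p) module_scheme
    \<Rightarrow> ('k, 'a, 'b) tensor \<Rightarrow> ('k, 'a, ('k, 'x, 'b) tensor) tensor"
  where "leg13 K A X B =
    tensor_lift K (tensor K A (tensor K X B))
      (\<lambda>a b. pure_tensor K A (tensor K X B) a (pure_tensor K X B \<one>\<^bsub>X\<^esub> b))"

definition Ad :: "('a, 'm) monoid_scheme \<Rightarrow> 'a \<Rightarrow> 'a \<Rightarrow> 'a"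
  where "Ad A w z = w \<otimes>\<^bsub>A\<^esub> z \<otimes>\<^bsub>A\<^esub> inv\<^bsub>A\<^esub> w"

definition yetter_drinfeld_algebra ::
  "('k, 'z) ring_scheme \<Rightarrow> ('k, 'h, 'm) hopf_scheme \<Rightarrow> ('k, 'x, 'n) module_scheme
    \<Rightarrow> ('x \<Rightarrow> ('k, 'x, 'h) tensor) \<Rightarrow> ('x \<Rightarrow> ('k, 'h \<Rightarrow> 'k, 'x) tensor) \<Rightarrow> bool"
  \<comment> \<open>right-left Yetter-Drinfeld algebras over \<open>H\<close> and its dual\<close>
  where "yetter_drinfeld_algebra K H X \<alpha> \<beta> \<longleftrightarrow>
    unital_algebra K X \<and> right_coaction K H X \<alpha> \<and> left_coaction K (dual_hopf K H) X \<beta> \<and>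
    (let D = dual_hopf K H;
         W = leg13 K D X H (inv\<^bsub>tensor K D H\<^esub> (tensor_flip K H D (canonical_element K H)))
      in \<forall>x\<in>carrier X.
        tensor_map K D (tensor K X H) id \<alpha> (\<beta> x) =
          Ad (tensor K D (tensor K X H)) W
            (tensor_assoc K D X H (tensor_map K (tensor K D X) H \<beta> id (\<alpha> x))))"


section \<open>Braided commutativity\<close>

definition heisenberg_braided_commutative ::
  "('k, 'z) ring_scheme \<Rightarrow> ('k, 'h, 'm) hopf_scheme \<Rightarrow> ('k, 'x, 'n) module_scheme
    \<Rightarrow> ('x \<Rightarrow> ('k, 'x, 'h) tensor) \<Rightarrow> ('x \<Rightarrow> ('k, 'h \<Rightarrow> 'k, 'x) tensor) \<Rightarrow> bool"
  where "heisenberg_braided_commutative K H X \<alpha> \<beta> \<longleftrightarrow>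
    (let D = dual_hopf K H;
         XH = tensor K X H;
         XD = tensor K X D;
         Z = tensor K X (heisenberg K H);
         \<iota>1 = tensor_map K X (heisenberg K H) id (\<lambda>\<theta>. pure_tensor K D H \<theta> \<one>\<^bsub>H\<^esub>);
         \<iota>2 = tensor_map K X (heisenberg K H) id (\<lambda>h. pure_tensor K D H \<one>\<^bsub>D\<^esub> h)
      in \<forall>x\<in>carrier X. \<forall>y\<in>carrier X.
        mult_map K Z (tensor_map K Z Z \<iota>2 \<iota>1 (pure_tensor K XH XD (\<alpha> x) (tensor_flip K D X (\<beta> y)))) =
        mult_map K Z (tensor_map K Z Z \<iota>1 \<iota>2 (pure_tensor K XD XH (tensor_flip K D X (\<beta> y)) (\<alpha> x))))"

definition coaction_action ::
  "('k, 'z) ring_scheme \<Rightarrow> ('k, 'x, 'n) module_scheme \<Rightarrow> ('x \<Rightarrow> ('k, 'h \<Rightarrow> 'k, 'x) tensor)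
    \<Rightarrow> 'x \<Rightarrow> 'h \<Rightarrow> 'x"
  \<comment> \<open>the right action of \<open>H\<close> induced by the left coaction \<open>\<beta>\<close> of its dual\<close>
  where "coaction_action K X \<beta> x h =
    tensor_lift K X (\<lambda>\<theta> y. pairing h \<theta> \<odot>\<^bsub>X\<^esub> y) (\<beta> x)"

definition braided_commutative ::
  "('k, 'z) ring_scheme \<Rightarrow> ('k, 'h, 'm) hopf_scheme \<Rightarrow> ('k, 'x, 'n) module_scheme
    \<Rightarrow> ('x \<Rightarrow> 'h \<Rightarrow> 'x) \<Rightarrow> ('x \<Rightarrow> ('k, 'x, 'h) tensor) \<Rightarrow> bool"
  \<comment> \<open>for a right-right Yetter-Drinfeld algebra with action \<open>act\<close> and coaction \<open>\<alpha>\<close>\<close>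
  where "braided_commutative K H X act \<alpha> \<longleftrightarrow>
    (\<forall>x\<in>carrier X. \<forall>y\<in>carrier X.
      x \<otimes>\<^bsub>X\<^esub> y =
        tensor_lift K X (\<lambda>x0 x1. act y (antipode_inv H x1) \<otimes>\<^bsub>X\<^esub> x0) (\<alpha> x))"

end

theory Submission
  imports Defs
begin

text \<open>
  Write \<open>\<alpha>(x) = x\<^sub>0 \<otimes> x\<^sub>1\<close>, write \<open>\<beta>(y) = \<theta> \<otimes> y\<^sub>0\<close>, and let \<open>y \<lhd> h\<close> be the
  action \<open>coaction_action\<close> induced by \<open>\<beta>\<close>. Both notions of braided commutativity turn out to be
  equivalent to the same identity
    \<open>x\<^sub>0 (y \<lhd> x\<^sub>1) = y x\<close> for all \<open>x\<close>, \<open>y\<close>,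
  whose left-hand side is called \<open>braided_mult x y\<close> below.

  For the Heisenberg condition, multiplying out its left-hand side gives the coproducts of the
  \<open>H\<close>-leg of \<open>\<alpha>(x)\<close> and of the dual leg of \<open>\<beta>(y)\<close>, paired with each other in one leg. The
  coaction axioms turn these coproducts into iterated coactions, and the pairing then becomes an
  action: the left-hand side is \<open>braided_mult x\<^sub>0 y\<^sub>0 \<otimes> \<theta> # x\<^sub>1\<close> (\<open>heisenberg_left\<close>). The
  right-hand side is \<open>y\<^sub>0 x\<^sub>0 \<otimes> \<theta> # x\<^sub>1\<close> (\<open>heisenberg_right\<close>). Thus the condition follows from the
  identity above, and applying the counits of \<open>H\<close> and of its dual to the last two legs
  (\<open>contract_spread\<close>) recovers the identity from the condition.

  For the condition \<open>x y = (y \<lhd> S\<^sup>-\<^sup>1(x\<^sub>1)) x\<^sub>0\<close>, either of the two identities is substituted into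
  the other with \<open>x\<^sub>0\<close> in place of \<open>x\<close> and with \<open>y\<close> acted upon by \<open>S\<^sup>-\<^sup>1(x\<^sub>1)\<close> or \<open>x\<^sub>1\<close>
  (\<open>braided_commutative_iff\<close>). Because \<open>\<lhd>\<close> is a right action (\<open>act_act\<close>), the result
  collapses by \<open>S\<^sup>-\<^sup>1(h\<^sub>2) h\<^sub>1 = \<epsilon>(h) 1 = h\<^sub>2 S\<^sup>-\<^sup>1(h\<^sub>1)\<close> (\<open>antipode_inv_sweedler\<close>). These follow
  by applying the antipode, once it is known to be antimultiplicative (\<open>antipode_mult\<close>); the
  latter is a consequence of the uniqueness of convolution inverses.

  All of this is computed with \<open>tensor_lift\<close> in the role of Sweedler notation. What makes that
  possible is the universal property of the tensor product, derived from its construction as a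
  quotient of a free module, and the existence and uniqueness of the coproduct of the dual, which is
  where the finite basis enters.
\<close>

section \<open>Linear and bilinear maps\<close>

definition bilinear_maps ::
  "('k, 'z) ring_scheme \<Rightarrow> ('k, 'a, 'm) module_scheme \<Rightarrow> ('k, 'b, 'n) module_scheme
    \<Rightarrow> ('k, 'c, 'p) module_scheme \<Rightarrow> ('a \<Rightarrow> 'b \<Rightarrow> 'c) set"
  where "bilinear_maps K M N P =
    {f. (\<forall>b\<in>carrier N. (\<lambda>a. f a b) \<in> linear_maps K M P) \<and>
        (\<forall>a\<in>carrier M. (\<lambda>b. f a b) \<in> linear_maps K N P)}"

lemma linear_mapsI:
  assumes "\<And>x. x \<in> carrier M \<Longrightarrow> f x \<in> carrier N"
    and "\<And>x y. \<lbrakk>x \<in> carrier M; y \<in> carrier M\<rbrakk> \<Longrightarrow> f (x \<oplus>\<^bsub>M\<^esub> y) = f x \<oplus>\<^bsub>N\<^esub> f y"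
    and "\<And>k x. \<lbrakk>k \<in> carrier K; x \<in> carrier M\<rbrakk> \<Longrightarrow> f (k \<odot>\<^bsub>M\<^esub> x) = k \<odot>\<^bsub>N\<^esub> f x"
  shows "f \<in> linear_maps K M N"
  using assms by (auto simp: linear_maps_def)

lemma linear_maps_closed: "\<lbrakk>f \<in> linear_maps K M N; x \<in> carrier M\<rbrakk> \<Longrightarrow> f x \<in> carrier N"
  and linear_maps_add: "\<lbrakk>f \<in> linear_maps K M N; x \<in> carrier M; y \<in> carrier M\<rbrakk>
    \<Longrightarrow> f (x \<oplus>\<^bsub>M\<^esub> y) = f x \<oplus>\<^bsub>N\<^esub> f y"
  and linear_maps_smult: "\<lbrakk>f \<in> linear_maps K M N; k \<in> carrier K; x \<in> carrier M\<rbrakk>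
    \<Longrightarrow> f (k \<odot>\<^bsub>M\<^esub> x) = k \<odot>\<^bsub>N\<^esub> f x"
  by (auto simp: linear_maps_def)

lemma linear_maps_zero:
  assumes "module K M" "module K N" "f \<in> linear_maps K M N"
  shows "f \<zero>\<^bsub>M\<^esub> = \<zero>\<^bsub>N\<^esub>"
proof -
  interpret M: module K M by fact
  interpret N: module K N by fact
  have "f (\<zero>\<^bsub>K\<^esub> \<odot>\<^bsub>M\<^esub> \<zero>\<^bsub>M\<^esub>) = \<zero>\<^bsub>K\<^esub> \<odot>\<^bsub>N\<^esub> f \<zero>\<^bsub>M\<^esub>"
    using assms(3) by (intro linear_maps_smult) auto
  then show ?thesis
    using linear_maps_closed[OF assms(3) M.zero_closed] by simp
qed

lemma linear_maps_finsum:
  assumes "module K M" "module K N" "f \<in> linear_maps K M N"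
    and "finite B" "g \<in> B \<rightarrow> carrier M"
  shows "f (\<Oplus>\<^bsub>M\<^esub>b\<in>B. g b) = (\<Oplus>\<^bsub>N\<^esub>b\<in>B. f (g b))"
proof -
  interpret M: module K M by fact
  interpret N: module K N by fact
  show ?thesis
    using assms(4,5)
  proof (induction B rule: finite_induct)
    case empty
    then show ?case
      using linear_maps_zero[OF assms(1-3)] by simp
  next
    case (insert b B)
    then have "(\<lambda>b. f (g b)) \<in> insert b B \<rightarrow> carrier N"
      using linear_maps_closed[OF assms(3)] by (auto simp: Pi_iff)
    with insert show ?case
      by (simp add: Pi_def M.finsum_closed linear_maps_add[OF assms(3)])
  qed
qed

lemma bilinear_mapsI:
  assumes "\<And>b. b \<in> carrier N \<Longrightarrow> (\<lambda>a. f a b) \<in> linear_maps K M P"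
    and "\<And>a. a \<in> carrier M \<Longrightarrow> (\<lambda>b. f a b) \<in> linear_maps K N P"
  shows "(\<lambda>a b. f a b) \<in> bilinear_maps K M N P"
  using assms by (simp add: bilinear_maps_def)

lemma bilinear_maps_left: "\<lbrakk>f \<in> bilinear_maps K M N P; b \<in> carrier N\<rbrakk>
    \<Longrightarrow> (\<lambda>a. f a b) \<in> linear_maps K M P"
  and bilinear_maps_right: "\<lbrakk>f \<in> bilinear_maps K M N P; a \<in> carrier M\<rbrakk>
    \<Longrightarrow> (\<lambda>b. f a b) \<in> linear_maps K N P"
  by (simp_all add: bilinear_maps_def)

lemma bilinear_maps_closed: "\<lbrakk>f \<in> bilinear_maps K M N P; a \<in> carrier M; b \<in> carrier N\<rbrakk>
    \<Longrightarrow> f a b \<in> carrier P"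
  by (auto dest: bilinear_maps_left linear_maps_closed)

section \<open>The tensor product and its universal property\<close>

lemma free_module_module:
  fixes K :: "('k, 'z) ring_scheme" and S :: "'s set"
  assumes "cring K"
  shows "module K (free_module K S)"
proof -
  interpret cring K by fact
  have fin: "finite {s. u s \<oplus>\<^bsub>K\<^esub> v s \<noteq> \<zero>\<^bsub>K\<^esub>}"
    if "finite {s. u s \<noteq> \<zero>\<^bsub>K\<^esub>}" "finite {s. v s \<noteq> \<zero>\<^bsub>K\<^esub>}" for u v :: "'s \<Rightarrow> 'k"
    by (rule finite_subset[OF _ finite_UnI[OF that]]) auto
  have fin': "finite {s. k \<otimes>\<^bsub>K\<^esub> u s \<noteq> \<zero>\<^bsub>K\<^esub>}"
    if "finite {s. u s \<noteq> \<zero>\<^bsub>K\<^esub>}" "k \<in> carrier K" for k and u :: "'s \<Rightarrow> 'k"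
    by (rule finite_subset[OF _ that(1)]) (use that(2) in auto)
  have el: "u s \<in> carrier K" if "u \<in> carrier (free_module K S)" for u s
    using that by (cases "s \<in> S") (auto simp: free_module_def)
  show ?thesis
  proof (rule moduleI[OF assms abelian_groupI])
    fix u assume u: "u \<in> carrier (free_module K S)"
    let ?v = "\<lambda>s. \<ominus>\<^bsub>K\<^esub> u s"
    have "{s. ?v s \<noteq> \<zero>\<^bsub>K\<^esub>} \<subseteq> {s. u s \<noteq> \<zero>\<^bsub>K\<^esub>}"
      by auto
    then have "?v \<in> carrier (free_module K S)"
      using u by (auto simp: free_module_def intro: finite_subset)
    moreover have "?v \<oplus>\<^bsub>free_module K S\<^esub> u = \<zero>\<^bsub>free_module K S\<^esub>"
      using el[OF u] by (simp add: free_module_def l_neg)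
    ultimately show "\<exists>v\<in>carrier (free_module K S).
        v \<oplus>\<^bsub>free_module K S\<^esub> u = \<zero>\<^bsub>free_module K S\<^esub>"
      by blast
  next
    fix u v assume uv: "u \<in> carrier (free_module K S)" "v \<in> carrier (free_module K S)"
    show "u \<oplus>\<^bsub>free_module K S\<^esub> v \<in> carrier (free_module K S)"
      using uv by (auto simp: free_module_def fin)
    show "u \<oplus>\<^bsub>free_module K S\<^esub> v = v \<oplus>\<^bsub>free_module K S\<^esub> u"
      using el[OF uv(1)] el[OF uv(2)] by (simp add: free_module_def a_comm)
    fix k l assume k: "k \<in> carrier K" "l \<in> carrier K"
    show "k \<odot>\<^bsub>free_module K S\<^esub> u \<in> carrier (free_module K S)"
      using k uv by (auto simp: free_module_def fin')
    show "(k \<oplus>\<^bsub>K\<^esub> l) \<odot>\<^bsub>free_module K S\<^esub> u =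
        k \<odot>\<^bsub>free_module K S\<^esub> u \<oplus>\<^bsub>free_module K S\<^esub> l \<odot>\<^bsub>free_module K S\<^esub> u"
      "k \<odot>\<^bsub>free_module K S\<^esub> (u \<oplus>\<^bsub>free_module K S\<^esub> v) =
        k \<odot>\<^bsub>free_module K S\<^esub> u \<oplus>\<^bsub>free_module K S\<^esub> k \<odot>\<^bsub>free_module K S\<^esub> v"
      "(k \<otimes>\<^bsub>K\<^esub> l) \<odot>\<^bsub>free_module K S\<^esub> u =
        k \<odot>\<^bsub>free_module K S\<^esub> (l \<odot>\<^bsub>free_module K S\<^esub> u)"
      using k el[OF uv(1)] el[OF uv(2)]
      by (simp_all add: free_module_def l_distr r_distr m_assoc)
  next
    fix u v w assume uv: "u \<in> carrier (free_module K S)" "v \<in> carrier (free_module K S)"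
      "w \<in> carrier (free_module K S)"
    show "u \<oplus>\<^bsub>free_module K S\<^esub> v \<oplus>\<^bsub>free_module K S\<^esub> w =
        u \<oplus>\<^bsub>free_module K S\<^esub> (v \<oplus>\<^bsub>free_module K S\<^esub> w)"
      using el[OF uv(1)] el[OF uv(2)] el[OF uv(3)] by (simp add: free_module_def a_assoc)
  next
    fix u assume u: "u \<in> carrier (free_module K S)"
    show "\<zero>\<^bsub>free_module K S\<^esub> \<oplus>\<^bsub>free_module K S\<^esub> u = u" "\<one>\<^bsub>K\<^esub> \<odot>\<^bsub>free_module K S\<^esub> u = u"
      using el[OF u] by (simp_all add: free_module_def)
  qed (auto simp: free_module_def)
qed

lemma free_gen_closed:
  assumes "cring K" "s \<in> S"
  shows "free_gen K s \<in> carrier (free_module K S)"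
proof -
  interpret cring K by fact
  have "{t. free_gen K s t \<noteq> \<zero>\<^bsub>K\<^esub>} \<subseteq> {s}"
    by (auto simp: free_gen_def)
  then show ?thesis
    using assms(2) by (auto simp: free_module_def free_gen_def intro: finite_subset)
qed

lemma free_module_el:
  assumes "cring K" "u \<in> carrier (free_module K S)"
  shows "u s \<in> carrier K" "u s \<noteq> \<zero>\<^bsub>K\<^esub> \<Longrightarrow> s \<in> S" "finite {s. u s \<noteq> \<zero>\<^bsub>K\<^esub>}"
proof -
  interpret cring K by fact
  show "u s \<in> carrier K" "u s \<noteq> \<zero>\<^bsub>K\<^esub> \<Longrightarrow> s \<in> S" "finite {s. u s \<noteq> \<zero>\<^bsub>K\<^esub>}"
    using assms(2) by (cases "s \<in> S"; auto simp: free_module_def)+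
qed

lemma free_moduleI:
  assumes "\<And>s. u s \<in> carrier K" "\<And>s. u s \<noteq> \<zero>\<^bsub>K\<^esub> \<Longrightarrow> s \<in> S" "finite {s. u s \<noteq> \<zero>\<^bsub>K\<^esub>}"
  shows "u \<in> carrier (free_module K S)"
  using assms by (auto simp: free_module_def)

lemma bilinear_relations_submodule:
  assumes "module K M" "module K N"
  shows "submodule (bilinear_relations K M N) K (free_pairs K M N)"
proof -
  interpret M: module K M by fact
  interpret N: module K N by fact
  have K: "cring K" ..
  interpret F: module K "free_pairs K M N"
    by (rule free_module_module[OF K])
  note gen = free_gen_closed[OF K]
  have sub: "u \<in> carrier (free_pairs K M N)" if "u \<in> bilinear_relations K M N" for u
    using that by induction (auto intro!: F.minus_closed F.smult_closed F.a_closed gen)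
  show ?thesis
  proof (rule F.submoduleI)
    fix u assume u: "u \<in> bilinear_relations K M N"
    have "(\<ominus>\<^bsub>K\<^esub> \<one>\<^bsub>K\<^esub>) \<odot>\<^bsub>free_pairs K M N\<^esub> u \<in> bilinear_relations K M N"
      using u by (intro bilinear_relations.smult) auto
    then show "\<ominus>\<^bsub>free_pairs K M N\<^esub> u \<in> bilinear_relations K M N"
      using sub[OF u] by (simp add: F.smult_l_minus)
  qed (auto intro: sub bilinear_relations.intros)
qed

text \<open>
  Cosets are handled in this locale only. What leaves it is the module structure, the induction over
  pure tensors and the universal property.
\<close>

locale two_modules = M: module K M + N: module K N
  for K :: "('k, 'z) ring_scheme" and M :: "('k, 'a, 'm) module_scheme"
    and N :: "('k, 'b, 'n) module_scheme"
begin

abbreviation "F \<equiv> free_pairs K M N"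
abbreviation "R \<equiv> bilinear_relations K M N"
abbreviation "T \<equiv> tensor_module K M N"
abbreviation "cls u \<equiv> R +>\<^bsub>F\<^esub> u"

lemma cring_K: "cring K" ..

sublocale F: module K F
  by (rule free_module_module[OF cring_K])

sublocale R: submodule R K F
  by (rule bilinear_relations_submodule) unfold_locales

sublocale R: abelian_subgroup R F
  by (rule abelian_subgroupI3) (unfold_locales, auto intro: R.subgroup_axioms additive_subgroup.intro)

lemma cls_eqI:
  assumes "u \<in> carrier F" "v \<in> carrier F" "u \<ominus>\<^bsub>F\<^esub> v \<in> R"
  shows "cls u = cls v"
  using assms R.a_rcos_module_rev[of v u] R.a_repr_independence'[of u v] by (simp add: a_minus_def)

lemma cls_memD:
  assumes "u \<in> carrier F" "v \<in> cls u"
  shows "v \<in> carrier F" "v \<ominus>\<^bsub>F\<^esub> u \<in> R"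
  using assms R.a_elemrcos_carrier R.a_rcos_module_imp by (auto simp: a_minus_def)

lemma carrier_T: "carrier T = cls ` carrier F"
  by (auto simp: tensor_module_def A_RCOSETS_def')

lemma zero_T: "\<zero>\<^bsub>T\<^esub> = cls \<zero>\<^bsub>F\<^esub>"
  using R.a_rcos_const[OF R.zero_closed] by (simp add: tensor_module_def)

lemma add_T: "\<lbrakk>u \<in> carrier F; v \<in> carrier F\<rbrakk> \<Longrightarrow> cls u \<oplus>\<^bsub>T\<^esub> cls v = cls (u \<oplus>\<^bsub>F\<^esub> v)"
  by (simp add: tensor_module_def R.a_rcos_sum)

lemma smult_T:
  assumes "k \<in> carrier K" "u \<in> carrier F"
  shows "k \<odot>\<^bsub>T\<^esub> cls u = cls (k \<odot>\<^bsub>F\<^esub> u)"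
proof -
  have eq: "cls (k \<odot>\<^bsub>F\<^esub> v) = cls (k \<odot>\<^bsub>F\<^esub> u)" if "v \<in> cls u" for v
  proof (rule cls_eqI)
    note v = cls_memD[OF assms(2) that]
    show kv: "k \<odot>\<^bsub>F\<^esub> v \<in> carrier F" and ku: "k \<odot>\<^bsub>F\<^esub> u \<in> carrier F"
      by (rule F.smult_closed; fact)+
    have "k \<odot>\<^bsub>F\<^esub> (v \<ominus>\<^bsub>F\<^esub> u) \<in> R"
      by (rule R.smult_closed) fact+
    also have "k \<odot>\<^bsub>F\<^esub> (v \<ominus>\<^bsub>F\<^esub> u) = k \<odot>\<^bsub>F\<^esub> v \<ominus>\<^bsub>F\<^esub> k \<odot>\<^bsub>F\<^esub> u"
      using assms v(1) by (simp add: a_minus_def F.smult_r_distr F.smult_r_minus)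
    finally show "k \<odot>\<^bsub>F\<^esub> v \<ominus>\<^bsub>F\<^esub> k \<odot>\<^bsub>F\<^esub> u \<in> R" .
  qed
  have "u \<in> cls u"
    by (rule R.a_rcos_self) fact
  then have "(\<Union>v\<in>cls u. cls (k \<odot>\<^bsub>F\<^esub> v)) = cls (k \<odot>\<^bsub>F\<^esub> u)"
    by (intro SUP_eq_const eq) blast
  then show ?thesis
    by (simp add: tensor_module_def)
qed

lemma module_T: "module K T"
proof (rule moduleI[OF cring_K abelian_groupI])
  fix t assume "t \<in> carrier T"
  then obtain u where u: "t = cls u" "u \<in> carrier F"
    by (auto simp: carrier_T)
  show "\<exists>s\<in>carrier T. s \<oplus>\<^bsub>T\<^esub> t = \<zero>\<^bsub>T\<^esub>"
    by (rule bexI[of _ "cls (\<ominus>\<^bsub>F\<^esub> u)"]) (use u in \<open>auto simp: add_T zero_T carrier_T F.l_neg\<close>)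
qed (auto simp: carrier_T zero_T add_T smult_T F.a_ac F.smult_l_distr F.smult_r_distr
    F.smult_assoc1)

lemma gen_closed: "\<lbrakk>a \<in> carrier M; b \<in> carrier N\<rbrakk> \<Longrightarrow> free_gen K (a, b) \<in> carrier F"
  by (rule free_gen_closed[OF cring_K]) simp

lemma pure_bilinear: "(\<lambda>a b. pure_tensor K M N a b) \<in> bilinear_maps K M N T"
proof -
  have cl: "pure_tensor K M N a b \<in> carrier T" if "a \<in> carrier M" "b \<in> carrier N" for a b
    using that by (simp add: pure_tensor_def carrier_T gen_closed)
  have al: "pure_tensor K M N (a \<oplus>\<^bsub>M\<^esub> a') b = pure_tensor K M N a b \<oplus>\<^bsub>T\<^esub> pure_tensor K M N a' b"
    if "a \<in> carrier M" "a' \<in> carrier M" "b \<in> carrier N" for a a' b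
    unfolding pure_tensor_def using that
    by (simp add: add_T smult_T gen_closed) (rule cls_eqI; simp add: gen_closed bilinear_relations.intros)
  have sl: "pure_tensor K M N (k \<odot>\<^bsub>M\<^esub> a) b = k \<odot>\<^bsub>T\<^esub> pure_tensor K M N a b"
    if "k \<in> carrier K" "a \<in> carrier M" "b \<in> carrier N" for k a b
    unfolding pure_tensor_def using that
    by (simp add: add_T smult_T gen_closed) (rule cls_eqI; simp add: gen_closed bilinear_relations.intros)
  have ar: "pure_tensor K M N a (b \<oplus>\<^bsub>N\<^esub> b') = pure_tensor K M N a b \<oplus>\<^bsub>T\<^esub> pure_tensor K M N a b'"
    if "a \<in> carrier M" "b \<in> carrier N" "b' \<in> carrier N" for a b b'
    unfolding pure_tensor_def using that
    by (simp add: add_T smult_T gen_closed) (rule cls_eqI; simp add: gen_closed bilinear_relations.intros)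
  have sr: "pure_tensor K M N a (k \<odot>\<^bsub>N\<^esub> b) = k \<odot>\<^bsub>T\<^esub> pure_tensor K M N a b"
    if "k \<in> carrier K" "a \<in> carrier M" "b \<in> carrier N" for k a b
    unfolding pure_tensor_def using that
    by (simp add: add_T smult_T gen_closed) (rule cls_eqI; simp add: gen_closed bilinear_relations.intros)
  show ?thesis
    by (rule bilinear_mapsI; rule linear_mapsI; (rule cl al sl ar sr; assumption))
qed

text \<open>A finitely supported function is built up from zero by adding one weighted generator at a time:
  induction on the size of the support.\<close>

lemma free_induct:
  assumes "u \<in> carrier F" "Q \<zero>\<^bsub>F\<^esub>"
    and step: "\<And>k a b u. \<lbrakk>k \<in> carrier K; a \<in> carrier M; b \<in> carrier N; u \<in> carrier F; Q u\<rbrakk>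
      \<Longrightarrow> Q (k \<odot>\<^bsub>F\<^esub> free_gen K (a, b) \<oplus>\<^bsub>F\<^esub> u)"
  shows "Q u"
  using assms(1)
proof (induction "card {s. u s \<noteq> \<zero>\<^bsub>K\<^esub>}" arbitrary: u)
  case 0
  then have "u = \<zero>\<^bsub>F\<^esub>"
    by (auto simp: free_module_def)
  then show ?case
    using assms(2) by simp
next
  case (Suc n)
  then have "{s. u s \<noteq> \<zero>\<^bsub>K\<^esub>} \<noteq> {}"
    by (metis card.empty nat.distinct(1))
  then obtain s where s: "u s \<noteq> \<zero>\<^bsub>K\<^esub>"
    by auto
  let ?v = "u(s := \<zero>\<^bsub>K\<^esub>)"
  note el = free_module_el[OF cring_K Suc.prems]
  have supp: "{t. ?v t \<noteq> \<zero>\<^bsub>K\<^esub>} = {t. u t \<noteq> \<zero>\<^bsub>K\<^esub>} - {s}"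
    by auto
  have v: "?v \<in> carrier F"
  proof (rule free_moduleI)
    show "?v t \<in> carrier K" for t
      using el(1) by simp
    show "t \<in> carrier M \<times> carrier N" if "?v t \<noteq> \<zero>\<^bsub>K\<^esub>" for t
      using that el(2)[of t] by (cases "t = s") simp_all
    show "finite {t. ?v t \<noteq> \<zero>\<^bsub>K\<^esub>}"
      unfolding supp using el(3) by simp
  qed
  have "n = card {t. ?v t \<noteq> \<zero>\<^bsub>K\<^esub>}"
    unfolding supp using Suc.hyps(2) el(3) s by (simp add: card_Diff_singleton)
  then have "Q ?v"
    using v by (rule Suc.hyps(1))
  moreover have "u = u s \<odot>\<^bsub>F\<^esub> free_gen K s \<oplus>\<^bsub>F\<^esub> ?v"
    using el(1) by (simp add: free_module_def free_gen_def fun_eq_iff)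
  moreover have "fst s \<in> carrier M" "snd s \<in> carrier N"
    using el(2)[OF s] by auto
  ultimately show ?case
    using step[of "u s" "fst s" "snd s" ?v] v el(1) by simp
qed

text \<open>The scalar in front of a generator is absorbed into the first tensor factor, so sums of pure
  tensors without coefficients suffice.\<close>

lemma T_induct:
  assumes "t \<in> carrier T" "Q \<zero>\<^bsub>T\<^esub>"
    and step: "\<And>a b t. \<lbrakk>a \<in> carrier M; b \<in> carrier N; t \<in> carrier T; Q t\<rbrakk>
      \<Longrightarrow> Q (pure_tensor K M N a b \<oplus>\<^bsub>T\<^esub> t)"
  shows "Q t"
proof -
  obtain u where u: "t = cls u" "u \<in> carrier F"
    using assms(1) by (auto simp: carrier_T)
  have "Q (cls u)"
  proof (rule free_induct[OF u(2)])
    show "Q (cls \<zero>\<^bsub>F\<^esub>)"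
      using assms(2) unfolding zero_T .
  next
    fix k a b u
    assume *: "k \<in> carrier K" "a \<in> carrier M" "b \<in> carrier N" "u \<in> carrier F" "Q (cls u)"
    have "cls (k \<odot>\<^bsub>F\<^esub> free_gen K (a, b)) = pure_tensor K M N (k \<odot>\<^bsub>M\<^esub> a) b"
      using * linear_maps_smult[OF bilinear_maps_left[OF pure_bilinear], of b k a] smult_T[of k "free_gen K (a, b)"]
      by (simp add: pure_tensor_def gen_closed)
    then show "Q (cls (k \<odot>\<^bsub>F\<^esub> free_gen K (a, b) \<oplus>\<^bsub>F\<^esub> u))"
      using * step[of "k \<odot>\<^bsub>M\<^esub> a" b "cls u"] by (simp add: carrier_T gen_closed flip: add_T)
  qed
  then show ?thesis
    using u by simp
qed

text \<open>The linear extension of \<open>f\<close> to the free module, which is the value that \<open>tensor_lift\<close> takes on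
  a chosen representative.\<close>

definition eval :: "('k, 'c, 'p) module_scheme \<Rightarrow> ('a \<Rightarrow> 'b \<Rightarrow> 'c) \<Rightarrow> ('a \<times> 'b \<Rightarrow> 'k) \<Rightarrow> 'c"
  where "eval P f u = (\<Oplus>\<^bsub>P\<^esub>s\<in>{s. u s \<noteq> \<zero>\<^bsub>K\<^esub>}. u s \<odot>\<^bsub>P\<^esub> f (fst s) (snd s))"

text \<open>Enlarging the index set beyond the support makes it possible to compare the sums for \<open>u\<close>, \<open>v\<close> and
  \<open>u + v\<close>, whose supports differ.\<close>

lemma eval_eq_sum:
  assumes "module K P" "f \<in> bilinear_maps K M N P" "u \<in> carrier F"
    and "finite A" "{s. u s \<noteq> \<zero>\<^bsub>K\<^esub>} \<subseteq> A" "A \<subseteq> carrier M \<times> carrier N"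
  shows "eval P f u = (\<Oplus>\<^bsub>P\<^esub>s\<in>A. u s \<odot>\<^bsub>P\<^esub> f (fst s) (snd s))"
proof -
  interpret P: module K P by fact
  note el = free_module_el[OF cring_K assms(3)]
  have "f (fst s) (snd s) \<in> carrier P" if "s \<in> A" for s
    using that assms(6) bilinear_maps_closed[OF assms(2)] by auto
  then show ?thesis
    unfolding eval_def using assms(4,5) el(1)
    by (intro P.add.finprod_mono_neutral_cong_left) auto
qed

lemma eval_linear:
  assumes P: "module K P" and f: "f \<in> bilinear_maps K M N P"
  shows "eval P f \<in> linear_maps K F P"
proof -
  interpret P: module K P by fact
  have cl: "f (fst s) (snd s) \<in> carrier P" if "s \<in> carrier M \<times> carrier N" for s
    using that bilinear_maps_closed[OF f] by auto
  have fin: "finite {s. u s \<noteq> \<zero>\<^bsub>K\<^esub>}" "{s. u s \<noteq> \<zero>\<^bsub>K\<^esub>} \<subseteq> carrier M \<times> carrier N"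
    and el: "u s \<in> carrier K" if "u \<in> carrier F" for u s
    using free_module_el[OF cring_K that] by auto
  show ?thesis
  proof (rule linear_mapsI)
    fix u assume u: "u \<in> carrier F"
    show "eval P f u \<in> carrier P"
      unfolding eval_def using fin(2)[OF u] el[OF u] cl by (intro P.finsum_closed) auto
  next
    fix u v assume u: "u \<in> carrier F" and v: "v \<in> carrier F"
    let ?A = "{s. u s \<noteq> \<zero>\<^bsub>K\<^esub>} \<union> {s. v s \<noteq> \<zero>\<^bsub>K\<^esub>}"
    have A: "finite ?A" "?A \<subseteq> carrier M \<times> carrier N"
      using fin[OF u] fin[OF v] by auto
    have uv: "(u \<oplus>\<^bsub>F\<^esub> v) s = u s \<oplus>\<^bsub>K\<^esub> v s" for s
      by (simp add: free_module_def)
    have "eval P f (u \<oplus>\<^bsub>F\<^esub> v) = (\<Oplus>\<^bsub>P\<^esub>s\<in>?A. (u \<oplus>\<^bsub>F\<^esub> v) s \<odot>\<^bsub>P\<^esub> f (fst s) (snd s))"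
      using u v by (intro eval_eq_sum[OF P f _ A(1) _ A(2)]) (auto simp: uv)
    also have "\<dots> = (\<Oplus>\<^bsub>P\<^esub>s\<in>?A. u s \<odot>\<^bsub>P\<^esub> f (fst s) (snd s) \<oplus>\<^bsub>P\<^esub> v s \<odot>\<^bsub>P\<^esub> f (fst s) (snd s))"
      using cl A(2) el[OF u] el[OF v]
      by (intro P.finsum_cong') (auto simp: uv P.smult_l_distr)
    also have "\<dots> = eval P f u \<oplus>\<^bsub>P\<^esub> eval P f v"
      using cl A el[OF u] el[OF v]
      by (subst P.finsum_addf) (auto simp: eval_eq_sum[OF P f u A(1) _ A(2)] eval_eq_sum[OF P f v A(1) _ A(2)])
    finally show "eval P f (u \<oplus>\<^bsub>F\<^esub> v) = eval P f u \<oplus>\<^bsub>P\<^esub> eval P f v" .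
  next
    fix k u assume k: "k \<in> carrier K" and u: "u \<in> carrier F"
    let ?A = "{s. u s \<noteq> \<zero>\<^bsub>K\<^esub>}"
    have A: "finite ?A" "?A \<subseteq> carrier M \<times> carrier N"
      using fin[OF u] by auto
    have ku: "(k \<odot>\<^bsub>F\<^esub> u) s = k \<otimes>\<^bsub>K\<^esub> u s" for s
      by (simp add: free_module_def)
    have "eval P f (k \<odot>\<^bsub>F\<^esub> u) = (\<Oplus>\<^bsub>P\<^esub>s\<in>?A. (k \<odot>\<^bsub>F\<^esub> u) s \<odot>\<^bsub>P\<^esub> f (fst s) (snd s))"
      using u k by (intro eval_eq_sum[OF P f _ A(1) _ A(2)]) (auto simp: ku)
    also have "\<dots> = (\<Oplus>\<^bsub>P\<^esub>s\<in>?A. k \<odot>\<^bsub>P\<^esub> (u s \<odot>\<^bsub>P\<^esub> f (fst s) (snd s)))"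
      using cl A(2) el[OF u] k by (intro P.finsum_cong') (auto simp: ku P.smult_assoc1)
    also have "\<dots> = k \<odot>\<^bsub>P\<^esub> eval P f u"
      unfolding eval_def using cl A el[OF u] k by (intro P.finsum_smult_ldistr[symmetric]) auto
    finally show "eval P f (k \<odot>\<^bsub>F\<^esub> u) = k \<odot>\<^bsub>P\<^esub> eval P f u" .
  qed
qed

lemma eval_gen:
  assumes P: "module K P" and f: "f \<in> bilinear_maps K M N P"
    and ab: "a \<in> carrier M" "b \<in> carrier N"
  shows "eval P f (free_gen K (a, b)) = f a b"
proof -
  interpret P: module K P by fact
  have "eval P f (free_gen K (a, b)) =
      (\<Oplus>\<^bsub>P\<^esub>s\<in>{(a, b)}. free_gen K (a, b) s \<odot>\<^bsub>P\<^esub> f (fst s) (snd s))"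
    using ab by (intro eval_eq_sum[OF P f gen_closed]) (auto simp: free_gen_def)
  also have "\<dots> = f a b"
    using bilinear_maps_closed[OF f ab] by (simp add: free_gen_def)
  finally show ?thesis .
qed

lemma eval_minus:
  assumes P: "module K P" and f: "f \<in> bilinear_maps K M N P" and "u \<in> carrier F" "v \<in> carrier F"
  shows "eval P f (u \<ominus>\<^bsub>F\<^esub> v) = eval P f u \<ominus>\<^bsub>P\<^esub> eval P f v"
proof -
  interpret P: module K P by fact
  note lin = eval_linear[OF P f]
  have "eval P f (\<ominus>\<^bsub>F\<^esub> v) = \<ominus>\<^bsub>P\<^esub> eval P f v"
    using assms(4) linear_maps_smult[OF lin, of "\<ominus>\<^bsub>K\<^esub> \<one>\<^bsub>K\<^esub>" v] linear_maps_closed[OF lin assms(4)]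
    by (simp add: P.smult_l_minus F.smult_l_minus)
  then show ?thesis
    using assms by (simp add: a_minus_def linear_maps_add[OF lin])
qed

lemma eval_relations:
  assumes P: "module K P" and f: "f \<in> bilinear_maps K M N P" and u: "u \<in> R"
  shows "eval P f u = \<zero>\<^bsub>P\<^esub>"
proof -
  interpret P: module K P by fact
  note lin = eval_linear[OF P f]
  note bil = bilinear_maps_left[OF f] bilinear_maps_right[OF f]
  note simps = eval_minus[OF P f] linear_maps_add[OF lin] linear_maps_smult[OF lin]
    eval_gen[OF P f] gen_closed bilinear_maps_closed[OF f]
    linear_maps_add[OF bil(1)] linear_maps_add[OF bil(2)]
    linear_maps_smult[OF bil(1)] linear_maps_smult[OF bil(2)]
  show ?thesis
    using u
  proof induction
    case zero
    show ?case
      using linear_maps_zero[OF _ P lin] F.module_axioms by simp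
  qed (simp_all add: simps P.r_neg a_minus_def[of P] R.a_Hcarr)
qed

text \<open>Two representatives of a coset differ by a bilinearity relation, which \<open>eval\<close> sends to zero.
  Hence the choice in \<open>tensor_lift\<close> is immaterial.\<close>

lemma lift_cls:
  assumes P: "module K P" and f: "f \<in> bilinear_maps K M N P" and u: "u \<in> carrier F"
  shows "tensor_lift K P f (cls u) = eval P f u"
proof -
  interpret P: module K P by fact
  define v where "v = (SOME v. v \<in> cls u)"
  have "v \<in> cls u"
    unfolding v_def by (rule someI[of _ u]) (rule R.a_rcos_self[OF u])
  note v = cls_memD[OF u this]
  have "eval P f v \<ominus>\<^bsub>P\<^esub> eval P f u = \<zero>\<^bsub>P\<^esub>"
    using eval_relations[OF P f v(2)] eval_minus[OF P f v(1) u] by simp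
  then have "eval P f v = eval P f u"
    using v(1) u linear_maps_closed[OF eval_linear[OF P f]]
    by (metis P.add.inv_closed P.minus_equality P.minus_minus a_minus_def)
  then show ?thesis
    by (simp add: tensor_lift_def eval_def Let_def flip: v_def)
qed

end

lemma tensor_simps:
  "carrier (tensor K M N) = carrier (tensor_module K M N)"
  "\<zero>\<^bsub>tensor K M N\<^esub> = \<zero>\<^bsub>tensor_module K M N\<^esub>"
  "s \<oplus>\<^bsub>tensor K M N\<^esub> t = s \<oplus>\<^bsub>tensor_module K M N\<^esub> t"
  "k \<odot>\<^bsub>tensor K M N\<^esub> t = k \<odot>\<^bsub>tensor_module K M N\<^esub> t"
  by (simp_all add: tensor_def)

lemma linear_maps_tensor_module:
  "linear_maps K (tensor K M N) P = linear_maps K (tensor_module K M N) P"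
  "linear_maps K P (tensor K M N) = linear_maps K P (tensor_module K M N)"
  by (simp_all add: linear_maps_def tensor_simps)

text \<open>The definition of the product on \<open>tensor\<close> lifts into \<open>tensor_module\<close>, everything else into
  \<open>tensor\<close>; this lemma reconciles the two.\<close>

lemma tensor_lift_tensor_module:
  "tensor_lift K (tensor_module K M N) f = tensor_lift K (tensor K M N) f"
  by (simp add: fun_eq_iff tensor_lift_def finsum_def tensor_simps Let_def tensor_def)

lemma module_tensor:
  assumes "module K M" "module K N"
  shows "module K (tensor K M N)"
proof -
  interpret two_modules K M N
    using assms by (rule two_modules.intro)
  interpret T: module K "tensor_module K M N"
    by (rule module_T)
  show ?thesis
  proof (rule moduleI[OF cring_K abelian_groupI])
    fix t assume "t \<in> carrier (tensor K M N)"
    then show "\<exists>s\<in>carrier (tensor K M N). s \<oplus>\<^bsub>tensor K M N\<^esub> t = \<zero>\<^bsub>tensor K M N\<^esub>"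
      unfolding tensor_simps by (rule abelian_groupE(6)[OF T.abelian_group_axioms])
  qed (auto simp: tensor_simps T.a_ac T.smult_l_distr T.smult_r_distr T.smult_assoc1)
qed

lemma pure_tensor_bilinear:
  assumes "module K M" "module K N"
  shows "pure_tensor K M N \<in> bilinear_maps K M N (tensor K M N)"
proof -
  interpret two_modules K M N
    using assms by (rule two_modules.intro)
  show ?thesis
    using pure_bilinear by (simp add: bilinear_maps_def linear_maps_tensor_module)
qed

lemma tensor_induct [consumes 3, case_names zero add]:
  assumes "module K M" "module K N" "t \<in> carrier (tensor K M N)"
    and "Q \<zero>\<^bsub>tensor K M N\<^esub>"
    and "\<And>a b t. \<lbrakk>a \<in> carrier M; b \<in> carrier N; t \<in> carrier (tensor K M N); Q t\<rbrakk>
      \<Longrightarrow> Q (pure_tensor K M N a b \<oplus>\<^bsub>tensor K M N\<^esub> t)"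
  shows "Q t"
proof -
  interpret two_modules K M N
    using assms(1,2) by (rule two_modules.intro)
  show ?thesis
    using assms(3-) T_induct[of t Q] by (simp add: tensor_simps)
qed

lemma tensor_lift_linear:
  assumes "module K M" "module K N" and P: "module K P" and f: "f \<in> bilinear_maps K M N P"
  shows "tensor_lift K P f \<in> linear_maps K (tensor K M N) P"
proof -
  interpret two_modules K M N
    using assms(1,2) by (rule two_modules.intro)
  note lin = eval_linear[OF P f]
  show ?thesis
    by (rule linear_mapsI)
       (auto simp: tensor_simps carrier_T add_T smult_T lift_cls[OF P f] linear_maps_closed[OF lin]
          linear_maps_add[OF lin] linear_maps_smult[OF lin])
qed

lemma tensor_lift_pure:
  assumes "module K M" "module K N" "module K P" "f \<in> bilinear_maps K M N P"
    and "a \<in> carrier M" "b \<in> carrier N"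
  shows "tensor_lift K P f (pure_tensor K M N a b) = f a b"
proof -
  interpret two_modules K M N
    using assms(1,2) by (rule two_modules.intro)
  show ?thesis
    using assms(3-) by (simp add: pure_tensor_def lift_cls gen_closed eval_gen)
qed

lemma tensor_ext:
  assumes M: "module K M" and N: "module K N" and P: "module K P"
    and g: "g \<in> linear_maps K (tensor K M N) P" and h: "h \<in> linear_maps K (tensor K M N) P"
    and eq: "\<And>a b. \<lbrakk>a \<in> carrier M; b \<in> carrier N\<rbrakk>
      \<Longrightarrow> g (pure_tensor K M N a b) = h (pure_tensor K M N a b)"
    and t: "t \<in> carrier (tensor K M N)"
  shows "g t = h t"
  using M N t
proof (induction t rule: tensor_induct)
  case zero
  show ?case
    using linear_maps_zero[OF module_tensor[OF M N] P g] linear_maps_zero[OF module_tensor[OF M N] P h] by simp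
next
  case (add a b t)
  then have "pure_tensor K M N a b \<in> carrier (tensor K M N)"
    by (intro bilinear_maps_closed[OF pure_tensor_bilinear[OF M N]])
  with add show ?case
    by (simp add: eq linear_maps_add[OF g] linear_maps_add[OF h])
qed

lemma bilinear_maps_cong:
  assumes M: "module K M" and N: "module K N" and f: "f \<in> bilinear_maps K M N P"
    and eq: "\<And>a b. \<lbrakk>a \<in> carrier M; b \<in> carrier N\<rbrakk> \<Longrightarrow> f a b = g a b"
  shows "g \<in> bilinear_maps K M N P"
proof -
  interpret M: module K M by fact
  interpret N: module K N by fact
  have "(\<lambda>a b. g a b) \<in> bilinear_maps K M N P"
    using bilinear_maps_closed[OF f]
      linear_maps_add[OF bilinear_maps_left[OF f]] linear_maps_add[OF bilinear_maps_right[OF f]]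
      linear_maps_smult[OF bilinear_maps_left[OF f]] linear_maps_smult[OF bilinear_maps_right[OF f]]
    by (intro bilinear_mapsI linear_mapsI) (simp_all flip: eq)
  then show ?thesis .
qed

lemma tensor_lift_cong:
  assumes M: "module K M" and N: "module K N" and P: "module K P"
    and t: "t \<in> carrier (tensor K M N)" and f: "f \<in> bilinear_maps K M N P"
    and eq: "\<And>a b. \<lbrakk>a \<in> carrier M; b \<in> carrier N\<rbrakk> \<Longrightarrow> f a b = g a b"
  shows "tensor_lift K P f t = tensor_lift K P g t"
proof -
  have g: "g \<in> bilinear_maps K M N P"
    by (rule bilinear_maps_cong[OF M N f eq])
  show ?thesis
    by (rule tensor_ext[OF M N P _ _ _ t])
       (auto intro!: tensor_lift_linear M N P f g simp: tensor_lift_pure[OF M N P] f g eq)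
qed

section \<open>Multilinearity of Sweedler expressions\<close>

lemma linear_id: "(\<lambda>x. x) \<in> linear_maps K M M"
  by (simp add: linear_maps_def)

lemma linear_compose:
  assumes "f \<in> linear_maps K M N" "g \<in> linear_maps K Q M"
  shows "(\<lambda>x. f (g x)) \<in> linear_maps K Q N"
  using assms by (auto simp: linear_maps_def Pi_def)

lemma bilinear_compose_left:
  assumes "f \<in> bilinear_maps K M N P" "g \<in> linear_maps K Q M" "b \<in> carrier N"
  shows "(\<lambda>x. f (g x) b) \<in> linear_maps K Q P"
  using linear_compose[OF bilinear_maps_left[OF assms(1,3)] assms(2)] .

lemma bilinear_compose_right:
  assumes "f \<in> bilinear_maps K M N P" "g \<in> linear_maps K Q N" "a \<in> carrier M"
  shows "(\<lambda>x. f a (g x)) \<in> linear_maps K Q P"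
  using linear_compose[OF bilinear_maps_right[OF assms(1,3)] assms(2)] .

text \<open>Linearity in a parameter of the lifted bilinear map, as opposed to linearity in the tensor. It is
  this rule that lets Sweedler expressions be nested.\<close>

lemma tensor_lift_linear_fun:
  assumes t: "t \<in> carrier (tensor K M N)"
    and M: "module K M" and N: "module K N" and P: "module K P" and Q: "module K Q"
    and f: "\<And>x. x \<in> carrier Q \<Longrightarrow> f x \<in> bilinear_maps K M N P"
    and lin: "\<And>a b. \<lbrakk>a \<in> carrier M; b \<in> carrier N\<rbrakk> \<Longrightarrow> (\<lambda>x. f x a b) \<in> linear_maps K Q P"
  shows "(\<lambda>x. tensor_lift K P (f x) t) \<in> linear_maps K Q P"
proof -
  interpret P: module K P by fact
  interpret Q: module K Q by fact
  note lift = tensor_lift_linear[OF M N P f]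
  note closed = linear_maps_closed[OF lift]
  show ?thesis
    using M N t
  proof (induction t rule: tensor_induct)
    case zero
    show ?case
      by (rule linear_mapsI) (simp_all add: linear_maps_zero[OF module_tensor[OF M N] P lift])
  next
    case (add a b t)
    then have pure: "pure_tensor K M N a b \<in> carrier (tensor K M N)"
      by (intro bilinear_maps_closed[OF pure_tensor_bilinear[OF M N]])
    have split: "tensor_lift K P (f x) (pure_tensor K M N a b \<oplus>\<^bsub>tensor K M N\<^esub> t)
        = f x a b \<oplus>\<^bsub>P\<^esub> tensor_lift K P (f x) t" if "x \<in> carrier Q" for x
      using linear_maps_add[OF lift[OF that] pure add(3)] tensor_lift_pure[OF M N P f[OF that] add(1,2)]
      by simp
    have cl: "f x a b \<in> carrier P" "tensor_lift K P (f x) t \<in> carrier P" if "x \<in> carrier Q" for x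
      using closed[OF that add(3)] bilinear_maps_closed[OF f[OF that] add(1,2)] by simp_all
    note l = lin[OF add(1,2)]
    show ?case
      by (rule linear_mapsI)
         (auto simp: split cl linear_maps_add[OF l] linear_maps_add[OF add(4)] linear_maps_smult[OF l]
           linear_maps_smult[OF add(4)] P.smult_r_distr P.a_ac)
  qed
qed

lemma tensor_lift_linear_arg:
  assumes "g \<in> linear_maps K Q (tensor K M N)" "module K M" "module K N" "module K P"
    and "f \<in> bilinear_maps K M N P"
  shows "(\<lambda>x. tensor_lift K P f (g x)) \<in> linear_maps K Q P"
  using linear_compose[OF tensor_lift_linear[OF assms(2-5)] assms(1)] .

lemma tensor_lift_closed:
  assumes "t \<in> carrier (tensor K M N)" "module K M" "module K N" "module K P"
    and "f \<in> bilinear_maps K M N P"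
  shows "tensor_lift K P f t \<in> carrier P"
  using linear_maps_closed[OF tensor_lift_linear[OF assms(2-5)] assms(1)] .

text \<open>Both sides are linear in the tensor and agree on pure tensors. Read from left to right, a linear
  map is pulled into a Sweedler expression; read backwards, a factor is pulled out.\<close>

lemma linear_tensor_lift:
  assumes t: "t \<in> carrier (tensor K M N)" and M: "module K M" and N: "module K N"
    and P: "module K P" and Q: "module K Q"
    and g: "g \<in> linear_maps K P Q" and f: "f \<in> bilinear_maps K M N P"
  shows "g (tensor_lift K P f t) = tensor_lift K Q (\<lambda>a b. g (f a b)) t"
proof -
  have gf: "(\<lambda>a b. g (f a b)) \<in> bilinear_maps K M N Q"
    by (intro bilinear_mapsI linear_compose[OF g] bilinear_maps_left[OF f] bilinear_maps_right[OF f])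
  show ?thesis
    by (rule tensor_ext[OF M N Q _ _ _ t])
       (auto intro!: linear_compose[OF g] tensor_lift_linear M N P Q f gf
         simp: tensor_lift_pure[OF M N] P Q f gf)
qed

text \<open>Independent Sweedler sums may be interchanged; by linearity it is enough to look at a pure tensor
  for the outer sum.\<close>

lemma tensor_lift_swap:
  assumes s: "s \<in> carrier (tensor K M N)" and t: "t \<in> carrier (tensor K M' N')"
    and M: "module K M" and N: "module K N" and M': "module K M'" and N': "module K N'"
    and P: "module K P"
    and f: "\<And>a b. \<lbrakk>a \<in> carrier M; b \<in> carrier N\<rbrakk> \<Longrightarrow> f a b \<in> bilinear_maps K M' N' P"
    and f': "\<And>c d. \<lbrakk>c \<in> carrier M'; d \<in> carrier N'\<rbrakk> \<Longrightarrow> (\<lambda>a b. f a b c d) \<in> bilinear_maps K M N P"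
  shows "tensor_lift K P (\<lambda>a b. tensor_lift K P (f a b) t) s
    = tensor_lift K P (\<lambda>c d. tensor_lift K P (\<lambda>a b. f a b c d) s) t"
proof -
  have 1: "(\<lambda>a b. tensor_lift K P (f a b) t') \<in> bilinear_maps K M N P"
    if "t' \<in> carrier (tensor K M' N')" for t'
    by (assumption | rule M N M' N' P that f bilinear_maps_left[OF f'] bilinear_maps_right[OF f']
        bilinear_mapsI tensor_lift_linear_fun)+
  have 2: "(\<lambda>c d. tensor_lift K P (\<lambda>a b. f a b c d) s') \<in> bilinear_maps K M' N' P"
    if "s' \<in> carrier (tensor K M N)" for s'
    by (assumption | rule M N M' N' P that f' bilinear_maps_left[OF f] bilinear_maps_right[OF f]
        bilinear_mapsI tensor_lift_linear_fun)+
  have lin: "(\<lambda>s. tensor_lift K P (\<lambda>c d. tensor_lift K P (\<lambda>a b. f a b c d) s) t)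
      \<in> linear_maps K (tensor K M N) P"
    by (intro tensor_lift_linear_fun[OF t M' N' P module_tensor[OF M N] 2] tensor_lift_linear
        M N P f')
  show ?thesis
  proof (rule tensor_ext[OF M N P tensor_lift_linear[OF M N P 1[OF t]] lin _ s])
    fix a b assume ab: "a \<in> carrier M" "b \<in> carrier N"
    have "tensor_lift K P (f a b) t
        = tensor_lift K P (\<lambda>c d. tensor_lift K P (\<lambda>a b. f a b c d) (pure_tensor K M N a b)) t"
      by (rule tensor_lift_cong[OF M' N' P t f[OF ab]]) (simp add: tensor_lift_pure M N P f' ab)
    then show "tensor_lift K P (\<lambda>a b. tensor_lift K P (f a b) t) (pure_tensor K M N a b)
        = tensor_lift K P (\<lambda>c d. tensor_lift K P (\<lambda>a b. f a b c d) (pure_tensor K M N a b)) t"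
      by (simp add: tensor_lift_pure[OF M N P 1[OF t] ab])
  qed
qed

lemmas pure_tensor_linear_left = bilinear_compose_left[OF pure_tensor_bilinear]
lemmas pure_tensor_linear_right = bilinear_compose_right[OF pure_tensor_bilinear]
lemmas pure_tensor_closed = bilinear_maps_closed[OF pure_tensor_bilinear]

lemma base_module_simps:
  "carrier (base_module K) = carrier K" "a \<oplus>\<^bsub>base_module K\<^esub> b = a \<oplus>\<^bsub>K\<^esub> b"
  "\<zero>\<^bsub>base_module K\<^esub> = \<zero>\<^bsub>K\<^esub>" "a \<odot>\<^bsub>base_module K\<^esub> b = a \<otimes>\<^bsub>K\<^esub> b"
  "a \<otimes>\<^bsub>base_module K\<^esub> b = a \<otimes>\<^bsub>K\<^esub> b" "\<one>\<^bsub>base_module K\<^esub> = \<one>\<^bsub>K\<^esub>"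
  by (simp_all add: base_module_def)

lemma module_base_module:
  assumes "cring K"
  shows "module K (base_module K)"
proof -
  interpret cring K by fact
  show ?thesis
  proof (rule moduleI[OF assms abelian_groupI])
    fix x assume x: "x \<in> carrier (base_module K)"
    show "\<exists>y\<in>carrier (base_module K). y \<oplus>\<^bsub>base_module K\<^esub> x = \<zero>\<^bsub>base_module K\<^esub>"
      by (rule bexI[of _ "\<ominus>\<^bsub>K\<^esub> x"]) (use x in \<open>simp_all add: base_module_simps l_neg\<close>)
  qed (simp_all add: base_module_simps a_ac m_assoc l_distr r_distr)
qed

lemma smult_bilinear:
  assumes "module K M"
  shows "smult M \<in> bilinear_maps K (base_module K) M M"
proof -
  interpret M: module K M by fact
  have "(\<lambda>k x. k \<odot>\<^bsub>M\<^esub> x) \<in> bilinear_maps K (base_module K) M M"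
    by (intro bilinear_mapsI linear_mapsI)
       (auto simp: base_module_simps M.smult_l_distr M.smult_r_distr M.R.m_comm simp flip: M.smult_assoc1)
  then show ?thesis .
qed

lemmas smult_linear_left = bilinear_compose_left[OF smult_bilinear]
lemmas smult_linear_right = bilinear_compose_right[OF smult_bilinear, unfolded base_module_simps]

lemma mult_bilinear:
  assumes "unital_algebra K A"
  shows "monoid.mult A \<in> bilinear_maps K A A A"
proof -
  interpret A: unital_algebra K A by fact
  have "(\<lambda>a b. a \<otimes>\<^bsub>A\<^esub> b) \<in> bilinear_maps K A A A"
    by (intro bilinear_mapsI linear_mapsI)
       (auto simp: A.smult_mult_left A.smult_mult_right A.l_distr A.r_distr)
  then show ?thesis .
qed

lemmas mult_linear_left = bilinear_compose_left[OF mult_bilinear]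
lemmas mult_linear_right = bilinear_compose_right[OF mult_bilinear]

section \<open>Sweedler form of the maps between tensor products\<close>

lemma tensor_map_linear:
  assumes "module K M" "module K N" "module K P" "module K Q"
    and "f \<in> linear_maps K M P" "g \<in> linear_maps K N Q"
  shows "tensor_map K P Q f g \<in> linear_maps K (tensor K M N) (tensor K P Q)"
  unfolding tensor_map_def
  by (intro tensor_lift_linear bilinear_mapsI pure_tensor_linear_left pure_tensor_linear_right
      module_tensor assms linear_maps_closed[OF assms(5)] linear_maps_closed[OF assms(6)])

lemma tensor_lift_tensor_map:
  assumes t: "t \<in> carrier (tensor K M N)"
    and M: "module K M" and N: "module K N" and P: "module K P" and Q: "module K Q" and L: "module K L"
    and f: "f \<in> linear_maps K M P" and g: "g \<in> linear_maps K N Q"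
    and h: "h \<in> bilinear_maps K P Q L"
  shows "tensor_lift K L h (tensor_map K P Q f g t) = tensor_lift K L (\<lambda>a b. h (f a) (g b)) t"
proof -
  have "tensor_lift K L h (tensor_map K P Q f g t)
      = tensor_lift K L (\<lambda>a b. tensor_lift K L h (pure_tensor K P Q (f a) (g b))) t"
    unfolding tensor_map_def
    by (rule linear_tensor_lift[OF t M N])
       (intro tensor_lift_linear bilinear_mapsI pure_tensor_linear_left pure_tensor_linear_right
         module_tensor assms linear_maps_closed[OF f] linear_maps_closed[OF g])+
  also have "\<dots> = tensor_lift K L (\<lambda>a b. h (f a) (g b)) t"
  proof (rule sym, rule tensor_lift_cong[OF M N L t])
    show "(\<lambda>a b. h (f a) (g b)) \<in> bilinear_maps K M N L"
      by (intro bilinear_mapsI bilinear_compose_left[OF h] bilinear_compose_right[OF h] f g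
          linear_maps_closed[OF f] linear_maps_closed[OF g])
  qed (simp add: tensor_lift_pure P Q L h linear_maps_closed[OF f] linear_maps_closed[OF g])
  finally show ?thesis .
qed

lemma tensor_flip_linear:
  assumes "module K M" "module K N"
  shows "tensor_flip K M N \<in> linear_maps K (tensor K M N) (tensor K N M)"
  unfolding tensor_flip_def
  by (intro tensor_lift_linear bilinear_mapsI pure_tensor_linear_left pure_tensor_linear_right
      module_tensor assms linear_id)

lemma tensor_lift_tensor_flip:
  assumes t: "t \<in> carrier (tensor K M N)"
    and M: "module K M" and N: "module K N" and L: "module K L"
    and h: "h \<in> bilinear_maps K N M L"
  shows "tensor_lift K L h (tensor_flip K M N t) = tensor_lift K L (\<lambda>a b. h b a) t"
proof -
  have "tensor_lift K L h (tensor_flip K M N t)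
      = tensor_lift K L (\<lambda>a b. tensor_lift K L h (pure_tensor K N M b a)) t"
    unfolding tensor_flip_def
    by (rule linear_tensor_lift[OF t M N])
       (intro tensor_lift_linear bilinear_mapsI pure_tensor_linear_left pure_tensor_linear_right
         module_tensor assms linear_id)+
  also have "\<dots> = tensor_lift K L (\<lambda>a b. h b a) t"
    by (rule sym, rule tensor_lift_cong[OF M N L t])
       (auto intro!: bilinear_mapsI bilinear_maps_left[OF h] bilinear_maps_right[OF h]
         simp: tensor_lift_pure M N L h)
  finally show ?thesis .
qed

lemma tensor_lift_tensor_assoc:
  assumes t: "t \<in> carrier (tensor K (tensor K L M) N)"
    and L: "module K L" and M: "module K M" and N: "module K N" and P: "module K P"
    and f1: "\<And>a. a \<in> carrier L \<Longrightarrow> f a \<in> bilinear_maps K M N P"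
    and f2: "\<And>b c. \<lbrakk>b \<in> carrier M; c \<in> carrier N\<rbrakk> \<Longrightarrow> (\<lambda>a. f a b c) \<in> linear_maps K L P"
  shows "tensor_lift K P (\<lambda>a s. tensor_lift K P (f a) s) (tensor_assoc K L M N t)
    = tensor_lift K P (\<lambda>s c. tensor_lift K P (\<lambda>a b. f a b c) s) t"
proof -
  let ?T = "tensor K L (tensor K M N)"
  have LM: "module K (tensor K L M)" and MN: "module K (tensor K M N)" and T: "module K ?T"
    by (intro module_tensor L M N)+
  note mods = L M N P LM MN T
  note rules = mods linear_id f1 f2 bilinear_maps_left[OF f1] bilinear_maps_right[OF f1]
    bilinear_mapsI tensor_lift_linear_arg tensor_lift_linear_fun tensor_lift_linear
    pure_tensor_linear_left pure_tensor_linear_right pure_tensor_closed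
  have pure: "(\<lambda>a b. pure_tensor K L (tensor K M N) a (pure_tensor K M N b c))
      \<in> bilinear_maps K L M ?T" if "c \<in> carrier N" for c
    by (assumption | rule that rules)+
  have F: "(\<lambda>a s. tensor_lift K P (f a) s) \<in> bilinear_maps K L (tensor K M N) P"
    by (assumption | rule rules)+
  have G: "(\<lambda>s c. tensor_lift K ?T (\<lambda>a b. pure_tensor K L (tensor K M N) a (pure_tensor K M N b c)) s)
      \<in> bilinear_maps K (tensor K L M) N ?T"
    by (assumption | rule rules)+
  have f3: "(\<lambda>a b. f a b c) \<in> bilinear_maps K L M P" if "c \<in> carrier N" for c
    by (assumption | rule that rules)+
  have "tensor_lift K P (\<lambda>a s. tensor_lift K P (f a) s) (tensor_assoc K L M N t)
     = tensor_lift K P (\<lambda>s c. tensor_lift K P (\<lambda>a s. tensor_lift K P (f a) s)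
         (tensor_lift K ?T (\<lambda>a b. pure_tensor K L (tensor K M N) a (pure_tensor K M N b c)) s)) t"
    unfolding tensor_assoc_def
    by (rule linear_tensor_lift[OF t LM N T P tensor_lift_linear[OF L MN P F] G])
  also have "\<dots> = tensor_lift K P (\<lambda>s c. tensor_lift K P (\<lambda>a b. f a b c) s) t"
  proof (rule sym, rule tensor_lift_cong[OF LM N P t])
    show "(\<lambda>s c. tensor_lift K P (\<lambda>a b. f a b c) s) \<in> bilinear_maps K (tensor K L M) N P"
      by (assumption | rule f3 rules)+
    fix s c assume s: "s \<in> carrier (tensor K L M)" and c: "c \<in> carrier N"
    have "tensor_lift K P (\<lambda>a s. tensor_lift K P (f a) s)
         (tensor_lift K ?T (\<lambda>a b. pure_tensor K L (tensor K M N) a (pure_tensor K M N b c)) s)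
       = tensor_lift K P (\<lambda>a b. tensor_lift K P (\<lambda>a s. tensor_lift K P (f a) s)
           (pure_tensor K L (tensor K M N) a (pure_tensor K M N b c))) s"
      by (rule linear_tensor_lift[OF s L M T P tensor_lift_linear[OF L MN P F] pure[OF c]])
    also have "\<dots> = tensor_lift K P (\<lambda>a b. f a b c) s"
      by (rule sym, rule tensor_lift_cong[OF L M P s f3[OF c]])
         (simp add: tensor_lift_pure[OF L MN P F] tensor_lift_pure[OF M N P f1] c
           pure_tensor_closed[OF M N])
    finally show "tensor_lift K P (\<lambda>a b. f a b c) s = tensor_lift K P (\<lambda>a s. tensor_lift K P (f a) s)
         (tensor_lift K ?T (\<lambda>a b. pure_tensor K L (tensor K M N) a (pure_tensor K M N b c)) s)"
      by simp
  qed
  finally show ?thesis .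
qed

lemma tensor_mult:
  "s \<otimes>\<^bsub>tensor K A B\<^esub> t = tensor_lift K (tensor K A B) (\<lambda>a b.
     tensor_lift K (tensor K A B) (\<lambda>a' b'. pure_tensor K A B (a \<otimes>\<^bsub>A\<^esub> a') (b \<otimes>\<^bsub>B\<^esub> b')) t) s"
  unfolding tensor_lift_tensor_module[symmetric] by (simp add: tensor_def)

text \<open>The factors are arbitrary modules with bilinear products because one of them will be the
  Heisenberg algebra, whose product is introduced as a formula and is shown to be bilinear first.\<close>

lemma tensor_mult_bilinear:
  assumes A: "module K A" and B: "module K B"
    and mA: "monoid.mult A \<in> bilinear_maps K A A A" and mB: "monoid.mult B \<in> bilinear_maps K B B B"
  shows "monoid.mult (tensor K A B) \<in> bilinear_maps K (tensor K A B) (tensor K A B) (tensor K A B)"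
proof -
  have "(\<lambda>s t. s \<otimes>\<^bsub>tensor K A B\<^esub> t) \<in> bilinear_maps K (tensor K A B) (tensor K A B) (tensor K A B)"
    unfolding tensor_mult
    by (assumption | rule A B module_tensor linear_id
      bilinear_mapsI tensor_lift_linear_arg tensor_lift_linear_fun
      pure_tensor_linear_left pure_tensor_linear_right
      bilinear_compose_left[OF mA] bilinear_compose_right[OF mA] bilinear_maps_closed[OF mA]
      bilinear_compose_left[OF mB] bilinear_compose_right[OF mB] bilinear_maps_closed[OF mB])+
  then show ?thesis .
qed

lemma tensor_map_pure:
  assumes "module K M" "module K N" "module K P" "module K Q"
    and f: "f \<in> linear_maps K M P" and g: "g \<in> linear_maps K N Q" and "a \<in> carrier M" "b \<in> carrier N"
  shows "tensor_map K P Q f g (pure_tensor K M N a b) = pure_tensor K P Q (f a) (g b)"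
proof -
  have "(\<lambda>a b. pure_tensor K P Q (f a) (g b)) \<in> bilinear_maps K M N (tensor K P Q)"
    by (assumption | rule assms bilinear_mapsI pure_tensor_linear_left pure_tensor_linear_right
        linear_maps_closed[OF f] linear_maps_closed[OF g])+
  then show ?thesis
    unfolding tensor_map_def by (intro tensor_lift_pure module_tensor assms)
qed

text \<open>This turns a product of two embedded tensors, as it occurs on either side of the Heisenberg
  condition, into a double Sweedler sum.\<close>

lemma tensor_mult_tensor_map:
  assumes A: "module K A" and B: "module K B"
    and mA: "monoid.mult A \<in> bilinear_maps K A A A" and mB: "monoid.mult B \<in> bilinear_maps K B B B"
    and M: "module K M" and N: "module K N" and M': "module K M'" and N': "module K N'"
    and f: "f \<in> linear_maps K M A" and g: "g \<in> linear_maps K N B"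
    and f': "f' \<in> linear_maps K M' A" and g': "g' \<in> linear_maps K N' B"
    and s: "s \<in> carrier (tensor K M N)" and t: "t \<in> carrier (tensor K M' N')"
  shows "tensor_map K A B f g s \<otimes>\<^bsub>tensor K A B\<^esub> tensor_map K A B f' g' t
    = tensor_lift K (tensor K A B) (\<lambda>a b. tensor_lift K (tensor K A B)
        (\<lambda>a' b'. pure_tensor K A B (f a \<otimes>\<^bsub>A\<^esub> f' a') (g b \<otimes>\<^bsub>B\<^esub> g' b')) t) s"
proof -
  let ?P = "tensor K A B"
  let ?t = "tensor_map K A B f' g' t"
  have P: "module K ?P"
    by (intro module_tensor A B)
  have t': "?t \<in> carrier ?P"
    by (rule linear_maps_closed[OF tensor_map_linear[OF M' N' A B f' g'] t])
  note rules = A B M N M' N' P t' s t module_tensor linear_id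
    linear_compose[OF f] linear_compose[OF g] linear_compose[OF f'] linear_compose[OF g']
    linear_maps_closed[OF f] linear_maps_closed[OF g] linear_maps_closed[OF f'] linear_maps_closed[OF g']
    bilinear_maps_closed[OF mA] bilinear_maps_closed[OF mB]
    bilinear_mapsI tensor_lift_linear_arg tensor_lift_linear_fun
    pure_tensor_linear_left pure_tensor_linear_right
    bilinear_compose_left[OF mA] bilinear_compose_right[OF mA]
    bilinear_compose_left[OF mB] bilinear_compose_right[OF mB]
  have "tensor_map K A B f g s \<otimes>\<^bsub>?P\<^esub> ?t = tensor_lift K ?P (\<lambda>a b. tensor_lift K ?P
        (\<lambda>a' b'. pure_tensor K A B (f a \<otimes>\<^bsub>A\<^esub> a') (g b \<otimes>\<^bsub>B\<^esub> b')) ?t) s"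
    unfolding tensor_mult
    by (rule tensor_lift_tensor_map[OF s M N A B P f g]) (assumption | rule rules)+
  also have "\<dots> = tensor_lift K ?P (\<lambda>a b. tensor_lift K ?P
        (\<lambda>a' b'. pure_tensor K A B (f a \<otimes>\<^bsub>A\<^esub> f' a') (g b \<otimes>\<^bsub>B\<^esub> g' b')) t) s"
  proof (rule tensor_lift_cong[OF M N P s])
    fix a b assume ab: "a \<in> carrier M" "b \<in> carrier N"
    show "tensor_lift K ?P (\<lambda>a' b'. pure_tensor K A B (f a \<otimes>\<^bsub>A\<^esub> a') (g b \<otimes>\<^bsub>B\<^esub> b')) ?t
      = tensor_lift K ?P (\<lambda>a' b'. pure_tensor K A B (f a \<otimes>\<^bsub>A\<^esub> f' a') (g b \<otimes>\<^bsub>B\<^esub> g' b')) t"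
      by (rule tensor_lift_tensor_map[OF t M' N' A B P f' g']) (assumption | rule ab rules)+
  qed (assumption | rule rules)+
  finally show ?thesis .
qed

lemma mult_map_pure:
  assumes "module K A" "monoid.mult A \<in> bilinear_maps K A A A" "a \<in> carrier A" "b \<in> carrier A"
  shows "mult_map K A (pure_tensor K A A a b) = a \<otimes>\<^bsub>A\<^esub> b"
  unfolding mult_map_def by (rule tensor_lift_pure[OF assms(1,1,1,2-4)])

section \<open>Finite bases\<close>

lemma linear_maps_finsum_fun:
  assumes M: "module K M" and N: "module K N" and "finite B"
    and f: "\<And>b. b \<in> B \<Longrightarrow> f b \<in> linear_maps K M N"
  shows "(\<lambda>x. \<Oplus>\<^bsub>N\<^esub>b\<in>B. f b x) \<in> linear_maps K M N"
proof -
  interpret M: module K M by fact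
  interpret N: module K N by fact
  note cl = linear_maps_closed[OF f]
  show ?thesis
  proof (rule linear_mapsI)
    show "(\<Oplus>\<^bsub>N\<^esub>b\<in>B. f b x) \<in> carrier N" if "x \<in> carrier M" for x
      using cl that by (intro N.finsum_closed) auto
    show "(\<Oplus>\<^bsub>N\<^esub>b\<in>B. f b (x \<oplus>\<^bsub>M\<^esub> y)) = (\<Oplus>\<^bsub>N\<^esub>b\<in>B. f b x) \<oplus>\<^bsub>N\<^esub> (\<Oplus>\<^bsub>N\<^esub>b\<in>B. f b y)"
      if "x \<in> carrier M" "y \<in> carrier M" for x y
    proof -
      have "(\<Oplus>\<^bsub>N\<^esub>b\<in>B. f b (x \<oplus>\<^bsub>M\<^esub> y)) = (\<Oplus>\<^bsub>N\<^esub>b\<in>B. f b x \<oplus>\<^bsub>N\<^esub> f b y)"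
        using cl that by (intro N.finsum_cong') (auto simp: linear_maps_add[OF f])
      then show ?thesis
        using cl that by (simp add: N.finsum_addf Pi_def)
    qed
    show "(\<Oplus>\<^bsub>N\<^esub>b\<in>B. f b (k \<odot>\<^bsub>M\<^esub> x)) = k \<odot>\<^bsub>N\<^esub> (\<Oplus>\<^bsub>N\<^esub>b\<in>B. f b x)"
      if "k \<in> carrier K" "x \<in> carrier M" for k x
    proof -
      have "(\<Oplus>\<^bsub>N\<^esub>b\<in>B. f b (k \<odot>\<^bsub>M\<^esub> x)) = (\<Oplus>\<^bsub>N\<^esub>b\<in>B. k \<odot>\<^bsub>N\<^esub> f b x)"
        using cl that by (intro N.finsum_cong') (auto simp: linear_maps_smult[OF f])
      then show ?thesis
        using cl that \<open>finite B\<close> by (subst N.finsum_smult_ldistr) auto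
    qed
  qed
qed

text \<open>Coordinates with respect to a basis are linear because they are unique: the coordinatewise sum of
  the coordinates of \<open>x\<close> and \<open>y\<close> represents \<open>x + y\<close>.\<close>

lemma finite_basis_coordinates:
  assumes M: "module K M" and B: "finite_basis K M B"
  obtains e where "\<And>b. b \<in> B \<Longrightarrow> e b \<in> linear_maps K M (base_module K)"
    "\<And>x. x \<in> carrier M \<Longrightarrow> x = (\<Oplus>\<^bsub>M\<^esub>b\<in>B. e b x \<odot>\<^bsub>M\<^esub> b)"
proof -
  interpret M: module K M by fact
  have fin: "finite B" and sub: "B \<subseteq> carrier M"
    using B by (auto simp: finite_basis_def)
  have ex: "\<exists>!c. c \<in> B \<rightarrow>\<^sub>E carrier K \<and> x = (\<Oplus>\<^bsub>M\<^esub>b\<in>B. c b \<odot>\<^bsub>M\<^esub> b)" if "x \<in> carrier M" for x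
    using B that by (simp add: finite_basis_def)
  define c where "c x = (THE c. c \<in> B \<rightarrow>\<^sub>E carrier K \<and> x = (\<Oplus>\<^bsub>M\<^esub>b\<in>B. c b \<odot>\<^bsub>M\<^esub> b))" for x
  have c1: "c x \<in> B \<rightarrow>\<^sub>E carrier K" and c2: "x = (\<Oplus>\<^bsub>M\<^esub>b\<in>B. c x b \<odot>\<^bsub>M\<^esub> b)" if "x \<in> carrier M" for x
    using theI'[OF ex[OF that]] unfolding c_def by blast+
  have c3: "c x b = d b" if "d \<in> B \<rightarrow> carrier K" "x = (\<Oplus>\<^bsub>M\<^esub>b\<in>B. d b \<odot>\<^bsub>M\<^esub> b)" "b \<in> B" for x d b
  proof -
    have "x \<in> carrier M"
      unfolding that(2) using sub that(1) by (intro M.finsum_closed) (auto simp: Pi_iff)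
    \<comment> \<open>Uniqueness in \<open>finite_basis\<close> is among functions that are undefined off the basis.\<close>
    moreover have "x = (\<Oplus>\<^bsub>M\<^esub>b\<in>B. restrict d B b \<odot>\<^bsub>M\<^esub> b)"
      unfolding that(2) using sub that(1) by (intro M.finsum_cong') (auto simp: Pi_iff)
    moreover have "restrict d B \<in> B \<rightarrow>\<^sub>E carrier K"
      using that(1) by auto
    ultimately have "c x = restrict d B"
      unfolding c_def by (intro the1_equality[OF ex] conjI)
    then show ?thesis
      using that(3) by simp
  qed
  have el: "c x b \<in> carrier K" if "x \<in> carrier M" "b \<in> B" for x b
    using c1[OF that(1)] that(2) by (auto simp: PiE_def)
  show ?thesis
  proof
    fix b assume b: "b \<in> B"
    show "(\<lambda>x. c x b) \<in> linear_maps K M (base_module K)"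
    proof (rule linear_mapsI; unfold base_module_simps)
      show "c x b \<in> carrier K" if "x \<in> carrier M" for x
        using el that b by simp
      show "c (x \<oplus>\<^bsub>M\<^esub> y) b = c x b \<oplus>\<^bsub>K\<^esub> c y b" if x: "x \<in> carrier M" and y: "y \<in> carrier M" for x y
      proof (rule c3[OF _ _ b])
        have "x \<oplus>\<^bsub>M\<^esub> y = (\<Oplus>\<^bsub>M\<^esub>b\<in>B. c x b \<odot>\<^bsub>M\<^esub> b \<oplus>\<^bsub>M\<^esub> c y b \<odot>\<^bsub>M\<^esub> b)"
          using el[OF x] el[OF y] sub
          by (subst M.finsum_addf) (auto simp flip: c2[OF x] c2[OF y])
        also have "\<dots> = (\<Oplus>\<^bsub>M\<^esub>b\<in>B. (c x b \<oplus>\<^bsub>K\<^esub> c y b) \<odot>\<^bsub>M\<^esub> b)"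
          using el[OF x] el[OF y] sub by (intro M.finsum_cong') (auto simp: M.smult_l_distr)
        finally show "x \<oplus>\<^bsub>M\<^esub> y = (\<Oplus>\<^bsub>M\<^esub>b\<in>B. (c x b \<oplus>\<^bsub>K\<^esub> c y b) \<odot>\<^bsub>M\<^esub> b)" .
      qed (use el[OF x] el[OF y] in auto)
      show "c (k \<odot>\<^bsub>M\<^esub> x) b = k \<otimes>\<^bsub>K\<^esub> c x b" if k: "k \<in> carrier K" and x: "x \<in> carrier M" for k x
      proof (rule c3[OF _ _ b])
        have "k \<odot>\<^bsub>M\<^esub> x = k \<odot>\<^bsub>M\<^esub> (\<Oplus>\<^bsub>M\<^esub>b\<in>B. c x b \<odot>\<^bsub>M\<^esub> b)"
          by (simp flip: c2[OF x])
        also have "\<dots> = (\<Oplus>\<^bsub>M\<^esub>b\<in>B. k \<odot>\<^bsub>M\<^esub> (c x b \<odot>\<^bsub>M\<^esub> b))"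
          using el[OF x] sub fin k by (intro M.finsum_smult_ldistr) auto
        also have "\<dots> = (\<Oplus>\<^bsub>M\<^esub>b\<in>B. (k \<otimes>\<^bsub>K\<^esub> c x b) \<odot>\<^bsub>M\<^esub> b)"
          using el[OF x] sub k by (intro M.finsum_cong') (auto simp: M.smult_assoc1)
        finally show "k \<odot>\<^bsub>M\<^esub> x = (\<Oplus>\<^bsub>M\<^esub>b\<in>B. (k \<otimes>\<^bsub>K\<^esub> c x b) \<odot>\<^bsub>M\<^esub> b)" .
      qed (use el[OF x] k in auto)
    qed
  next
    show "x = (\<Oplus>\<^bsub>M\<^esub>b\<in>B. c x b \<odot>\<^bsub>M\<^esub> b)" if "x \<in> carrier M" for x
      by (rule c2[OF that])
  qed
qed

section \<open>The dual of a finite-dimensional Hopf algebra\<close>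

text \<open>The coproduct of the dual is specified by a tensor over the bare algebra \<open>dual_algebra\<close> but is
  used as a tensor over \<open>dual_hopf\<close>. The tensor products coincide, since they depend only on the
  algebra structure.\<close>

lemma bilinear_relations_eq:
  assumes M: "carrier M = carrier M'" "add M = add M'" "smult M = smult M'"
    and N: "carrier N = carrier N'" "add N = add N'" "smult N = smult N'"
  shows "bilinear_relations K M N = bilinear_relations K M' N'"
proof
  show "bilinear_relations K M N \<subseteq> bilinear_relations K M' N'"
  proof
    show "u \<in> bilinear_relations K M' N'" if "u \<in> bilinear_relations K M N" for u
      using that by induction (simp_all add: assms bilinear_relations.intros)
  qed
  show "bilinear_relations K M' N' \<subseteq> bilinear_relations K M N"
  proof
    show "u \<in> bilinear_relations K M N" if "u \<in> bilinear_relations K M' N'" for u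
      using that by induction (simp_all add: assms[symmetric] bilinear_relations.intros)
  qed
qed

lemma tensor_eq:
  assumes M: "carrier M = carrier M'" "add M = add M'" "smult M = smult M'"
      "monoid.mult M = monoid.mult M'" "\<one>\<^bsub>M\<^esub> = \<one>\<^bsub>M'\<^esub>"
    and N: "carrier N = carrier N'" "add N = add N'" "smult N = smult N'"
      "monoid.mult N = monoid.mult N'" "\<one>\<^bsub>N\<^esub> = \<one>\<^bsub>N'\<^esub>"
  shows "tensor K M N = tensor K M' N'"
  by (simp add: tensor_def tensor_module_def pure_tensor_def fun_eq_iff assms bilinear_relations_eq[OF M(1-3) N(1-3)])

lemma dual_hopf_simps:
  "carrier (dual_hopf K H) = carrier (dual_algebra K H)"
  "add (dual_hopf K H) = add (dual_algebra K H)"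
  "smult (dual_hopf K H) = smult (dual_algebra K H)"
  "monoid.mult (dual_hopf K H) = monoid.mult (dual_algebra K H)"
  "\<zero>\<^bsub>dual_hopf K H\<^esub> = \<zero>\<^bsub>dual_algebra K H\<^esub>"
  "\<one>\<^bsub>dual_hopf K H\<^esub> = \<one>\<^bsub>dual_algebra K H\<^esub>"
  "counit (dual_hopf K H) = (\<lambda>\<theta>. pairing \<one>\<^bsub>H\<^esub> \<theta>)"
  by (simp_all add: dual_hopf_def module.defs hopf.defs)

context hopf_algebra
begin

abbreviation "KK \<equiv> base_module K"

lemma cring_K: "cring K" ..

lemmas K_simps = cring.cring_simprules[OF cring_K]

lemma module_K: "module K KK"
  by (rule module_base_module) unfold_locales

lemma module_H: "module K H" ..

lemma algebra_H: "unital_algebra K H" ..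

lemma K_mult_bilinear: "monoid.mult K \<in> bilinear_maps K KK KK KK"
  using smult_bilinear[OF module_K] by (simp add: base_module_def)

lemmas K_mult_linear = bilinear_compose_left[OF K_mult_bilinear, unfolded base_module_simps]
  bilinear_compose_right[OF K_mult_bilinear, unfolded base_module_simps]

end

locale finite_dimensional_hopf_algebra = hopf_algebra K H
  for K :: "('k, 'z) ring_scheme" and H :: "('k, 'h, 'm) hopf_scheme" +
  assumes finite_dimensional: "finite_dimensional K H"
begin

abbreviation "D \<equiv> dual_hopf K H"

lemma dual_carrier: "\<theta> \<in> carrier D \<longleftrightarrow> \<theta> \<in> linear_maps K H KK \<and> \<theta> \<in> extensional (carrier H)"
  by (simp add: dual_hopf_simps dual_algebra_def)

lemma dual_restrict: "f \<in> linear_maps K H KK \<Longrightarrow> restrict f (carrier H) \<in> carrier D"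
  by (auto simp: dual_carrier linear_maps_def)

lemma dual_eqI:
  assumes "\<theta> \<in> carrier D" "\<eta> \<in> carrier D" "\<And>h. h \<in> carrier H \<Longrightarrow> pairing h \<theta> = pairing h \<eta>"
  shows "\<theta> = \<eta>"
  using assms by (intro extensionalityI[of _ "carrier H"]) (auto simp: dual_carrier pairing_def)

lemma pairing_linear_left: "\<theta> \<in> carrier D \<Longrightarrow> (\<lambda>h. pairing h \<theta>) \<in> linear_maps K H KK"
  by (simp add: dual_carrier pairing_def)

lemma pairing_closed: "\<lbrakk>h \<in> carrier H; \<theta> \<in> carrier D\<rbrakk> \<Longrightarrow> pairing h \<theta> \<in> carrier K"
  using linear_maps_closed[OF pairing_linear_left] by (simp add: base_module_simps)

lemma dual_ops:
  "h \<in> carrier H \<Longrightarrow> pairing h (\<theta> \<oplus>\<^bsub>D\<^esub> \<eta>) = pairing h \<theta> \<oplus>\<^bsub>K\<^esub> pairing h \<eta>"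
  "h \<in> carrier H \<Longrightarrow> pairing h (k \<odot>\<^bsub>D\<^esub> \<theta>) = k \<otimes>\<^bsub>K\<^esub> pairing h \<theta>"
  "h \<in> carrier H \<Longrightarrow> pairing h \<zero>\<^bsub>D\<^esub> = \<zero>\<^bsub>K\<^esub>"
  by (simp_all add: dual_hopf_simps dual_algebra_def pairing_def)

lemma module_D: "module K D"
proof -
  interpret KK: module K KK by (rule module_K)
  have add: "\<theta> \<oplus>\<^bsub>D\<^esub> \<eta> \<in> carrier D" if "\<theta> \<in> carrier D" "\<eta> \<in> carrier D" for \<theta> \<eta>
  proof -
    have "(\<lambda>h. pairing h \<theta> \<oplus>\<^bsub>K\<^esub> pairing h \<eta>) \<in> linear_maps K H KK"
      using linear_maps_add[OF pairing_linear_left[OF that(1)]] linear_maps_add[OF pairing_linear_left[OF that(2)]]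
        linear_maps_smult[OF pairing_linear_left[OF that(1)]] linear_maps_smult[OF pairing_linear_left[OF that(2)]]
      by (intro linear_mapsI) (simp_all add: base_module_simps pairing_closed that K_simps)
    from dual_restrict[OF this] show ?thesis
      by (simp add: dual_hopf_simps dual_algebra_def pairing_def)
  qed
  have smult: "k \<odot>\<^bsub>D\<^esub> \<theta> \<in> carrier D" if "k \<in> carrier K" "\<theta> \<in> carrier D" for k \<theta>
  proof -
    have "(\<lambda>h. k \<otimes>\<^bsub>K\<^esub> pairing h \<theta>) \<in> linear_maps K H KK"
      using linear_maps_add[OF pairing_linear_left[OF that(2)]] linear_maps_smult[OF pairing_linear_left[OF that(2)]]
      by (intro linear_mapsI) (simp_all add: base_module_simps pairing_closed that K_simps)
    from dual_restrict[OF this] show ?thesis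
      by (simp add: dual_hopf_simps dual_algebra_def pairing_def)
  qed
  have zero: "\<zero>\<^bsub>D\<^esub> \<in> carrier D"
  proof -
    have "(\<lambda>h. \<zero>\<^bsub>K\<^esub>) \<in> linear_maps K H KK"
      by (intro linear_mapsI) (simp_all add: base_module_simps)
    from dual_restrict[OF this] show ?thesis
      by (simp add: dual_hopf_simps dual_algebra_def)
  qed
  have "cring K" ..
  then show ?thesis
  proof (rule moduleI[OF _ abelian_groupI])
    fix \<theta> assume \<theta>: "\<theta> \<in> carrier D"
    show "\<exists>\<eta>\<in>carrier D. \<eta> \<oplus>\<^bsub>D\<^esub> \<theta> = \<zero>\<^bsub>D\<^esub>"
    proof
      show *: "(\<ominus>\<^bsub>K\<^esub> \<one>\<^bsub>K\<^esub>) \<odot>\<^bsub>D\<^esub> \<theta> \<in> carrier D"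
        by (intro smult \<theta>) simp
      show "(\<ominus>\<^bsub>K\<^esub> \<one>\<^bsub>K\<^esub>) \<odot>\<^bsub>D\<^esub> \<theta> \<oplus>\<^bsub>D\<^esub> \<theta> = \<zero>\<^bsub>D\<^esub>"
        by (intro dual_eqI add zero * \<theta>) (simp add: dual_ops pairing_closed \<theta> K_simps)
    qed
  qed (auto intro!: add smult zero dual_eqI simp: dual_ops pairing_closed K_simps)
qed

lemma pairing_linear_right: "h \<in> carrier H \<Longrightarrow> pairing h \<in> linear_maps K D KK"
  by (rule linear_mapsI) (simp_all add: base_module_simps dual_ops pairing_closed)

lemma pairing_bilinear: "pairing \<in> bilinear_maps K H D KK"
  using bilinear_mapsI[of D pairing K H KK] by (simp add: pairing_linear_left pairing_linear_right)

lemmas pairing_linear = bilinear_compose_left[OF pairing_bilinear] bilinear_compose_right[OF pairing_bilinear]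

lemma pairing_one: "h \<in> carrier H \<Longrightarrow> pairing h \<one>\<^bsub>D\<^esub> = counit H h"
  by (simp add: dual_hopf_simps dual_algebra_def pairing_def)

abbreviation "pair2 h k \<equiv> tensor_lift K KK (\<lambda>\<theta> \<eta>. pairing h \<theta> \<otimes>\<^bsub>K\<^esub> pairing k \<eta>)"

lemma pair2_bilinear:
  assumes "h \<in> carrier H" "k \<in> carrier H"
  shows "(\<lambda>\<theta> \<eta>. pairing h \<theta> \<otimes>\<^bsub>K\<^esub> pairing k \<eta>) \<in> bilinear_maps K D D KK"
  by (assumption | rule assms bilinear_mapsI K_mult_linear pairing_linear pairing_closed linear_id)+

lemma dual_basis:
  obtains B e where "finite B" "B \<subseteq> carrier H" "\<And>b. b \<in> B \<Longrightarrow> e b \<in> carrier D"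
    "\<And>h. h \<in> carrier H \<Longrightarrow> h = (\<Oplus>\<^bsub>H\<^esub>b\<in>B. pairing h (e b) \<odot>\<^bsub>H\<^esub> b)"
proof -
  obtain B where B: "finite_basis K H B"
    using finite_dimensional by (auto simp: finite_dimensional_def)
  obtain e where e: "\<And>b. b \<in> B \<Longrightarrow> e b \<in> linear_maps K H KK"
      "\<And>h. h \<in> carrier H \<Longrightarrow> h = (\<Oplus>\<^bsub>H\<^esub>b\<in>B. e b h \<odot>\<^bsub>H\<^esub> b)"
    by (rule finite_basis_coordinates[OF module_H B]) (rule that)
  show ?thesis
  proof
    show "finite B" "B \<subseteq> carrier H"
      using B by (auto simp: finite_basis_def)
    show "restrict (e b) (carrier H) \<in> carrier D" if "b \<in> B" for b
      by (rule dual_restrict[OF e(1)[OF that]])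
    show "h = (\<Oplus>\<^bsub>H\<^esub>b\<in>B. pairing h (restrict (e b) (carrier H)) \<odot>\<^bsub>H\<^esub> b)" if "h \<in> carrier H" for h
      using e(2)[OF that] that by (simp add: pairing_def)
  qed
qed

lemma functional_expand:
  assumes B: "finite B" "B \<subseteq> carrier H" "\<And>b. b \<in> B \<Longrightarrow> e b \<in> carrier D"
    "\<And>h. h \<in> carrier H \<Longrightarrow> h = (\<Oplus>\<^bsub>H\<^esub>b\<in>B. pairing h (e b) \<odot>\<^bsub>H\<^esub> b)"
    and f: "f \<in> linear_maps K H KK" and h: "h \<in> carrier H"
  shows "f h = (\<Oplus>\<^bsub>KK\<^esub>b\<in>B. pairing h (e b) \<otimes>\<^bsub>K\<^esub> f b)"
proof -
  interpret KK: module K KK by (rule module_K)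
  have "f h = f (\<Oplus>\<^bsub>H\<^esub>b\<in>B. pairing h (e b) \<odot>\<^bsub>H\<^esub> b)"
    using B(4)[OF h] by simp
  also have "\<dots> = (\<Oplus>\<^bsub>KK\<^esub>b\<in>B. f (pairing h (e b) \<odot>\<^bsub>H\<^esub> b))"
    using B(1-3) h pairing_closed by (intro linear_maps_finsum[OF module_H module_K f]) auto
  also have "\<dots> = (\<Oplus>\<^bsub>KK\<^esub>b\<in>B. pairing h (e b) \<otimes>\<^bsub>K\<^esub> f b)"
    using B(1-3) h pairing_closed linear_maps_closed[OF f]
    by (intro KK.finsum_cong') (auto simp: linear_maps_smult[OF f] base_module_simps)
  finally show ?thesis .
qed

text \<open>The tensor \<open>t\<close> is recovered from its values on pairs as the sum over the basis of
  \<open>t(-, b) \<otimes> e\<^sub>b\<close>, where \<open>t(-, b)\<close> is the functional obtained by evaluating the second leg at the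
  basis vector \<open>b\<close> and \<open>e\<^sub>b\<close> is the dual basis vector.\<close>

lemma dual_tensor_eqI:
  assumes s: "s \<in> carrier (tensor K D D)" and t: "t \<in> carrier (tensor K D D)"
    and eq: "\<And>h k. \<lbrakk>h \<in> carrier H; k \<in> carrier H\<rbrakk> \<Longrightarrow> pair2 h k s = pair2 h k t"
  shows "s = t"
proof -
  obtain B e where B: "finite B" "B \<subseteq> carrier H" "\<And>b. b \<in> B \<Longrightarrow> e b \<in> carrier D"
    "\<And>h. h \<in> carrier H \<Longrightarrow> h = (\<Oplus>\<^bsub>H\<^esub>b\<in>B. pairing h (e b) \<odot>\<^bsub>H\<^esub> b)"
    by (rule dual_basis) (rule that)
  interpret D: module K D by (rule module_D)
  interpret KK: module K KK by (rule module_K)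
  interpret DD: module K "tensor K D D" by (intro module_tensor module_D)
  have expand: "\<eta> = (\<Oplus>\<^bsub>D\<^esub>b\<in>B. pairing b \<eta> \<odot>\<^bsub>D\<^esub> e b)" if \<eta>: "\<eta> \<in> carrier D" for \<eta>
  proof (rule dual_eqI[OF \<eta>])
    have cl: "(\<lambda>b. pairing b \<eta> \<odot>\<^bsub>D\<^esub> e b) \<in> B \<rightarrow> carrier D"
      using B(2,3) \<eta> pairing_closed by auto
    then show "(\<Oplus>\<^bsub>D\<^esub>b\<in>B. pairing b \<eta> \<odot>\<^bsub>D\<^esub> e b) \<in> carrier D"
      by (rule D.finsum_closed)
    fix h assume h: "h \<in> carrier H"
    have "pairing h (\<Oplus>\<^bsub>D\<^esub>b\<in>B. pairing b \<eta> \<odot>\<^bsub>D\<^esub> e b) = (\<Oplus>\<^bsub>KK\<^esub>b\<in>B. pairing h (pairing b \<eta> \<odot>\<^bsub>D\<^esub> e b))"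
      by (rule linear_maps_finsum[OF module_D module_K pairing_linear_right[OF h] B(1) cl])
    also have "\<dots> = (\<Oplus>\<^bsub>KK\<^esub>b\<in>B. pairing h (e b) \<otimes>\<^bsub>K\<^esub> pairing b \<eta>)"
      using B(2,3) h \<eta> pairing_closed
      by (intro KK.finsum_cong') (auto simp: dual_ops base_module_simps K_simps)
    also have "\<dots> = pairing h \<eta>"
      using functional_expand[OF B pairing_linear_left[OF \<eta>] h] by simp
    finally show "pairing h \<eta> = pairing h (\<Oplus>\<^bsub>D\<^esub>b\<in>B. pairing b \<eta> \<odot>\<^bsub>D\<^esub> e b)" ..
  qed
  \<comment> \<open>\<open>part b t\<close> is the functional \<open>t(-, b)\<close>.\<close>
  define part :: "'h \<Rightarrow> ('k, 'h \<Rightarrow> 'k, 'h \<Rightarrow> 'k) tensor \<Rightarrow> 'h \<Rightarrow> 'k" where "part b t = tensor_lift K D (\<lambda>\<theta> \<eta>. pairing b \<eta> \<odot>\<^bsub>D\<^esub> \<theta>) t" for b t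
  have bil: "(\<lambda>\<theta> \<eta>. pairing b \<eta> \<odot>\<^bsub>D\<^esub> \<theta>) \<in> bilinear_maps K D D D" if "b \<in> carrier H" for b
    by (assumption | rule that module_D bilinear_mapsI smult_linear_left smult_linear_right
        pairing_linear pairing_closed linear_id)+
  have part_lin: "part b \<in> linear_maps K (tensor K D D) D" if "b \<in> carrier H" for b
    unfolding part_def by (rule tensor_lift_linear[OF module_D module_D module_D bil[OF that]])
  have part_pairing: "pairing h (part b u) = pair2 h b u"
    if h: "h \<in> carrier H" and b: "b \<in> carrier H" and u: "u \<in> carrier (tensor K D D)" for h b u
  proof -
    have "pairing h (part b u) = tensor_lift K KK (\<lambda>\<theta> \<eta>. pairing h (pairing b \<eta> \<odot>\<^bsub>D\<^esub> \<theta>)) u"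
      unfolding part_def
      by (rule linear_tensor_lift[OF u module_D module_D module_D module_K pairing_linear_right[OF h] bil[OF b]])
    also have "\<dots> = pair2 h b u"
      by (rule sym, rule tensor_lift_cong[OF module_D module_D module_K u pair2_bilinear[OF h b]])
         (simp add: dual_ops h b pairing_closed K_simps)
    finally show ?thesis .
  qed
  have decomp: "u = (\<Oplus>\<^bsub>tensor K D D\<^esub>b\<in>B. pure_tensor K D D (part b u) (e b))"
    if u: "u \<in> carrier (tensor K D D)" for u
  proof (rule tensor_ext[OF module_D module_D _ linear_id _ _ u])
    show "module K (tensor K D D)" ..
    show "(\<lambda>u. \<Oplus>\<^bsub>tensor K D D\<^esub>b\<in>B. pure_tensor K D D (part b u) (e b))
        \<in> linear_maps K (tensor K D D) (tensor K D D)"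
      using B(2,3) by (intro linear_maps_finsum_fun pure_tensor_linear_left module_D module_tensor part_lin B) auto
    fix \<theta> \<eta> assume \<theta>: "\<theta> \<in> carrier D" and \<eta>: "\<eta> \<in> carrier D"
    note P = pure_tensor_bilinear[OF module_D module_D]
    have "pure_tensor K D D \<theta> \<eta> = pure_tensor K D D \<theta> (\<Oplus>\<^bsub>D\<^esub>b\<in>B. pairing b \<eta> \<odot>\<^bsub>D\<^esub> e b)"
      using expand[OF \<eta>] by simp
    also have "\<dots> = (\<Oplus>\<^bsub>tensor K D D\<^esub>b\<in>B. pure_tensor K D D \<theta> (pairing b \<eta> \<odot>\<^bsub>D\<^esub> e b))"
      using B(2,3) \<eta> pairing_closed
      by (intro linear_maps_finsum[OF module_D DD.module_axioms bilinear_maps_right[OF P \<theta>] B(1)]) auto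
    also have "\<dots> = (\<Oplus>\<^bsub>tensor K D D\<^esub>b\<in>B. pure_tensor K D D (part b (pure_tensor K D D \<theta> \<eta>)) (e b))"
    proof (rule DD.finsum_cong'[OF refl])
      fix b assume "b \<in> B"
      then have b: "b \<in> carrier H" "e b \<in> carrier D" "pairing b \<eta> \<in> carrier K"
        using B(2,3) pairing_closed \<eta> by auto
      have "part b (pure_tensor K D D \<theta> \<eta>) = pairing b \<eta> \<odot>\<^bsub>D\<^esub> \<theta>"
        unfolding part_def by (rule tensor_lift_pure[OF module_D module_D module_D bil[OF b(1)] \<theta> \<eta>])
      then show "pure_tensor K D D \<theta> (pairing b \<eta> \<odot>\<^bsub>D\<^esub> e b)
          = pure_tensor K D D (part b (pure_tensor K D D \<theta> \<eta>)) (e b)"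
        using linear_maps_smult[OF bilinear_maps_right[OF P \<theta>]]
          linear_maps_smult[OF bilinear_maps_left[OF P]] b \<theta> by simp
    next
      show "(\<lambda>b. pure_tensor K D D (part b (pure_tensor K D D \<theta> \<eta>)) (e b)) \<in> B \<rightarrow> carrier (tensor K D D)"
        using B(2,3) \<theta> \<eta>
        by (intro Pi_I pure_tensor_closed module_D linear_maps_closed[OF part_lin]) auto
    qed
    finally show "pure_tensor K D D \<theta> \<eta>
        = (\<Oplus>\<^bsub>tensor K D D\<^esub>b\<in>B. pure_tensor K D D (part b (pure_tensor K D D \<theta> \<eta>)) (e b))" .
  qed
  have "part b s = part b t" if "b \<in> B" for b
    using B(2) that s t by (intro dual_eqI) (auto simp: part_pairing eq linear_maps_closed[OF part_lin])
  then have "(\<Oplus>\<^bsub>tensor K D D\<^esub>b\<in>B. pure_tensor K D D (part b s) (e b))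
      = (\<Oplus>\<^bsub>tensor K D D\<^esub>b\<in>B. pure_tensor K D D (part b t) (e b))"
    using B(2,3) t
    by (intro DD.finsum_cong' Pi_I pure_tensor_closed module_D linear_maps_closed[OF part_lin]) auto
  then show ?thesis
    using decomp[OF s] decomp[OF t] by simp
qed

text \<open>The witness is the sum over the basis of \<open>\<theta>(- b) \<otimes> e\<^sub>b\<close>. Evaluating it at \<open>h\<close> and \<open>k\<close> gives
  \<open>\<theta>(h k)\<close>, because \<open>k\<close> is the sum of the \<open>e\<^sub>b(k) b\<close>.\<close>

lemma dual_tensor_exists:
  assumes \<theta>: "\<theta> \<in> carrier D"
  shows "\<exists>t\<in>carrier (tensor K D D). \<forall>h\<in>carrier H. \<forall>k\<in>carrier H. pair2 h k t = pairing (h \<otimes>\<^bsub>H\<^esub> k) \<theta>"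
proof -
  obtain B e where B: "finite B" "B \<subseteq> carrier H" "\<And>b. b \<in> B \<Longrightarrow> e b \<in> carrier D"
    "\<And>h. h \<in> carrier H \<Longrightarrow> h = (\<Oplus>\<^bsub>H\<^esub>b\<in>B. pairing h (e b) \<odot>\<^bsub>H\<^esub> b)"
    by (rule dual_basis) (rule that)
  interpret D: module K D by (rule module_D)
  interpret KK: module K KK by (rule module_K)
  interpret DD: module K "tensor K D D" by (intro module_tensor module_D)
  define \<theta>' where "\<theta>' b = (\<lambda>h\<in>carrier H. pairing (h \<otimes>\<^bsub>H\<^esub> b) \<theta>)" for b
  have lin: "(\<lambda>h. pairing (h \<otimes>\<^bsub>H\<^esub> b) \<theta>) \<in> linear_maps K H KK" "(\<lambda>h. pairing (b \<otimes>\<^bsub>H\<^esub> h) \<theta>) \<in> linear_maps K H KK"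
    if "b \<in> carrier H" for b
    by (assumption | rule that \<theta> pairing_linear mult_linear_left mult_linear_right algebra_H linear_id)+
  have \<theta>': "\<theta>' b \<in> carrier D" if "b \<in> B" for b
    unfolding \<theta>'_def using that B(2) by (intro dual_restrict lin) auto
  let ?f = "\<lambda>b. pure_tensor K D D (\<theta>' b) (e b)"
  have cl: "?f \<in> B \<rightarrow> carrier (tensor K D D)"
    by (intro Pi_I pure_tensor_closed module_D \<theta>' B(3))
  show ?thesis
  proof (intro bexI ballI)
    show "(\<Oplus>\<^bsub>tensor K D D\<^esub>b\<in>B. ?f b) \<in> carrier (tensor K D D)"
      by (rule DD.finsum_closed[OF cl])
    fix h k assume h: "h \<in> carrier H" and k: "k \<in> carrier H"
    note bil = pair2_bilinear[OF h k]
    have "pair2 h k (\<Oplus>\<^bsub>tensor K D D\<^esub>b\<in>B. ?f b) = (\<Oplus>\<^bsub>KK\<^esub>b\<in>B. pair2 h k (?f b))"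
      by (rule linear_maps_finsum[OF DD.module_axioms module_K
            tensor_lift_linear[OF module_D module_D module_K bil] B(1) cl])
    also have "\<dots> = (\<Oplus>\<^bsub>KK\<^esub>b\<in>B. pairing k (e b) \<otimes>\<^bsub>K\<^esub> pairing (h \<otimes>\<^bsub>H\<^esub> b) \<theta>)"
    proof (rule KK.finsum_cong'[OF refl])
      fix b assume b: "b \<in> B"
      have "pair2 h k (?f b) = pairing h (\<theta>' b) \<otimes>\<^bsub>K\<^esub> pairing k (e b)"
        by (rule tensor_lift_pure[OF module_D module_D module_K bil \<theta>'[OF b] B(3)[OF b]])
      moreover have "pairing h (\<theta>' b) = pairing (h \<otimes>\<^bsub>H\<^esub> b) \<theta>"
        using h by (simp add: \<theta>'_def pairing_def)
      moreover have "pairing (h \<otimes>\<^bsub>H\<^esub> b) \<theta> \<in> carrier K" "pairing k (e b) \<in> carrier K"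
        using b B(2,3) h k \<theta> by (auto intro!: pairing_closed)
      ultimately show "pair2 h k (?f b) = pairing k (e b) \<otimes>\<^bsub>K\<^esub> pairing (h \<otimes>\<^bsub>H\<^esub> b) \<theta>"
        by (simp add: K_simps)
    next
      show "(\<lambda>b. pairing k (e b) \<otimes>\<^bsub>K\<^esub> pairing (h \<otimes>\<^bsub>H\<^esub> b) \<theta>) \<in> B \<rightarrow> carrier KK"
        using B(2,3) h k \<theta> by (auto intro!: pairing_closed simp: base_module_simps)
    qed
    also have "\<dots> = pairing (h \<otimes>\<^bsub>H\<^esub> k) \<theta>"
      by (rule functional_expand[OF B lin(2)[OF h] k, symmetric])
    finally show "pair2 h k (\<Oplus>\<^bsub>tensor K D D\<^esub>b\<in>B. ?f b) = pairing (h \<otimes>\<^bsub>H\<^esub> k) \<theta>" .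
  qed
qed

lemma dual_comult:
  assumes \<theta>: "\<theta> \<in> carrier D"
  shows "comult D \<theta> \<in> carrier (tensor K D D)"
    and "\<And>h k. \<lbrakk>h \<in> carrier H; k \<in> carrier H\<rbrakk> \<Longrightarrow> pair2 h k (comult D \<theta>) = pairing (h \<otimes>\<^bsub>H\<^esub> k) \<theta>"
proof -
  have eq: "tensor K (dual_algebra K H) (dual_algebra K H) = tensor K D D"
    by (rule tensor_eq) (simp_all add: dual_hopf_simps)
  have the: "comult D \<theta> = (THE t. t \<in> carrier (tensor K D D) \<and>
      (\<forall>h\<in>carrier H. \<forall>k\<in>carrier H. pair2 h k t = pairing (h \<otimes>\<^bsub>H\<^esub> k) \<theta>))"
    unfolding eq[symmetric] by (simp add: dual_hopf_def module.defs hopf.defs)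
  have ex: "\<exists>!t. t \<in> carrier (tensor K D D) \<and>
      (\<forall>h\<in>carrier H. \<forall>k\<in>carrier H. pair2 h k t = pairing (h \<otimes>\<^bsub>H\<^esub> k) \<theta>)"
  proof (rule ex_ex1I)
    show "s = t"
      if "s \<in> carrier (tensor K D D) \<and>
          (\<forall>h\<in>carrier H. \<forall>k\<in>carrier H. pair2 h k s = pairing (h \<otimes>\<^bsub>H\<^esub> k) \<theta>)"
        "t \<in> carrier (tensor K D D) \<and>
          (\<forall>h\<in>carrier H. \<forall>k\<in>carrier H. pair2 h k t = pairing (h \<otimes>\<^bsub>H\<^esub> k) \<theta>)" for s t
      using that by (intro dual_tensor_eqI) simp_all
  qed (use dual_tensor_exists[OF \<theta>] in blast)
  have "comult D \<theta> \<in> carrier (tensor K D D) \<and>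
      (\<forall>h\<in>carrier H. \<forall>k\<in>carrier H. pair2 h k (comult D \<theta>) = pairing (h \<otimes>\<^bsub>H\<^esub> k) \<theta>)"
    unfolding the by (rule theI'[OF ex])
  then show "comult D \<theta> \<in> carrier (tensor K D D)"
    and "\<And>h k. \<lbrakk>h \<in> carrier H; k \<in> carrier H\<rbrakk> \<Longrightarrow> pair2 h k (comult D \<theta>) = pairing (h \<otimes>\<^bsub>H\<^esub> k) \<theta>"
    by auto
qed

text \<open>Two tensors with the same values on pairs are equal, and the value of the coproduct on a pair is
  linear in the functional.\<close>

lemma dual_comult_linear: "comult D \<in> linear_maps K D (tensor K D D)"
proof -
  interpret D: module K D by (rule module_D)
  interpret DD: module K "tensor K D D" by (intro module_tensor module_D)
  note lin = tensor_lift_linear[OF module_D module_D module_K pair2_bilinear]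
  show ?thesis
    by (rule linear_mapsI; (intro dual_tensor_eqI)?)
       (simp_all add: dual_comult linear_maps_add[OF lin] linear_maps_smult[OF lin] base_module_simps dual_ops)
qed

end

section \<open>The antipode is antimultiplicative\<close>

context hopf_algebra
begin

abbreviation sweedler :: "('k, 'c, 'p) module_scheme \<Rightarrow> ('h \<Rightarrow> 'h \<Rightarrow> 'c) \<Rightarrow> 'h \<Rightarrow> 'c"
  where "sweedler P f h \<equiv> tensor_lift K P f (comult H h)"

lemma comult_linear: "comult H \<in> linear_maps K H (tensor K H H)"
  using comult_hom by (simp add: algebra_homs_def)

lemma counit_linear: "counit H \<in> linear_maps K H KK"
  using counit_hom by (simp add: algebra_homs_def)

lemma counit_closed: "h \<in> carrier H \<Longrightarrow> counit H h \<in> carrier K"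
  using linear_maps_closed[OF counit_linear] by (simp add: base_module_simps)

lemma counit_mult: "\<lbrakk>h \<in> carrier H; k \<in> carrier H\<rbrakk>
    \<Longrightarrow> counit H (h \<otimes>\<^bsub>H\<^esub> k) = counit H h \<otimes>\<^bsub>K\<^esub> counit H k"
  using counit_hom by (auto simp: algebra_homs_def ring_hom_def base_module_simps)

lemma counit_one: "counit H \<one>\<^bsub>H\<^esub> = \<one>\<^bsub>K\<^esub>"
  using counit_hom by (auto simp: algebra_homs_def ring_hom_def base_module_simps)

lemma comult_one: "comult H \<one>\<^bsub>H\<^esub> = pure_tensor K H H \<one>\<^bsub>H\<^esub> \<one>\<^bsub>H\<^esub>"
  using comult_hom by (auto simp: algebra_homs_def ring_hom_def tensor_def)

lemma comult_mult: "\<lbrakk>h \<in> carrier H; k \<in> carrier H\<rbrakk>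
    \<Longrightarrow> comult H (h \<otimes>\<^bsub>H\<^esub> k) = comult H h \<otimes>\<^bsub>tensor K H H\<^esub> comult H k"
  using comult_hom by (auto simp: algebra_homs_def ring_hom_def)

lemma H_one_closed: "\<one>\<^bsub>H\<^esub> \<in> carrier H"
  using algebra_H by (simp add: unital_algebra_def ring.is_monoid monoid.one_closed)

lemmas H_mult_closed = bilinear_maps_closed[OF mult_bilinear[OF algebra_H]]
lemmas comult_closed = linear_maps_closed[OF comult_linear]
lemmas antipode_closed = linear_maps_closed[OF antipode_linear]

text \<open>Closure rules by which multilinearity of a nested Sweedler expression is checked
  syntactically, one constructor at a time. The modules involved are found by unification, and this is
  why in the rules for \<open>tensor_lift\<close> the premise that determines them comes first.\<close>

lemmas sweedler_intros = linear_id module_H module_K module_tensor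
  bilinear_maps_closed[OF K_mult_bilinear, unfolded base_module_simps]
  H_one_closed H_mult_closed comult_closed antipode_closed counit_closed module.smult_closed
  bilinear_mapsI tensor_lift_linear_arg tensor_lift_linear_fun tensor_lift_closed
  pure_tensor_linear_left pure_tensor_linear_right pure_tensor_closed
  smult_linear_left smult_linear_right K_mult_linear
  mult_linear_left[OF algebra_H] mult_linear_right[OF algebra_H]
  linear_compose[OF comult_linear] linear_compose[OF counit_linear] linear_compose[OF antipode_linear]

lemma sweedler_cong:
  assumes "h \<in> carrier H" "module K P" "f \<in> bilinear_maps K H H P"
    and "\<And>a b. \<lbrakk>a \<in> carrier H; b \<in> carrier H\<rbrakk> \<Longrightarrow> f a b = g a b"
  shows "sweedler P f h = sweedler P g h"
  by (rule tensor_lift_cong[OF module_H module_H assms(2) comult_closed[OF assms(1)] assms(3,4)])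

lemma linear_sweedler:
  assumes "h \<in> carrier H" "module K P" "module K Q" "g \<in> linear_maps K P Q" "f \<in> bilinear_maps K H H P"
  shows "g (sweedler P f h) = sweedler Q (\<lambda>a b. g (f a b)) h"
  by (rule linear_tensor_lift[OF comult_closed[OF assms(1)] module_H module_H assms(2-5)])

text \<open>The coassociativity axiom, stated between two tensors, becomes an identity of Sweedler sums by
  applying to both sides the linear map that \<open>f\<close> induces on the triple tensor product.\<close>

lemma sweedler_coassoc:
  assumes h: "h \<in> carrier H" and P: "module K P"
    and f1: "\<And>a. a \<in> carrier H \<Longrightarrow> f a \<in> bilinear_maps K H H P"
    and f2: "\<And>b c. \<lbrakk>b \<in> carrier H; c \<in> carrier H\<rbrakk> \<Longrightarrow> (\<lambda>a. f a b c) \<in> linear_maps K H P"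
  shows "sweedler P (\<lambda>a c. sweedler P (\<lambda>a1 a2. f a1 a2 c) a) h
    = sweedler P (\<lambda>a c. sweedler P (f a) c) h"
proof -
  have HH: "module K (tensor K H H)"
    by (intro module_tensor module_H)
  note rules = bilinear_maps_left[OF f1] bilinear_maps_right[OF f1] f1 f2 P sweedler_intros
  have f3: "(\<lambda>a b. f a b c) \<in> bilinear_maps K H H P" if "c \<in> carrier H" for c
    by (assumption | rule that rules)+
  let ?t = "tensor_map K (tensor K H H) H (comult H) id (comult H h)"
  have id: "id \<in> linear_maps K H H"
    using linear_id by (simp add: id_def)
  have t: "?t \<in> carrier (tensor K (tensor K H H) H)"
    by (rule linear_maps_closed[OF tensor_map_linear[OF module_H module_H HH module_H comult_linear id]
        comult_closed[OF h]])
  have s: "(\<lambda>s c. tensor_lift K P (\<lambda>a b. f a b c) s) \<in> bilinear_maps K (tensor K H H) H P"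
    by (assumption | rule f3 rules)+
  have r: "(\<lambda>a s. tensor_lift K P (f a) s) \<in> bilinear_maps K H (tensor K H H) P"
    by (assumption | rule f3 rules)+
  have "sweedler P (\<lambda>a c. sweedler P (\<lambda>a1 a2. f a1 a2 c) a) h
    = tensor_lift K P (\<lambda>a s. tensor_lift K P (f a) s) (tensor_assoc K H H H ?t)"
    using tensor_lift_tensor_assoc[OF t module_H module_H module_H P f1 f2]
      tensor_lift_tensor_map[OF comult_closed[OF h] module_H module_H HH module_H P comult_linear id s]
    by simp
  also have "\<dots> = sweedler P (\<lambda>a c. sweedler P (f a) c) h"
    unfolding coassoc[OF h]
    using tensor_lift_tensor_map[OF comult_closed[OF h] module_H module_H module_H HH P id comult_linear r]
    by simp
  finally show ?thesis .
qed

lemma sweedler_mult: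
  assumes h: "h \<in> carrier H" and k: "k \<in> carrier H" and P: "module K P" and f: "f \<in> bilinear_maps K H H P"
  shows "sweedler P f (h \<otimes>\<^bsub>H\<^esub> k)
    = sweedler P (\<lambda>a b. sweedler P (\<lambda>c d. f (a \<otimes>\<^bsub>H\<^esub> c) (b \<otimes>\<^bsub>H\<^esub> d)) k) h"
proof -
  let ?V = "tensor K H H"
  let ?p = "\<lambda>a b c d. pure_tensor K H H (a \<otimes>\<^bsub>H\<^esub> c) (b \<otimes>\<^bsub>H\<^esub> d)"
  have V: "module K ?V"
    by (intro module_tensor module_H)
  have lift: "tensor_lift K P f \<in> linear_maps K ?V P"
    by (rule tensor_lift_linear[OF module_H module_H P f])
  note rules = bilinear_compose_left[OF f] bilinear_compose_right[OF f] P h k sweedler_intros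
  have p: "?p a b \<in> bilinear_maps K H H ?V" if "a \<in> carrier H" "b \<in> carrier H" for a b
    by (assumption | rule that rules)+
  have "sweedler P f (h \<otimes>\<^bsub>H\<^esub> k)
      = tensor_lift K P f (sweedler ?V (\<lambda>a b. sweedler ?V (?p a b) k) h)"
    by (simp add: comult_mult h k tensor_mult)
  also have "\<dots> = sweedler P (\<lambda>a b. tensor_lift K P f (sweedler ?V (?p a b) k)) h"
    by (rule linear_sweedler[OF h V P lift]) (assumption | rule rules)+
  also have "\<dots> = sweedler P (\<lambda>a b. sweedler P (\<lambda>c d. f (a \<otimes>\<^bsub>H\<^esub> c) (b \<otimes>\<^bsub>H\<^esub> d)) k) h"
  proof (rule sym, rule sweedler_cong[OF h P])
    show "(\<lambda>a b. sweedler P (\<lambda>c d. f (a \<otimes>\<^bsub>H\<^esub> c) (b \<otimes>\<^bsub>H\<^esub> d)) k) \<in> bilinear_maps K H H P"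
      by (assumption | rule rules)+
    fix a b assume ab: "a \<in> carrier H" "b \<in> carrier H"
    have "tensor_lift K P f (sweedler ?V (?p a b) k) = sweedler P (\<lambda>c d. tensor_lift K P f (?p a b c d)) k"
      by (rule linear_sweedler[OF k V P lift p[OF ab]])
    also have "\<dots> = sweedler P (\<lambda>c d. f (a \<otimes>\<^bsub>H\<^esub> c) (b \<otimes>\<^bsub>H\<^esub> d)) k"
    proof (rule sym, rule sweedler_cong[OF k P])
      show "(\<lambda>c d. f (a \<otimes>\<^bsub>H\<^esub> c) (b \<otimes>\<^bsub>H\<^esub> d)) \<in> bilinear_maps K H H P"
        by (assumption | rule ab rules)+
    qed (simp add: tensor_lift_pure[OF module_H module_H P f] H_mult_closed ab)
    finally show "sweedler P (\<lambda>c d. f (a \<otimes>\<^bsub>H\<^esub> c) (b \<otimes>\<^bsub>H\<^esub> d)) k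
      = tensor_lift K P f (sweedler ?V (?p a b) k)" ..
  qed
  finally show ?thesis .
qed

lemma sweedler_counit_left:
  assumes h: "h \<in> carrier H" and P: "module K P" and f: "f \<in> linear_maps K H P"
  shows "sweedler P (\<lambda>a b. counit H a \<odot>\<^bsub>P\<^esub> f b) h = f h"
proof -
  have bil: "(\<lambda>a b. counit H a \<odot>\<^bsub>H\<^esub> b) \<in> bilinear_maps K H H H"
    by (assumption | rule sweedler_intros)+
  have "f h = sweedler P (\<lambda>a b. f (counit H a \<odot>\<^bsub>H\<^esub> b)) h"
    using linear_sweedler[OF h module_H P f bil] counit_left[OF h] by simp
  also have "\<dots> = sweedler P (\<lambda>a b. counit H a \<odot>\<^bsub>P\<^esub> f b) h"
    by (rule sweedler_cong[OF h P])
       ((assumption | rule linear_compose[OF f] P sweedler_intros)+,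
        simp add: linear_maps_smult[OF f] counit_closed)
  finally show ?thesis ..
qed

lemma sweedler_counit_right:
  assumes h: "h \<in> carrier H" and P: "module K P" and f: "f \<in> linear_maps K H P"
  shows "sweedler P (\<lambda>a b. counit H b \<odot>\<^bsub>P\<^esub> f a) h = f h"
proof -
  have bil: "(\<lambda>a b. counit H b \<odot>\<^bsub>H\<^esub> a) \<in> bilinear_maps K H H H"
    by (assumption | rule sweedler_intros)+
  have "f h = sweedler P (\<lambda>a b. f (counit H b \<odot>\<^bsub>H\<^esub> a)) h"
    using linear_sweedler[OF h module_H P f bil] counit_right[OF h] by simp
  also have "\<dots> = sweedler P (\<lambda>a b. counit H b \<odot>\<^bsub>P\<^esub> f a) h"
    by (rule sweedler_cong[OF h P])
       ((assumption | rule linear_compose[OF f] P sweedler_intros)+,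
        simp add: linear_maps_smult[OF f] counit_closed)
  finally show ?thesis ..
qed

lemma sweedler_antipode_left:
  assumes h: "h \<in> carrier H"
  shows "sweedler H (\<lambda>a b. antipode H a \<otimes>\<^bsub>H\<^esub> b) h = counit H h \<odot>\<^bsub>H\<^esub> \<one>\<^bsub>H\<^esub>"
proof -
  have id: "id \<in> linear_maps K H H"
    using linear_id by (simp add: id_def)
  show ?thesis
    using antipode_left[OF h]
      tensor_lift_tensor_map[OF comult_closed[OF h] module_H module_H module_H module_H module_H
        antipode_linear id mult_bilinear[OF algebra_H]]
    by (simp add: mult_map_def)
qed

lemma sweedler_antipode_right:
  assumes h: "h \<in> carrier H"
  shows "sweedler H (\<lambda>a b. a \<otimes>\<^bsub>H\<^esub> antipode H b) h = counit H h \<odot>\<^bsub>H\<^esub> \<one>\<^bsub>H\<^esub>"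
proof -
  have id: "id \<in> linear_maps K H H"
    using linear_id by (simp add: id_def)
  show ?thesis
    using antipode_right[OF h]
      tensor_lift_tensor_map[OF comult_closed[OF h] module_H module_H module_H module_H module_H
        id antipode_linear mult_bilinear[OF algebra_H]]
    by (simp add: mult_map_def)
qed

text \<open>The convolution product of bilinear maps \<open>H \<times> H \<rightarrow> H\<close>, that is, of linear maps from the
  coalgebra \<open>H \<otimes> H\<close> to the algebra \<open>H\<close>.\<close>

definition conv :: "('h \<Rightarrow> 'h \<Rightarrow> 'h) \<Rightarrow> ('h \<Rightarrow> 'h \<Rightarrow> 'h) \<Rightarrow> 'h \<Rightarrow> 'h \<Rightarrow> 'h"
  where "conv f g h k = sweedler H (\<lambda>a b. sweedler H (\<lambda>c d. f a c \<otimes>\<^bsub>H\<^esub> g b d) k) h"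

text \<open>Coassociativity is applied once in each of the two arguments. Before and
  after that, sums are interchanged so that the nested coproducts of the same argument are adjacent.\<close>

lemma conv_assoc:
  assumes f: "f \<in> bilinear_maps K H H H" and g: "g \<in> bilinear_maps K H H H" and u: "u \<in> bilinear_maps K H H H"
    and h: "h \<in> carrier H" and k: "k \<in> carrier H"
  shows "conv (conv f g) u h k = conv f (conv g u) h k"
proof -
  note comp = bilinear_compose_left[OF f] bilinear_compose_right[OF f]
    bilinear_compose_left[OF g] bilinear_compose_right[OF g]
    bilinear_compose_left[OF u] bilinear_compose_right[OF u]
  note rules = comp bilinear_maps_closed[OF f] bilinear_maps_closed[OF g] bilinear_maps_closed[OF u]
    h k sweedler_intros
  let ?T = "\<lambda>a1 a2 a3 c1 c2 c3. f a1 c1 \<otimes>\<^bsub>H\<^esub> (g a2 c2 \<otimes>\<^bsub>H\<^esub> u a3 c3)"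
  have assoc: "f a c \<otimes>\<^bsub>H\<^esub> g a' c' \<otimes>\<^bsub>H\<^esub> u a'' c'' = ?T a a' a'' c c' c''"
    if "a \<in> carrier H" "c \<in> carrier H" "a' \<in> carrier H" "c' \<in> carrier H" "a'' \<in> carrier H" "c'' \<in> carrier H"
    for a c a' c' a'' c''
    using that by (simp add: m_assoc bilinear_maps_closed[OF f] bilinear_maps_closed[OF g] bilinear_maps_closed[OF u])
  have swap: "sweedler H (\<lambda>c d. sweedler H (\<lambda>a b. q c d a b) a') c'
      = sweedler H (\<lambda>a b. sweedler H (\<lambda>c d. q c d a b) c') a'"
    if "a' \<in> carrier H" "c' \<in> carrier H"
      "\<And>c d. \<lbrakk>c \<in> carrier H; d \<in> carrier H\<rbrakk> \<Longrightarrow> q c d \<in> bilinear_maps K H H H"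
      "\<And>a b. \<lbrakk>a \<in> carrier H; b \<in> carrier H\<rbrakk> \<Longrightarrow> (\<lambda>c d. q c d a b) \<in> bilinear_maps K H H H" for q a' c'
    by (rule tensor_lift_swap[OF comult_closed[OF that(2)] comult_closed[OF that(1)]
          module_H module_H module_H module_H module_H that(3,4)])
  have "conv (conv f g) u h k
      = sweedler H (\<lambda>a b. sweedler H (\<lambda>c d. sweedler H (\<lambda>a1 a2. sweedler H (\<lambda>c1 c2. ?T a1 a2 b c1 c2 d) c) a) k) h"
    unfolding conv_def
  proof (intro sweedler_cong h k module_H)
    fix a b c d assume abcd: "a \<in> carrier H" "b \<in> carrier H" "c \<in> carrier H" "d \<in> carrier H"
    have "sweedler H (\<lambda>a1 a2. sweedler H (\<lambda>c1 c2. f a1 c1 \<otimes>\<^bsub>H\<^esub> g a2 c2) c) a \<otimes>\<^bsub>H\<^esub> u b d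
      = sweedler H (\<lambda>a1 a2. sweedler H (\<lambda>c1 c2. f a1 c1 \<otimes>\<^bsub>H\<^esub> g a2 c2) c \<otimes>\<^bsub>H\<^esub> u b d) a"
      by (rule linear_sweedler[OF _ module_H module_H, where g = "\<lambda>x. x \<otimes>\<^bsub>H\<^esub> u b d"])
         (assumption | rule abcd rules)+
    also have "\<dots> = sweedler H (\<lambda>a1 a2. sweedler H (\<lambda>c1 c2. ?T a1 a2 b c1 c2 d) c) a"
    proof (rule sweedler_cong[OF abcd(1) module_H])
      show "(\<lambda>a1 a2. sweedler H (\<lambda>c1 c2. f a1 c1 \<otimes>\<^bsub>H\<^esub> g a2 c2) c \<otimes>\<^bsub>H\<^esub> u b d) \<in> bilinear_maps K H H H"
        by (assumption | rule abcd rules)+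
      fix a1 a2 assume a12: "a1 \<in> carrier H" "a2 \<in> carrier H"
      have "sweedler H (\<lambda>c1 c2. f a1 c1 \<otimes>\<^bsub>H\<^esub> g a2 c2) c \<otimes>\<^bsub>H\<^esub> u b d
        = sweedler H (\<lambda>c1 c2. f a1 c1 \<otimes>\<^bsub>H\<^esub> g a2 c2 \<otimes>\<^bsub>H\<^esub> u b d) c"
        by (rule linear_sweedler[OF _ module_H module_H, where g = "\<lambda>x. x \<otimes>\<^bsub>H\<^esub> u b d"])
           (assumption | rule a12 abcd rules)+
      also have "\<dots> = sweedler H (\<lambda>c1 c2. ?T a1 a2 b c1 c2 d) c"
      proof (rule sweedler_cong[OF abcd(3) module_H])
        show "(\<lambda>c1 c2. f a1 c1 \<otimes>\<^bsub>H\<^esub> g a2 c2 \<otimes>\<^bsub>H\<^esub> u b d) \<in> bilinear_maps K H H H"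
          by (assumption | rule a12 abcd rules)+
      qed (rule assoc, (assumption | rule a12 abcd)+)
      finally show "sweedler H (\<lambda>c1 c2. f a1 c1 \<otimes>\<^bsub>H\<^esub> g a2 c2) c \<otimes>\<^bsub>H\<^esub> u b d
        = sweedler H (\<lambda>c1 c2. ?T a1 a2 b c1 c2 d) c" .
    qed
    finally show "sweedler H (\<lambda>a1 a2. sweedler H (\<lambda>c1 c2. f a1 c1 \<otimes>\<^bsub>H\<^esub> g a2 c2) c) a \<otimes>\<^bsub>H\<^esub> u b d
      = sweedler H (\<lambda>a1 a2. sweedler H (\<lambda>c1 c2. ?T a1 a2 b c1 c2 d) c) a" .
  qed (assumption | rule rules)+
  also have "\<dots> = sweedler H (\<lambda>a b. sweedler H (\<lambda>a1 a2. sweedler H (\<lambda>c d. sweedler H (\<lambda>c1 c2. ?T a1 a2 b c1 c2 d) c) k) a) h"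
    by (rule sweedler_cong[OF h module_H]; (rule swap)?) (assumption | rule rules)+
  also have "\<dots> = sweedler H (\<lambda>a b. sweedler H (\<lambda>a1 a2. sweedler H (\<lambda>c d. sweedler H (\<lambda>c1 c2. ?T a1 a2 b c c1 c2) d) k) a) h"
    by (rule sweedler_cong[OF h module_H]; (rule sweedler_cong[OF _ module_H]; (rule sweedler_coassoc)?)?)
       (assumption | rule rules)+
  also have "\<dots> = sweedler H (\<lambda>a b. sweedler H (\<lambda>b1 b2. sweedler H (\<lambda>c d. sweedler H (\<lambda>c1 c2. ?T a b1 b2 c c1 c2) d) k) b) h"
    by (rule sweedler_coassoc) (assumption | rule rules)+
  also have "\<dots> = sweedler H (\<lambda>a b. sweedler H (\<lambda>c d. sweedler H (\<lambda>b1 b2. sweedler H (\<lambda>c1 c2. ?T a b1 b2 c c1 c2) d) b) k) h"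
    by (rule sweedler_cong[OF h module_H]; (rule swap[symmetric])?) (assumption | rule rules)+
  also have "\<dots> = conv f (conv g u) h k"
    unfolding conv_def
  proof (intro sweedler_cong h k module_H)
    fix a b c d assume abcd: "a \<in> carrier H" "b \<in> carrier H" "c \<in> carrier H" "d \<in> carrier H"
    have "f a c \<otimes>\<^bsub>H\<^esub> sweedler H (\<lambda>b1 b2. sweedler H (\<lambda>c1 c2. g b1 c1 \<otimes>\<^bsub>H\<^esub> u b2 c2) d) b
      = sweedler H (\<lambda>b1 b2. f a c \<otimes>\<^bsub>H\<^esub> sweedler H (\<lambda>c1 c2. g b1 c1 \<otimes>\<^bsub>H\<^esub> u b2 c2) d) b"
      by (rule linear_sweedler[OF _ module_H module_H, where g = "\<lambda>x. f a c \<otimes>\<^bsub>H\<^esub> x"])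
         (assumption | rule abcd rules)+
    also have "\<dots> = sweedler H (\<lambda>b1 b2. sweedler H (\<lambda>c1 c2. ?T a b1 b2 c c1 c2) d) b"
    proof (rule sweedler_cong[OF abcd(2) module_H])
      show "(\<lambda>b1 b2. f a c \<otimes>\<^bsub>H\<^esub> sweedler H (\<lambda>c1 c2. g b1 c1 \<otimes>\<^bsub>H\<^esub> u b2 c2) d) \<in> bilinear_maps K H H H"
        by (assumption | rule abcd rules)+
      show "f a c \<otimes>\<^bsub>H\<^esub> sweedler H (\<lambda>c1 c2. g b1 c1 \<otimes>\<^bsub>H\<^esub> u b2 c2) d = sweedler H (\<lambda>c1 c2. ?T a b1 b2 c c1 c2) d"
        if "b1 \<in> carrier H" "b2 \<in> carrier H" for b1 b2
        by (rule linear_sweedler[OF _ module_H module_H, where g = "\<lambda>x. f a c \<otimes>\<^bsub>H\<^esub> x"])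
           (assumption | rule that abcd rules)+
    qed
    finally show "sweedler H (\<lambda>b1 b2. sweedler H (\<lambda>c1 c2. ?T a b1 b2 c c1 c2) d) b
      = f a c \<otimes>\<^bsub>H\<^esub> sweedler H (\<lambda>b1 b2. sweedler H (\<lambda>c1 c2. g b1 c1 \<otimes>\<^bsub>H\<^esub> u b2 c2) d) b" ..
  qed (assumption | rule rules)+
  finally show ?thesis .
qed

lemma conv_counit_right:
  assumes f: "f \<in> bilinear_maps K H H H" and h: "h \<in> carrier H" and k: "k \<in> carrier H"
  shows "conv f (\<lambda>b d. (counit H b \<otimes>\<^bsub>K\<^esub> counit H d) \<odot>\<^bsub>H\<^esub> \<one>\<^bsub>H\<^esub>) h k = f h k"
proof -
  note rules = bilinear_compose_left[OF f] bilinear_compose_right[OF f] bilinear_maps_closed[OF f]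
    h k sweedler_intros
  have "conv f (\<lambda>b d. (counit H b \<otimes>\<^bsub>K\<^esub> counit H d) \<odot>\<^bsub>H\<^esub> \<one>\<^bsub>H\<^esub>) h k
      = sweedler H (\<lambda>a b. counit H b \<odot>\<^bsub>H\<^esub> f a k) h"
    unfolding conv_def
  proof (rule sweedler_cong[OF h module_H])
    fix a b assume ab: "a \<in> carrier H" "b \<in> carrier H"
    have "sweedler H (\<lambda>c d. f a c \<otimes>\<^bsub>H\<^esub> ((counit H b \<otimes>\<^bsub>K\<^esub> counit H d) \<odot>\<^bsub>H\<^esub> \<one>\<^bsub>H\<^esub>)) k
        = sweedler H (\<lambda>c d. counit H d \<odot>\<^bsub>H\<^esub> (counit H b \<odot>\<^bsub>H\<^esub> f a c)) k"
    proof (rule sweedler_cong[OF k module_H])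
      fix c d assume cd: "c \<in> carrier H" "d \<in> carrier H"
      then show "f a c \<otimes>\<^bsub>H\<^esub> ((counit H b \<otimes>\<^bsub>K\<^esub> counit H d) \<odot>\<^bsub>H\<^esub> \<one>\<^bsub>H\<^esub>)
          = counit H d \<odot>\<^bsub>H\<^esub> (counit H b \<odot>\<^bsub>H\<^esub> f a c)"
        by (simp add: ab counit_closed bilinear_maps_closed[OF f] smult_mult_right H_one_closed
           K_simps smult_assoc1[symmetric])
    qed (assumption | rule ab rules)+
    also have "\<dots> = counit H b \<odot>\<^bsub>H\<^esub> f a k"
      by (rule sweedler_counit_right[OF k module_H]) (assumption | rule ab rules)+
    finally show "sweedler H (\<lambda>c d. f a c \<otimes>\<^bsub>H\<^esub> ((counit H b \<otimes>\<^bsub>K\<^esub> counit H d) \<odot>\<^bsub>H\<^esub> \<one>\<^bsub>H\<^esub>)) k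
        = counit H b \<odot>\<^bsub>H\<^esub> f a k" .
  qed (assumption | rule rules)+
  also have "\<dots> = f h k"
    by (rule sweedler_counit_right[OF h module_H]) (assumption | rule rules)+
  finally show ?thesis .
qed

lemma conv_counit_left:
  assumes f: "f \<in> bilinear_maps K H H H" and h: "h \<in> carrier H" and k: "k \<in> carrier H"
  shows "conv (\<lambda>a c. (counit H a \<otimes>\<^bsub>K\<^esub> counit H c) \<odot>\<^bsub>H\<^esub> \<one>\<^bsub>H\<^esub>) f h k = f h k"
proof -
  note rules = bilinear_compose_left[OF f] bilinear_compose_right[OF f] bilinear_maps_closed[OF f]
    h k sweedler_intros
  have "conv (\<lambda>a c. (counit H a \<otimes>\<^bsub>K\<^esub> counit H c) \<odot>\<^bsub>H\<^esub> \<one>\<^bsub>H\<^esub>) f h k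
      = sweedler H (\<lambda>a b. counit H a \<odot>\<^bsub>H\<^esub> f b k) h"
    unfolding conv_def
  proof (rule sweedler_cong[OF h module_H])
    fix a b assume ab: "a \<in> carrier H" "b \<in> carrier H"
    have "sweedler H (\<lambda>c d. (counit H a \<otimes>\<^bsub>K\<^esub> counit H c) \<odot>\<^bsub>H\<^esub> \<one>\<^bsub>H\<^esub> \<otimes>\<^bsub>H\<^esub> f b d) k
        = sweedler H (\<lambda>c d. counit H c \<odot>\<^bsub>H\<^esub> (counit H a \<odot>\<^bsub>H\<^esub> f b d)) k"
    proof (rule sweedler_cong[OF k module_H])
      fix c d assume cd: "c \<in> carrier H" "d \<in> carrier H"
      then show "(counit H a \<otimes>\<^bsub>K\<^esub> counit H c) \<odot>\<^bsub>H\<^esub> \<one>\<^bsub>H\<^esub> \<otimes>\<^bsub>H\<^esub> f b d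
          = counit H c \<odot>\<^bsub>H\<^esub> (counit H a \<odot>\<^bsub>H\<^esub> f b d)"
        by (simp add: ab counit_closed bilinear_maps_closed[OF f] smult_mult_left H_one_closed
           K_simps smult_assoc1[symmetric])
    qed (assumption | rule ab rules)+
    also have "\<dots> = counit H a \<odot>\<^bsub>H\<^esub> f b k"
      by (rule sweedler_counit_left[OF k module_H]) (assumption | rule ab rules)+
    finally show "sweedler H (\<lambda>c d. (counit H a \<otimes>\<^bsub>K\<^esub> counit H c) \<odot>\<^bsub>H\<^esub> \<one>\<^bsub>H\<^esub> \<otimes>\<^bsub>H\<^esub> f b d) k
        = counit H a \<odot>\<^bsub>H\<^esub> f b k" .
  qed (assumption | rule rules)+
  also have "\<dots> = f h k"
    by (rule sweedler_counit_left[OF h module_H]) (assumption | rule rules)+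
  finally show ?thesis .
qed

lemma conv_cong:
  assumes "f \<in> bilinear_maps K H H H" "g \<in> bilinear_maps K H H H" "h \<in> carrier H" "k \<in> carrier H"
    and "\<And>a b. \<lbrakk>a \<in> carrier H; b \<in> carrier H\<rbrakk> \<Longrightarrow> f a b = f' a b"
    and "\<And>a b. \<lbrakk>a \<in> carrier H; b \<in> carrier H\<rbrakk> \<Longrightarrow> g a b = g' a b"
  shows "conv f g h k = conv f' g' h k"
  unfolding conv_def
proof (rule sweedler_cong[OF assms(3) module_H])
  note comp = bilinear_compose_left[OF assms(1)] bilinear_compose_right[OF assms(1)]
    bilinear_compose_left[OF assms(2)] bilinear_compose_right[OF assms(2)]
    bilinear_maps_closed[OF assms(1)] bilinear_maps_closed[OF assms(2)]
  show "(\<lambda>a b. sweedler H (\<lambda>c d. f a c \<otimes>\<^bsub>H\<^esub> g b d) k) \<in> bilinear_maps K H H H"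
    by (assumption | rule comp assms(4) sweedler_intros)+
  fix a b assume ab: "a \<in> carrier H" "b \<in> carrier H"
  show "sweedler H (\<lambda>c d. f a c \<otimes>\<^bsub>H\<^esub> g b d) k = sweedler H (\<lambda>c d. f' a c \<otimes>\<^bsub>H\<^esub> g' b d) k"
    by (rule sweedler_cong[OF assms(4) module_H], (assumption | rule ab comp sweedler_intros)+)
       (simp add: assms(5,6) ab)
qed

text \<open>In the convolution algebra of bilinear maps, the multiplication \<open>\<mu>\<close> has the left inverse
  \<open>S \<circ> \<mu>\<close> and the right inverse \<open>(a, c) \<mapsto> S(c) S(a)\<close>, which therefore coincide.\<close>

lemma antipode_mult:
  assumes h: "h \<in> carrier H" and k: "k \<in> carrier H"
  shows "antipode H (h \<otimes>\<^bsub>H\<^esub> k) = antipode H k \<otimes>\<^bsub>H\<^esub> antipode H h"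
proof -
  let ?N = "\<lambda>a c. antipode H (a \<otimes>\<^bsub>H\<^esub> c)" and ?V = "\<lambda>a c. antipode H c \<otimes>\<^bsub>H\<^esub> antipode H a"
    and ?M = "\<lambda>a c. a \<otimes>\<^bsub>H\<^esub> c" and ?E = "\<lambda>a c. (counit H a \<otimes>\<^bsub>K\<^esub> counit H c) \<odot>\<^bsub>H\<^esub> \<one>\<^bsub>H\<^esub>"
  have N: "?N \<in> bilinear_maps K H H H" and V: "?V \<in> bilinear_maps K H H H"
    and M: "?M \<in> bilinear_maps K H H H" and E: "?E \<in> bilinear_maps K H H H"
    by (assumption | rule sweedler_intros)+
  have S: "(\<lambda>a b. antipode H a \<otimes>\<^bsub>H\<^esub> b) \<in> bilinear_maps K H H H"
    by (assumption | rule sweedler_intros)+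
  have NM: "conv ?N ?M a c = ?E a c" if a: "a \<in> carrier H" and c: "c \<in> carrier H" for a c
    using sweedler_mult[OF a c module_H S] sweedler_antipode_left[of "a \<otimes>\<^bsub>H\<^esub> c"] a c
    by (simp add: conv_def H_mult_closed counit_mult)
  have MV: "conv ?M ?V a c = ?E a c" if a: "a \<in> carrier H" and c: "c \<in> carrier H" for a c
  proof -
    note rules = a c sweedler_intros
    have "conv ?M ?V a c = sweedler H (\<lambda>a1 a2. counit H c \<odot>\<^bsub>H\<^esub> (a1 \<otimes>\<^bsub>H\<^esub> antipode H a2)) a"
      unfolding conv_def
    proof (rule sweedler_cong[OF a module_H])
      fix a1 a2 assume a12: "a1 \<in> carrier H" "a2 \<in> carrier H"
      have "sweedler H (\<lambda>c1 c2. a1 \<otimes>\<^bsub>H\<^esub> c1 \<otimes>\<^bsub>H\<^esub> (antipode H c2 \<otimes>\<^bsub>H\<^esub> antipode H a2)) c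
          = sweedler H (\<lambda>c1 c2. a1 \<otimes>\<^bsub>H\<^esub> (c1 \<otimes>\<^bsub>H\<^esub> antipode H c2) \<otimes>\<^bsub>H\<^esub> antipode H a2) c"
        by (rule sweedler_cong[OF c module_H], (assumption | rule a12 rules)+)
           (simp add: a12 antipode_closed H_mult_closed m_assoc)
      also have "\<dots> = a1 \<otimes>\<^bsub>H\<^esub> sweedler H (\<lambda>c1 c2. c1 \<otimes>\<^bsub>H\<^esub> antipode H c2) c \<otimes>\<^bsub>H\<^esub> antipode H a2"
        by (rule linear_sweedler[OF c module_H module_H, symmetric, where g = "\<lambda>x. a1 \<otimes>\<^bsub>H\<^esub> x \<otimes>\<^bsub>H\<^esub> antipode H a2"])
           (assumption | rule a12 rules)+
      also have "\<dots> = counit H c \<odot>\<^bsub>H\<^esub> (a1 \<otimes>\<^bsub>H\<^esub> antipode H a2)"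
        unfolding sweedler_antipode_right[OF c]
        using a12 c by (simp add: counit_closed antipode_closed smult_mult_right smult_mult_left)
      finally show "sweedler H (\<lambda>c1 c2. a1 \<otimes>\<^bsub>H\<^esub> c1 \<otimes>\<^bsub>H\<^esub> (antipode H c2 \<otimes>\<^bsub>H\<^esub> antipode H a2)) c
          = counit H c \<odot>\<^bsub>H\<^esub> (a1 \<otimes>\<^bsub>H\<^esub> antipode H a2)" .
    qed (assumption | rule rules)+
    also have "\<dots> = counit H c \<odot>\<^bsub>H\<^esub> sweedler H (\<lambda>a1 a2. a1 \<otimes>\<^bsub>H\<^esub> antipode H a2) a"
      by (rule linear_sweedler[OF a module_H module_H, symmetric, where g = "\<lambda>x. counit H c \<odot>\<^bsub>H\<^esub> x"])
         (assumption | rule rules)+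
    also have "\<dots> = ?E a c"
      using a c by (simp add: sweedler_antipode_right counit_closed K_simps H_one_closed smult_assoc1[symmetric])
    finally show ?thesis .
  qed
  have "antipode H (h \<otimes>\<^bsub>H\<^esub> k) = conv ?N ?E h k"
    by (rule conv_counit_right[OF N h k, symmetric])
  also have "\<dots> = conv ?N (conv ?M ?V) h k"
    by (rule conv_cong[OF N E h k]) (simp_all add: MV)
  also have "\<dots> = conv (conv ?N ?M) ?V h k"
    by (rule conv_assoc[OF N M V h k, symmetric])
  also have "\<dots> = conv ?E ?V h k"
    by (rule conv_cong[OF E V h k, symmetric]) (simp_all add: NM)
  also have "\<dots> = antipode H k \<otimes>\<^bsub>H\<^esub> antipode H h"
    by (rule conv_counit_left[OF V h k])
  finally show ?thesis .
qed

lemma antipode_one: "antipode H \<one>\<^bsub>H\<^esub> = \<one>\<^bsub>H\<^esub>"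
proof -
  have S: "(\<lambda>a b. antipode H a \<otimes>\<^bsub>H\<^esub> b) \<in> bilinear_maps K H H H"
    by (assumption | rule sweedler_intros)+
  show ?thesis
    using sweedler_antipode_left[OF H_one_closed] antipode_closed[OF H_one_closed]
      tensor_lift_pure[OF module_H module_H module_H S H_one_closed H_one_closed]
    by (simp add: comult_one counit_one H_one_closed)
qed

lemma antipode_inv_props:
  assumes bij: "bij_betw (antipode H) (carrier H) (carrier H)" and h: "h \<in> carrier H"
  shows "antipode_inv H h \<in> carrier H" "antipode H (antipode_inv H h) = h"
  using assms unfolding antipode_inv_def bij_betw_def by (auto intro: inv_into_into f_inv_into_f)

lemma antipode_inv_linear:
  assumes bij: "bij_betw (antipode H) (carrier H) (carrier H)"
  shows "antipode_inv H \<in> linear_maps K H H"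
proof -
  have inj: "x = y" if "antipode H x = antipode H y" "x \<in> carrier H" "y \<in> carrier H" for x y
    using that bij by (auto simp: bij_betw_def inj_on_def)
  note T = antipode_inv_props[OF bij]
  show ?thesis
    by (rule linear_mapsI, simp add: T; rule inj)
       (simp_all add: T linear_maps_add[OF antipode_linear] linear_maps_smult[OF antipode_linear])
qed

text \<open>The inverse of the antipode is an antipode for the opposite coproduct: applying the injective map
  \<open>S\<close>, which reverses products, reduces both identities to the antipode axioms.\<close>

lemma antipode_inv_sweedler:
  assumes bij: "bij_betw (antipode H) (carrier H) (carrier H)" and h: "h \<in> carrier H"
  shows "sweedler H (\<lambda>a b. antipode_inv H b \<otimes>\<^bsub>H\<^esub> a) h = counit H h \<odot>\<^bsub>H\<^esub> \<one>\<^bsub>H\<^esub>"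
    and "sweedler H (\<lambda>a b. b \<otimes>\<^bsub>H\<^esub> antipode_inv H a) h = counit H h \<odot>\<^bsub>H\<^esub> \<one>\<^bsub>H\<^esub>"
proof -
  have inj: "x = y" if "antipode H x = antipode H y" "x \<in> carrier H" "y \<in> carrier H" for x y
    using that bij by (auto simp: bij_betw_def inj_on_def)
  note T = antipode_inv_props[OF bij]
  note rules = h T(1) linear_compose[OF antipode_inv_linear[OF bij]] sweedler_intros
  have e: "antipode H (counit H h \<odot>\<^bsub>H\<^esub> \<one>\<^bsub>H\<^esub>) = counit H h \<odot>\<^bsub>H\<^esub> \<one>\<^bsub>H\<^esub>"
    by (simp add: linear_maps_smult[OF antipode_linear] counit_closed h H_one_closed antipode_one)
  show "sweedler H (\<lambda>a b. antipode_inv H b \<otimes>\<^bsub>H\<^esub> a) h = counit H h \<odot>\<^bsub>H\<^esub> \<one>\<^bsub>H\<^esub>"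
  proof (rule inj)
    have "antipode H (sweedler H (\<lambda>a b. antipode_inv H b \<otimes>\<^bsub>H\<^esub> a) h)
        = sweedler H (\<lambda>a b. antipode H (antipode_inv H b \<otimes>\<^bsub>H\<^esub> a)) h"
      by (rule linear_sweedler[OF h module_H module_H antipode_linear]) (assumption | rule rules)+
    also have "\<dots> = sweedler H (\<lambda>a b. antipode H a \<otimes>\<^bsub>H\<^esub> b) h"
      by (rule sweedler_cong[OF h module_H], (assumption | rule rules)+) (simp add: antipode_mult T)
    also have "\<dots> = antipode H (counit H h \<odot>\<^bsub>H\<^esub> \<one>\<^bsub>H\<^esub>)"
      unfolding e by (rule sweedler_antipode_left[OF h])
    finally show "antipode H (sweedler H (\<lambda>a b. antipode_inv H b \<otimes>\<^bsub>H\<^esub> a) h)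
        = antipode H (counit H h \<odot>\<^bsub>H\<^esub> \<one>\<^bsub>H\<^esub>)" .
  qed (assumption | rule rules)+
  show "sweedler H (\<lambda>a b. b \<otimes>\<^bsub>H\<^esub> antipode_inv H a) h = counit H h \<odot>\<^bsub>H\<^esub> \<one>\<^bsub>H\<^esub>"
  proof (rule inj)
    have "antipode H (sweedler H (\<lambda>a b. b \<otimes>\<^bsub>H\<^esub> antipode_inv H a) h)
        = sweedler H (\<lambda>a b. antipode H (b \<otimes>\<^bsub>H\<^esub> antipode_inv H a)) h"
      by (rule linear_sweedler[OF h module_H module_H antipode_linear]) (assumption | rule rules)+
    also have "\<dots> = sweedler H (\<lambda>a b. a \<otimes>\<^bsub>H\<^esub> antipode H b) h"
      by (rule sweedler_cong[OF h module_H], (assumption | rule rules)+) (simp add: antipode_mult T)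
    also have "\<dots> = antipode H (counit H h \<odot>\<^bsub>H\<^esub> \<one>\<^bsub>H\<^esub>)"
      unfolding e by (rule sweedler_antipode_right[OF h])
    finally show "antipode H (sweedler H (\<lambda>a b. b \<otimes>\<^bsub>H\<^esub> antipode_inv H a) h)
        = antipode H (counit H h \<odot>\<^bsub>H\<^esub> \<one>\<^bsub>H\<^esub>)" .
  qed (assumption | rule rules)+
qed

end

section \<open>The Heisenberg algebra\<close>

context finite_dimensional_hopf_algebra
begin

abbreviation dual_sweedler :: "('k, 'c, 'p) module_scheme \<Rightarrow> (('h \<Rightarrow> 'k) \<Rightarrow> ('h \<Rightarrow> 'k) \<Rightarrow> 'c) \<Rightarrow> ('h \<Rightarrow> 'k) \<Rightarrow> 'c"
  where "dual_sweedler P f \<theta> \<equiv> tensor_lift K P f (comult D \<theta>)"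

lemmas dual_intros = module_D dual_comult(1) pairing_closed pairing_linear linear_compose[OF dual_comult_linear]
  sweedler_intros

lemma dual_mult_bil:
  assumes "\<theta> \<in> carrier D" "\<eta> \<in> carrier D"
  shows "(\<lambda>a b. pairing a \<theta> \<otimes>\<^bsub>K\<^esub> pairing b \<eta>) \<in> bilinear_maps K H H KK"
  by (assumption | rule assms dual_intros)+

lemma dual_mult:
  "h \<in> carrier H \<Longrightarrow> pairing h (\<theta> \<otimes>\<^bsub>D\<^esub> \<eta>) = sweedler KK (\<lambda>a b. pairing a \<theta> \<otimes>\<^bsub>K\<^esub> pairing b \<eta>) h"
  by (simp add: dual_hopf_simps dual_algebra_def pairing_def)

lemma dual_mult_closed:
  assumes "\<theta> \<in> carrier D" "\<eta> \<in> carrier D"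
  shows "\<theta> \<otimes>\<^bsub>D\<^esub> \<eta> \<in> carrier D"
proof -
  have "(\<lambda>h. sweedler KK (\<lambda>a b. pairing a \<theta> \<otimes>\<^bsub>K\<^esub> pairing b \<eta>) h) \<in> linear_maps K H KK"
    by (assumption | rule assms dual_intros)+
  from dual_restrict[OF this] show ?thesis
    by (simp add: dual_hopf_simps dual_algebra_def pairing_def)
qed

lemma dual_mult_bilinear: "monoid.mult D \<in> bilinear_maps K D D D"
proof -
  interpret D: module K D by (rule module_D)
  have left: "(\<lambda>\<theta>. sweedler KK (\<lambda>a b. pairing a \<theta> \<otimes>\<^bsub>K\<^esub> pairing b \<eta>) h) \<in> linear_maps K D KK"
    and right: "(\<lambda>\<theta>. sweedler KK (\<lambda>a b. pairing a \<eta> \<otimes>\<^bsub>K\<^esub> pairing b \<theta>) h) \<in> linear_maps K D KK"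
    if "\<eta> \<in> carrier D" "h \<in> carrier H" for \<eta> h
    by (assumption | rule that dual_intros)+
  have "(\<lambda>\<theta> \<eta>. \<theta> \<otimes>\<^bsub>D\<^esub> \<eta>) \<in> bilinear_maps K D D D"
    by (rule bilinear_mapsI; rule linear_mapsI; (intro dual_eqI)?)
       (simp_all add: dual_mult_closed dual_mult dual_ops linear_maps_add[OF left] linear_maps_smult[OF left]
         linear_maps_add[OF right] linear_maps_smult[OF right] base_module_simps)
  then show ?thesis .
qed

lemma dual_one_closed: "\<one>\<^bsub>D\<^esub> \<in> carrier D"
  using dual_restrict[OF counit_linear] by (simp add: dual_hopf_simps dual_algebra_def)

lemma dual_l_one:
  assumes "\<theta> \<in> carrier D" shows "\<one>\<^bsub>D\<^esub> \<otimes>\<^bsub>D\<^esub> \<theta> = \<theta>"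
proof (rule dual_eqI[OF dual_mult_closed[OF dual_one_closed assms] assms])
  fix h assume h: "h \<in> carrier H"
  have "pairing h (\<one>\<^bsub>D\<^esub> \<otimes>\<^bsub>D\<^esub> \<theta>) = sweedler KK (\<lambda>a b. counit H a \<odot>\<^bsub>KK\<^esub> pairing b \<theta>) h"
    unfolding dual_mult[OF h]
    by (rule sweedler_cong[OF h module_K dual_mult_bil[OF dual_one_closed assms]])
       (simp add: pairing_one base_module_simps)
  also have "\<dots> = pairing h \<theta>"
    by (rule sweedler_counit_left[OF h module_K pairing_linear_left[OF assms]])
  finally show "pairing h (\<one>\<^bsub>D\<^esub> \<otimes>\<^bsub>D\<^esub> \<theta>) = pairing h \<theta>" .
qed

lemma dual_r_one:
  assumes "\<theta> \<in> carrier D" shows "\<theta> \<otimes>\<^bsub>D\<^esub> \<one>\<^bsub>D\<^esub> = \<theta>"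
proof (rule dual_eqI[OF dual_mult_closed[OF assms dual_one_closed] assms])
  fix h assume h: "h \<in> carrier H"
  have "pairing h (\<theta> \<otimes>\<^bsub>D\<^esub> \<one>\<^bsub>D\<^esub>) = sweedler KK (\<lambda>a b. counit H b \<odot>\<^bsub>KK\<^esub> pairing a \<theta>) h"
    unfolding dual_mult[OF h]
    by (rule sweedler_cong[OF h module_K dual_mult_bil[OF assms dual_one_closed]])
       (simp add: pairing_one base_module_simps K_simps counit_closed pairing_closed assms)
  also have "\<dots> = pairing h \<theta>"
    by (rule sweedler_counit_right[OF h module_K pairing_linear_left[OF assms]])
  finally show "pairing h (\<theta> \<otimes>\<^bsub>D\<^esub> \<one>\<^bsub>D\<^esub>) = pairing h \<theta>" .
qed

text \<open>Evaluated on pairs, this says that the counit of \<open>H\<close> is multiplicative.\<close>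

lemma dual_comult_one: "comult D \<one>\<^bsub>D\<^esub> = pure_tensor K D D \<one>\<^bsub>D\<^esub> \<one>\<^bsub>D\<^esub>"
  by (rule dual_tensor_eqI)
     (simp_all add: dual_comult dual_one_closed pure_tensor_closed[OF module_D module_D] pairing_one
       tensor_lift_pure[OF module_D module_D module_K pair2_bilinear] H_mult_closed counit_mult)

abbreviation "V \<equiv> tensor K D H"
abbreviation "E \<equiv> heisenberg K H"

lemma heisenberg_simps:
  "carrier E = carrier V" "\<zero>\<^bsub>E\<^esub> = \<zero>\<^bsub>V\<^esub>" "s \<oplus>\<^bsub>E\<^esub> t = s \<oplus>\<^bsub>V\<^esub> t" "k \<odot>\<^bsub>E\<^esub> t = k \<odot>\<^bsub>V\<^esub> t"
  by (simp_all add: heisenberg_def Let_def)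

lemma heisenberg_mult:
  "s \<otimes>\<^bsub>E\<^esub> t = tensor_lift K V (\<lambda>\<theta> h. tensor_lift K V (\<lambda>\<theta>' h'.
     dual_sweedler V (\<lambda>\<theta>1 \<theta>2. sweedler V (\<lambda>h1 h2.
       pairing h1 \<theta>2 \<odot>\<^bsub>V\<^esub> pure_tensor K D H (\<theta> \<otimes>\<^bsub>D\<^esub> \<theta>1) (h2 \<otimes>\<^bsub>H\<^esub> h')) h) \<theta>') t) s"
  by (simp add: heisenberg_def Let_def)

lemma linear_maps_heisenberg:
  "linear_maps K E P = linear_maps K V P" "linear_maps K P E = linear_maps K P V"
  by (simp_all add: linear_maps_def heisenberg_simps)

lemma module_V: "module K V"
  by (intro module_tensor module_D module_H)

lemma module_E: "module K E"
proof -
  interpret V: module K V by (rule module_V)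
  show ?thesis
  proof (rule moduleI[OF cring_K abelian_groupI])
    fix t assume "t \<in> carrier E"
    then show "\<exists>s\<in>carrier E. s \<oplus>\<^bsub>E\<^esub> t = \<zero>\<^bsub>E\<^esub>"
      unfolding heisenberg_simps by (rule abelian_groupE(6)[OF V.abelian_group_axioms])
  qed (auto simp: heisenberg_simps V.a_ac V.smult_l_distr V.smult_r_distr V.smult_assoc1)
qed

lemmas heisenberg_intros = module_V module_E dual_one_closed dual_mult_closed
  bilinear_compose_left[OF dual_mult_bilinear] bilinear_compose_right[OF dual_mult_bilinear] dual_intros

lemma heisenberg_mult_bilinear: "monoid.mult E \<in> bilinear_maps K E E E"
proof -
  have "(\<lambda>s t. s \<otimes>\<^bsub>E\<^esub> t) \<in> bilinear_maps K V V V"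
    unfolding heisenberg_mult by (assumption | rule heisenberg_intros)+
  then show ?thesis
    by (simp add: bilinear_maps_def linear_maps_heisenberg heisenberg_simps)
qed

lemma heisenberg_mult_pure:
  assumes "\<theta> \<in> carrier D" "h \<in> carrier H" "\<theta>' \<in> carrier D" "h' \<in> carrier H"
  shows "pure_tensor K D H \<theta> h \<otimes>\<^bsub>E\<^esub> pure_tensor K D H \<theta>' h' =
     dual_sweedler V (\<lambda>\<theta>1 \<theta>2. sweedler V (\<lambda>h1 h2.
       pairing h1 \<theta>2 \<odot>\<^bsub>V\<^esub> pure_tensor K D H (\<theta> \<otimes>\<^bsub>D\<^esub> \<theta>1) (h2 \<otimes>\<^bsub>H\<^esub> h')) h) \<theta>'"
proof -
  note rules = assms heisenberg_intros
  have "(\<lambda>\<theta> h. tensor_lift K V (\<lambda>\<theta>' h'. dual_sweedler V (\<lambda>\<theta>1 \<theta>2. sweedler V (\<lambda>h1 h2.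
       pairing h1 \<theta>2 \<odot>\<^bsub>V\<^esub> pure_tensor K D H (\<theta> \<otimes>\<^bsub>D\<^esub> \<theta>1) (h2 \<otimes>\<^bsub>H\<^esub> h')) h) \<theta>') (pure_tensor K D H \<theta>' h'))
     \<in> bilinear_maps K D H V"
    by (assumption | rule rules)+
  moreover have "(\<lambda>\<theta>' h'. dual_sweedler V (\<lambda>\<theta>1 \<theta>2. sweedler V (\<lambda>h1 h2.
       pairing h1 \<theta>2 \<odot>\<^bsub>V\<^esub> pure_tensor K D H (\<theta> \<otimes>\<^bsub>D\<^esub> \<theta>1) (h2 \<otimes>\<^bsub>H\<^esub> h')) h) \<theta>') \<in> bilinear_maps K D H V"
    by (assumption | rule rules)+
  ultimately show ?thesis
    unfolding heisenberg_mult using assms by (simp add: tensor_lift_pure[OF module_D module_H module_V])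
qed

lemma heisenberg_mult_dual_left:
  assumes \<theta>: "\<theta> \<in> carrier D" and h: "h \<in> carrier H"
  shows "pure_tensor K D H \<theta> \<one>\<^bsub>H\<^esub> \<otimes>\<^bsub>E\<^esub> pure_tensor K D H \<one>\<^bsub>D\<^esub> h = pure_tensor K D H \<theta> h"
proof -
  interpret V: module K V by (rule module_V)
  let ?f = "\<lambda>\<theta>1 \<theta>2 h1 h2. pairing h1 \<theta>2 \<odot>\<^bsub>V\<^esub> pure_tensor K D H (\<theta> \<otimes>\<^bsub>D\<^esub> \<theta>1) (h2 \<otimes>\<^bsub>H\<^esub> h)"
  note rules = assms heisenberg_intros
  have 1: "(\<lambda>\<theta>1 \<theta>2. sweedler V (?f \<theta>1 \<theta>2) \<one>\<^bsub>H\<^esub>) \<in> bilinear_maps K D D V"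
    by (assumption | rule rules)+
  have 2: "?f \<one>\<^bsub>D\<^esub> \<one>\<^bsub>D\<^esub> \<in> bilinear_maps K H H V"
    by (assumption | rule rules)+
  show ?thesis
    using \<theta> h tensor_lift_pure[OF module_D module_D module_V 1 dual_one_closed dual_one_closed]
      tensor_lift_pure[OF module_H module_H module_V 2 H_one_closed H_one_closed]
    by (simp add: heisenberg_mult_pure dual_one_closed H_one_closed dual_comult_one comult_one pairing_one
        counit_one dual_r_one pure_tensor_closed[OF module_D module_H])
qed

lemma heisenberg_mult_dual_right:
  assumes \<theta>: "\<theta> \<in> carrier D" and h: "h \<in> carrier H"
  shows "pure_tensor K D H \<one>\<^bsub>D\<^esub> h \<otimes>\<^bsub>E\<^esub> pure_tensor K D H \<theta> \<one>\<^bsub>H\<^esub> =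
     dual_sweedler V (\<lambda>\<theta>1 \<theta>2. sweedler V (\<lambda>h1 h2. pairing h1 \<theta>2 \<odot>\<^bsub>V\<^esub> pure_tensor K D H \<theta>1 h2) h) \<theta>"
proof -
  note rules = assms heisenberg_intros
  show ?thesis
    unfolding heisenberg_mult_pure[OF dual_one_closed h \<theta> H_one_closed]
  proof (rule tensor_lift_cong[OF module_D module_D module_V dual_comult(1)[OF \<theta>]])
    fix \<theta>1 \<theta>2 assume \<theta>12: "\<theta>1 \<in> carrier D" "\<theta>2 \<in> carrier D"
    show "sweedler V (\<lambda>h1 h2. pairing h1 \<theta>2 \<odot>\<^bsub>V\<^esub> pure_tensor K D H (\<one>\<^bsub>D\<^esub> \<otimes>\<^bsub>D\<^esub> \<theta>1) (h2 \<otimes>\<^bsub>H\<^esub> \<one>\<^bsub>H\<^esub>)) h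
      = sweedler V (\<lambda>h1 h2. pairing h1 \<theta>2 \<odot>\<^bsub>V\<^esub> pure_tensor K D H \<theta>1 h2) h"
      by (rule sweedler_cong[OF h module_V], (assumption | rule \<theta>12 rules)+) (simp add: dual_l_one \<theta>12)
  qed (assumption | rule rules)+
qed

end

section \<open>Coactions and the induced action\<close>

locale coaction_pair = finite_dimensional_hopf_algebra K H
  for K :: "('k, 'z) ring_scheme" and H :: "('k, 'h, 'm) hopf_scheme" +
  fixes X :: "('k, 'x, 'n) module_scheme"
    and \<alpha> :: "'x \<Rightarrow> ('k, 'x, 'h) tensor" and \<beta> :: "'x \<Rightarrow> ('k, 'h \<Rightarrow> 'k, 'x) tensor"
  assumes algebra_X: "unital_algebra K X"
    and \<alpha>: "right_coaction K H X \<alpha>"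
    and \<beta>: "left_coaction K (dual_hopf K H) X \<beta>"
begin

lemma module_X: "module K X"
  using algebra_X by (simp add: unital_algebra_def)

lemma \<alpha>_linear: "\<alpha> \<in> linear_maps K X (tensor K X H)"
  using \<alpha> by (simp add: right_coaction_def algebra_homs_def)

lemma \<beta>_linear: "\<beta> \<in> linear_maps K X (tensor K D X)"
  using \<beta> by (simp add: left_coaction_def algebra_homs_def)

abbreviation "\<alpha>_lift P f x \<equiv> tensor_lift K P f (\<alpha> x)"
abbreviation "\<beta>_lift P f y \<equiv> tensor_lift K P f (\<beta> y)"

lemmas \<alpha>_closed = linear_maps_closed[OF \<alpha>_linear]
lemmas \<beta>_closed = linear_maps_closed[OF \<beta>_linear]
lemmas X_mult_closed = bilinear_maps_closed[OF mult_bilinear[OF algebra_X]]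

lemmas coaction_intros = module_X X_mult_closed \<alpha>_closed \<beta>_closed linear_compose[OF \<alpha>_linear] linear_compose[OF \<beta>_linear]
  mult_linear_left[OF algebra_X] mult_linear_right[OF algebra_X] heisenberg_intros

lemmas \<alpha>_cong = tensor_lift_cong[OF module_X module_H _ \<alpha>_closed]
lemmas \<beta>_cong = tensor_lift_cong[OF module_D module_X _ \<beta>_closed]

text \<open>The pattern of \<open>sweedler_coassoc\<close>: a coproduct of the \<open>H\<close>-leg may be traded for a second
  coaction, and likewise for \<open>\<beta>\<close> below.\<close>

lemma \<alpha>_coassoc:
  assumes x: "x \<in> carrier X" and P: "module K P"
    and f1: "\<And>a. a \<in> carrier X \<Longrightarrow> f a \<in> bilinear_maps K H H P"
    and f2: "\<And>b c. \<lbrakk>b \<in> carrier H; c \<in> carrier H\<rbrakk> \<Longrightarrow> (\<lambda>a. f a b c) \<in> linear_maps K X P"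
  shows "\<alpha>_lift P (\<lambda>y c. \<alpha>_lift P (\<lambda>a b. f a b c) y) x = \<alpha>_lift P (\<lambda>a c. sweedler P (f a) c) x"
proof -
  have XH: "module K (tensor K X H)" and HH: "module K (tensor K H H)"
    by (intro module_tensor module_H module_X)+
  note rules = bilinear_maps_left[OF f1] bilinear_maps_right[OF f1] f1 f2 P coaction_intros
  have f3: "(\<lambda>a b. f a b c) \<in> bilinear_maps K X H P" if "c \<in> carrier H" for c
    by (assumption | rule that rules)+
  have id: "id \<in> linear_maps K M M" for M :: "('k, 'c, 'q) module_scheme"
    using linear_id by (simp add: id_def)
  let ?t = "tensor_map K (tensor K X H) H \<alpha> id (\<alpha> x)"
  have t: "?t \<in> carrier (tensor K (tensor K X H) H)"
    by (rule linear_maps_closed[OF tensor_map_linear[OF module_X module_H XH module_H \<alpha>_linear id]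
        \<alpha>_closed[OF x]])
  have s: "(\<lambda>s c. tensor_lift K P (\<lambda>a b. f a b c) s) \<in> bilinear_maps K (tensor K X H) H P"
    by (assumption | rule f3 rules)+
  have r: "(\<lambda>a s. tensor_lift K P (f a) s) \<in> bilinear_maps K X (tensor K H H) P"
    by (assumption | rule f3 rules)+
  have "\<alpha>_lift P (\<lambda>y c. \<alpha>_lift P (\<lambda>a b. f a b c) y) x
    = tensor_lift K P (\<lambda>a s. tensor_lift K P (f a) s) (tensor_assoc K X H H ?t)"
    using tensor_lift_tensor_assoc[OF t module_X module_H module_H P f1 f2]
      tensor_lift_tensor_map[OF \<alpha>_closed[OF x] module_X module_H XH module_H P \<alpha>_linear id s]
    by simp
  also have "tensor_assoc K X H H ?t = tensor_map K X (tensor K H H) id (comult H) (\<alpha> x)"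
    using \<alpha> x by (simp add: right_coaction_def)
  also have "tensor_lift K P (\<lambda>a s. tensor_lift K P (f a) s) \<dots> = \<alpha>_lift P (\<lambda>a c. sweedler P (f a) c) x"
    using tensor_lift_tensor_map[OF \<alpha>_closed[OF x] module_X module_H module_X HH P id comult_linear r]
    by simp
  finally show ?thesis .
qed

lemma \<beta>_coassoc:
  assumes y: "y \<in> carrier X" and P: "module K P"
    and f1: "\<And>\<theta>. \<theta> \<in> carrier D \<Longrightarrow> f \<theta> \<in> bilinear_maps K D X P"
    and f2: "\<And>\<eta> z. \<lbrakk>\<eta> \<in> carrier D; z \<in> carrier X\<rbrakk> \<Longrightarrow> (\<lambda>\<theta>. f \<theta> \<eta> z) \<in> linear_maps K D P"
  shows "\<beta>_lift P (\<lambda>\<theta> z. dual_sweedler P (\<lambda>\<theta>1 \<theta>2. f \<theta>1 \<theta>2 z) \<theta>) y = \<beta>_lift P (\<lambda>\<theta> z. \<beta>_lift P (f \<theta>) z) y"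
proof -
  have DX: "module K (tensor K D X)" and DD: "module K (tensor K D D)"
    by (intro module_tensor module_D module_X)+
  note rules = bilinear_maps_left[OF f1] bilinear_maps_right[OF f1] f1 f2 P coaction_intros
  have f3: "(\<lambda>a b. f a b c) \<in> bilinear_maps K D D P" if "c \<in> carrier X" for c
    by (assumption | rule that rules)+
  have id: "id \<in> linear_maps K M M" for M :: "('k, 'c, 'q) module_scheme"
    using linear_id by (simp add: id_def)
  let ?t = "tensor_map K (tensor K D D) X (comult D) id (\<beta> y)"
  have t: "?t \<in> carrier (tensor K (tensor K D D) X)"
    by (rule linear_maps_closed[OF tensor_map_linear[OF module_D module_X DD module_X dual_comult_linear id]
        \<beta>_closed[OF y]])
  have s: "(\<lambda>s c. tensor_lift K P (\<lambda>a b. f a b c) s) \<in> bilinear_maps K (tensor K D D) X P"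
    by (assumption | rule f3 rules)+
  have r: "(\<lambda>a s. tensor_lift K P (f a) s) \<in> bilinear_maps K D (tensor K D X) P"
    by (assumption | rule f3 rules)+
  have "\<beta>_lift P (\<lambda>\<theta> z. dual_sweedler P (\<lambda>\<theta>1 \<theta>2. f \<theta>1 \<theta>2 z) \<theta>) y
    = tensor_lift K P (\<lambda>a s. tensor_lift K P (f a) s) (tensor_assoc K D D X ?t)"
    using tensor_lift_tensor_assoc[OF t module_D module_D module_X P f1 f2]
      tensor_lift_tensor_map[OF \<beta>_closed[OF y] module_D module_X DD module_X P dual_comult_linear id s]
    by simp
  also have "tensor_assoc K D D X ?t = tensor_map K D (tensor K D X) id \<beta> (\<beta> y)"
    using \<beta> y by (simp add: left_coaction_def)
  also have "tensor_lift K P (\<lambda>a s. tensor_lift K P (f a) s) \<dots> = \<beta>_lift P (\<lambda>\<theta> z. \<beta>_lift P (f \<theta>) z) y"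
    using tensor_lift_tensor_map[OF \<beta>_closed[OF y] module_D module_X module_D DX P id \<beta>_linear r]
    by simp
  finally show ?thesis .
qed

lemma \<alpha>_counit:
  assumes x: "x \<in> carrier X" and P: "module K P" and f: "f \<in> linear_maps K X P"
  shows "\<alpha>_lift P (\<lambda>y h. counit H h \<odot>\<^bsub>P\<^esub> f y) x = f x"
proof -
  have bil: "(\<lambda>y h. counit H h \<odot>\<^bsub>X\<^esub> y) \<in> bilinear_maps K X H X"
    by (assumption | rule coaction_intros)+
  have "f x = \<alpha>_lift P (\<lambda>y h. f (counit H h \<odot>\<^bsub>X\<^esub> y)) x"
    using linear_tensor_lift[OF \<alpha>_closed[OF x] module_X module_H module_X P f bil] \<alpha> x
    by (simp add: right_coaction_def)
  also have "\<dots> = \<alpha>_lift P (\<lambda>y h. counit H h \<odot>\<^bsub>P\<^esub> f y) x"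
    by (rule \<alpha>_cong[OF P x], (assumption | rule linear_compose[OF f] P coaction_intros)+)
       (simp add: linear_maps_smult[OF f] counit_closed)
  finally show ?thesis ..
qed

lemma \<beta>_counit:
  assumes y: "y \<in> carrier X" and P: "module K P" and f: "f \<in> linear_maps K X P"
  shows "\<beta>_lift P (\<lambda>\<theta> z. pairing \<one>\<^bsub>H\<^esub> \<theta> \<odot>\<^bsub>P\<^esub> f z) y = f y"
proof -
  have bil: "(\<lambda>\<theta> z. pairing \<one>\<^bsub>H\<^esub> \<theta> \<odot>\<^bsub>X\<^esub> z) \<in> bilinear_maps K D X X"
    by (assumption | rule coaction_intros)+
  have "f y = \<beta>_lift P (\<lambda>\<theta> z. f (pairing \<one>\<^bsub>H\<^esub> \<theta> \<odot>\<^bsub>X\<^esub> z)) y"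
    using linear_tensor_lift[OF \<beta>_closed[OF y] module_D module_X module_X P f bil] \<beta> y
    by (simp add: left_coaction_def dual_hopf_simps)
  also have "\<dots> = \<beta>_lift P (\<lambda>\<theta> z. pairing \<one>\<^bsub>H\<^esub> \<theta> \<odot>\<^bsub>P\<^esub> f z) y"
    by (rule \<beta>_cong[OF P y], (assumption | rule linear_compose[OF f] P coaction_intros)+)
       (simp add: linear_maps_smult[OF f] pairing_closed H_one_closed)
  finally show ?thesis ..
qed

abbreviation "act \<equiv> coaction_action K X \<beta>"

lemma act_bilinear: "act \<in> bilinear_maps K X H X"
proof -
  have "(\<lambda>y h. act y h) \<in> bilinear_maps K X H X"
    unfolding coaction_action_def by (assumption | rule coaction_intros)+
  then show ?thesis .
qed

lemma act_one: "y \<in> carrier X \<Longrightarrow> act y \<one>\<^bsub>H\<^esub> = y"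
  unfolding coaction_action_def by (rule \<beta>_counit[OF _ module_X linear_id])

lemmas act_intros = bilinear_maps_closed[OF act_bilinear] bilinear_compose_left[OF act_bilinear]
  bilinear_compose_right[OF act_bilinear] coaction_intros

text \<open>Acting twice pairs \<open>h\<close> and \<open>k\<close> with the two dual legs of the iterated coaction. By
  coassociativity these legs are a coproduct, and the coproduct of the dual is transposed to the
  product of \<open>H\<close>.\<close>

lemma act_act:
  assumes y: "y \<in> carrier X" and h: "h \<in> carrier H" and k: "k \<in> carrier H"
  shows "act (act y h) k = act y (h \<otimes>\<^bsub>H\<^esub> k)"
proof -
  interpret X: module K X by (rule module_X)
  note rules = y h k act_intros
  let ?f = "\<lambda>\<theta> \<eta> z. pairing h \<theta> \<odot>\<^bsub>X\<^esub> (pairing k \<eta> \<odot>\<^bsub>X\<^esub> z)"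
  have "act (act y h) k = \<beta>_lift X (\<lambda>\<theta> z. act (pairing h \<theta> \<odot>\<^bsub>X\<^esub> z) k) y"
    unfolding coaction_action_def[of K X \<beta> y h]
    by (rule linear_tensor_lift[OF \<beta>_closed[OF y] module_D module_X module_X module_X, where g = "\<lambda>w. act w k"])
       (assumption | rule rules)+
  also have "\<dots> = \<beta>_lift X (\<lambda>\<theta> z. \<beta>_lift X (?f \<theta>) z) y"
  proof (rule \<beta>_cong[OF module_X y])
    fix \<theta> z assume \<theta>: "\<theta> \<in> carrier D" and z: "z \<in> carrier X"
    have "act (pairing h \<theta> \<odot>\<^bsub>X\<^esub> z) k = pairing h \<theta> \<odot>\<^bsub>X\<^esub> act z k"
      by (rule linear_maps_smult[OF bilinear_maps_left[OF act_bilinear k] pairing_closed[OF h \<theta>] z])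
    also have "\<dots> = \<beta>_lift X (?f \<theta>) z"
      unfolding coaction_action_def
      by (rule linear_tensor_lift[OF \<beta>_closed[OF z] module_D module_X module_X module_X,
            where g = "\<lambda>w. pairing h \<theta> \<odot>\<^bsub>X\<^esub> w"])
         (assumption | rule \<theta> z rules)+
    finally show "act (pairing h \<theta> \<odot>\<^bsub>X\<^esub> z) k = \<beta>_lift X (?f \<theta>) z" .
  qed (assumption | rule rules)+
  also have "\<dots> = \<beta>_lift X (\<lambda>\<theta> z. dual_sweedler X (\<lambda>\<theta>1 \<theta>2. ?f \<theta>1 \<theta>2 z) \<theta>) y"
    by (rule \<beta>_coassoc[symmetric, OF y module_X]) (assumption | rule rules)+
  also have "\<dots> = act y (h \<otimes>\<^bsub>H\<^esub> k)"
    unfolding coaction_action_def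
  proof (rule \<beta>_cong[OF module_X y])
    fix \<theta> z assume \<theta>: "\<theta> \<in> carrier D" and z: "z \<in> carrier X"
    have "dual_sweedler X (\<lambda>\<theta>1 \<theta>2. ?f \<theta>1 \<theta>2 z) \<theta>
        = dual_sweedler X (\<lambda>\<theta>1 \<theta>2. (pairing h \<theta>1 \<otimes>\<^bsub>K\<^esub> pairing k \<theta>2) \<odot>\<^bsub>X\<^esub> z) \<theta>"
      by (rule tensor_lift_cong[OF module_D module_D module_X dual_comult(1)[OF \<theta>]],
          (assumption | rule \<theta> z rules)+)
         (simp add: X.smult_assoc1 pairing_closed h k z)
    also have "\<dots> = pair2 h k (comult D \<theta>) \<odot>\<^bsub>X\<^esub> z"
      by (rule linear_tensor_lift[symmetric, OF dual_comult(1)[OF \<theta>] module_D module_D module_K module_X,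
            where g = "\<lambda>c. c \<odot>\<^bsub>X\<^esub> z"])
         (assumption | rule \<theta> z rules)+
    finally show "dual_sweedler X (\<lambda>\<theta>1 \<theta>2. ?f \<theta>1 \<theta>2 z) \<theta> = pairing (h \<otimes>\<^bsub>H\<^esub> k) \<theta> \<odot>\<^bsub>X\<^esub> z"
      by (simp add: dual_comult \<theta> h k)
  qed (assumption | rule rules)+
  finally show ?thesis .
qed

section \<open>Braided commutativity without the inverse antipode\<close>

definition braided_mult :: "'x \<Rightarrow> 'x \<Rightarrow> 'x"
  where "braided_mult x y = \<alpha>_lift X (\<lambda>x0 x1. x0 \<otimes>\<^bsub>X\<^esub> act y x1) x"

lemma braided_mult_bilinear: "braided_mult \<in> bilinear_maps K X X X"
proof -
  have "(\<lambda>x y. braided_mult x y) \<in> bilinear_maps K X X X"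
    unfolding braided_mult_def by (assumption | rule act_intros)+
  then show ?thesis .
qed

lemma act_counit:
  assumes "y \<in> carrier X" "h \<in> carrier H"
  shows "act y (counit H h \<odot>\<^bsub>H\<^esub> \<one>\<^bsub>H\<^esub>) = counit H h \<odot>\<^bsub>X\<^esub> y"
  using linear_maps_smult[OF bilinear_maps_right[OF act_bilinear]] assms
  by (simp add: counit_closed H_one_closed act_one)

text \<open>Facts \<open>A\<close> and \<open>B\<close> below evaluate \<open>braided_mult\<close>, respectively the right-hand side of braided
  commutativity, at \<open>x\<^sub>0\<close> and at \<open>y\<close> acted upon by \<open>S\<^sup>-\<^sup>1(x\<^sub>1)\<close>, respectively \<open>x\<^sub>1\<close>. In both cases the
  two actions on \<open>y\<close> cancel and a plain product is left. Rewriting the left-hand side of \<open>A\<close> by the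
  identity for \<open>braided_mult\<close>, or that of \<open>B\<close> by braided commutativity, therefore gives the other
  condition.\<close>

lemma braided_commutative_iff:
  assumes bij: "bij_betw (antipode H) (carrier H) (carrier H)"
  shows "braided_commutative K H X act \<alpha>
    \<longleftrightarrow> (\<forall>x\<in>carrier X. \<forall>y\<in>carrier X. braided_mult x y = y \<otimes>\<^bsub>X\<^esub> x)"
proof -
  interpret X: unital_algebra K X by (rule algebra_X)
  note T = antipode_inv_props[OF bij]
  note rules = T(1) linear_compose[OF antipode_inv_linear[OF bij]]
    bilinear_maps_closed[OF braided_mult_bilinear] bilinear_compose_left[OF braided_mult_bilinear]
    bilinear_compose_right[OF braided_mult_bilinear] act_intros
  let ?G = "\<lambda>x y. \<alpha>_lift X (\<lambda>x0 x1. act y (antipode_inv H x1) \<otimes>\<^bsub>X\<^esub> x0) x"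
  have A: "\<alpha>_lift X (\<lambda>x0 h. braided_mult x0 (act y (antipode_inv H h))) x = x \<otimes>\<^bsub>X\<^esub> y"
    if x: "x \<in> carrier X" and y: "y \<in> carrier X" for x y
  proof -
    let ?f = "\<lambda>x0 h1 h2. x0 \<otimes>\<^bsub>X\<^esub> act y (antipode_inv H h2 \<otimes>\<^bsub>H\<^esub> h1)"
    have "\<alpha>_lift X (\<lambda>x0 h. braided_mult x0 (act y (antipode_inv H h))) x
        = \<alpha>_lift X (\<lambda>x0 h. \<alpha>_lift X (\<lambda>a b. ?f a b h) x0) x"
    proof (rule \<alpha>_cong[OF module_X x])
      fix x0 h assume xh: "x0 \<in> carrier X" "h \<in> carrier H"
      show "braided_mult x0 (act y (antipode_inv H h)) = \<alpha>_lift X (\<lambda>a b. ?f a b h) x0"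
        unfolding braided_mult_def
        by (rule \<alpha>_cong[OF module_X xh(1)], (assumption | rule x y xh rules)+) (simp add: act_act y xh T)
    qed (assumption | rule x y rules)+
    also have "\<dots> = \<alpha>_lift X (\<lambda>x0 h. sweedler X (?f x0) h) x"
      by (rule \<alpha>_coassoc[OF x module_X]) (assumption | rule x y rules)+
    also have "\<dots> = \<alpha>_lift X (\<lambda>x0 h. counit H h \<odot>\<^bsub>X\<^esub> (x0 \<otimes>\<^bsub>X\<^esub> y)) x"
    proof (rule \<alpha>_cong[OF module_X x])
      fix x0 h assume xh: "x0 \<in> carrier X" "h \<in> carrier H"
      have "sweedler X (?f x0) h = x0 \<otimes>\<^bsub>X\<^esub> act y (sweedler H (\<lambda>h1 h2. antipode_inv H h2 \<otimes>\<^bsub>H\<^esub> h1) h)"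
        by (rule linear_sweedler[symmetric, OF xh(2) module_H module_X, where g = "\<lambda>w. x0 \<otimes>\<^bsub>X\<^esub> act y w"])
           (assumption | rule x y xh rules)+
      also have "\<dots> = counit H h \<odot>\<^bsub>X\<^esub> (x0 \<otimes>\<^bsub>X\<^esub> y)"
        using xh y by (simp add: antipode_inv_sweedler[OF bij] act_counit X.smult_mult_right counit_closed)
      finally show "sweedler X (?f x0) h = counit H h \<odot>\<^bsub>X\<^esub> (x0 \<otimes>\<^bsub>X\<^esub> y)" .
    qed (assumption | rule x y rules)+
    also have "\<dots> = x \<otimes>\<^bsub>X\<^esub> y"
      by (rule \<alpha>_counit[OF x module_X]) (assumption | rule x y rules)+
    finally show ?thesis .
  qed
  have B: "\<alpha>_lift X (\<lambda>x0 h. ?G x0 (act y h)) x = y \<otimes>\<^bsub>X\<^esub> x"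
    if x: "x \<in> carrier X" and y: "y \<in> carrier X" for x y
  proof -
    let ?f = "\<lambda>x0 h1 h2. act y (h2 \<otimes>\<^bsub>H\<^esub> antipode_inv H h1) \<otimes>\<^bsub>X\<^esub> x0"
    have "\<alpha>_lift X (\<lambda>x0 h. ?G x0 (act y h)) x = \<alpha>_lift X (\<lambda>x0 h. \<alpha>_lift X (\<lambda>a b. ?f a b h) x0) x"
    proof (rule \<alpha>_cong[OF module_X x])
      fix x0 h assume xh: "x0 \<in> carrier X" "h \<in> carrier H"
      show "?G x0 (act y h) = \<alpha>_lift X (\<lambda>a b. ?f a b h) x0"
        by (rule \<alpha>_cong[OF module_X xh(1)], (assumption | rule x y xh rules)+) (simp add: act_act y xh T)
    qed (assumption | rule x y rules)+
    also have "\<dots> = \<alpha>_lift X (\<lambda>x0 h. sweedler X (?f x0) h) x"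
      by (rule \<alpha>_coassoc[OF x module_X]) (assumption | rule x y rules)+
    also have "\<dots> = \<alpha>_lift X (\<lambda>x0 h. counit H h \<odot>\<^bsub>X\<^esub> (y \<otimes>\<^bsub>X\<^esub> x0)) x"
    proof (rule \<alpha>_cong[OF module_X x])
      fix x0 h assume xh: "x0 \<in> carrier X" "h \<in> carrier H"
      have "sweedler X (?f x0) h = act y (sweedler H (\<lambda>h1 h2. h2 \<otimes>\<^bsub>H\<^esub> antipode_inv H h1) h) \<otimes>\<^bsub>X\<^esub> x0"
        by (rule linear_sweedler[symmetric, OF xh(2) module_H module_X, where g = "\<lambda>w. act y w \<otimes>\<^bsub>X\<^esub> x0"])
           (assumption | rule x y xh rules)+
      also have "\<dots> = counit H h \<odot>\<^bsub>X\<^esub> (y \<otimes>\<^bsub>X\<^esub> x0)"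
        using xh y by (simp add: antipode_inv_sweedler[OF bij] act_counit X.smult_mult_left counit_closed)
      finally show "sweedler X (?f x0) h = counit H h \<odot>\<^bsub>X\<^esub> (y \<otimes>\<^bsub>X\<^esub> x0)" .
    qed (assumption | rule x y rules)+
    also have "\<dots> = y \<otimes>\<^bsub>X\<^esub> x"
      by (rule \<alpha>_counit[OF x module_X]) (assumption | rule x y rules)+
    finally show ?thesis .
  qed
  show ?thesis
  proof
    assume bc: "braided_commutative K H X act \<alpha>"
    show "\<forall>x\<in>carrier X. \<forall>y\<in>carrier X. braided_mult x y = y \<otimes>\<^bsub>X\<^esub> x"
    proof (intro ballI)
      fix x y assume x: "x \<in> carrier X" and y: "y \<in> carrier X"
      have "braided_mult x y = \<alpha>_lift X (\<lambda>x0 h. ?G x0 (act y h)) x"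
        unfolding braided_mult_def
      proof (rule \<alpha>_cong[OF module_X x])
        fix x0 h assume "x0 \<in> carrier X" "h \<in> carrier H"
        then show "x0 \<otimes>\<^bsub>X\<^esub> act y h = ?G x0 (act y h)"
          using bc bilinear_maps_closed[OF act_bilinear y] by (simp add: braided_commutative_def)
      qed (assumption | rule x y rules)+
      then show "braided_mult x y = y \<otimes>\<^bsub>X\<^esub> x"
        using B[OF x y] by simp
    qed
  next
    assume bm: "\<forall>x\<in>carrier X. \<forall>y\<in>carrier X. braided_mult x y = y \<otimes>\<^bsub>X\<^esub> x"
    show "braided_commutative K H X act \<alpha>"
      unfolding braided_commutative_def
    proof (intro ballI)
      fix x y assume x: "x \<in> carrier X" and y: "y \<in> carrier X"
      have "?G x y = \<alpha>_lift X (\<lambda>x0 h. braided_mult x0 (act y (antipode_inv H h))) x"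
      proof (rule \<alpha>_cong[OF module_X x])
        fix x0 h assume "x0 \<in> carrier X" "h \<in> carrier H"
        then show "act y (antipode_inv H h) \<otimes>\<^bsub>X\<^esub> x0 = braided_mult x0 (act y (antipode_inv H h))"
          using bm bilinear_maps_closed[OF act_bilinear y] T(1) by simp
      qed (assumption | rule x y rules)+
      then show "x \<otimes>\<^bsub>X\<^esub> y = ?G x y"
        using A[OF x y] by simp
    qed
  qed
qed

section \<open>The Heisenberg form of braided commutativity\<close>

abbreviation "Z \<equiv> tensor K X E"

definition triple :: "'x \<Rightarrow> ('h \<Rightarrow> 'k) \<Rightarrow> 'h \<Rightarrow> ('k, 'x, ('k, 'h \<Rightarrow> 'k, 'h) tensor) tensor"
  where "triple x \<theta> h = pure_tensor K X E x (pure_tensor K D H \<theta> h)"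

lemma module_Z: "module K Z"
  by (intro module_tensor module_X module_E)

lemma pure_E_closed: "\<lbrakk>\<theta> \<in> carrier D; h \<in> carrier H\<rbrakk> \<Longrightarrow> pure_tensor K D H \<theta> h \<in> carrier E"
  by (simp add: heisenberg_simps pure_tensor_closed[OF module_D module_H])

lemmas pure_E_linear =
  pure_tensor_linear_left[OF module_D module_H, folded linear_maps_heisenberg]
  pure_tensor_linear_right[OF module_D module_H, folded linear_maps_heisenberg]

lemma triple_linear:
  "\<lbrakk>g \<in> linear_maps K Q X; \<theta> \<in> carrier D; h \<in> carrier H\<rbrakk> \<Longrightarrow> (\<lambda>q. triple (g q) \<theta> h) \<in> linear_maps K Q Z"
  "\<lbrakk>g' \<in> linear_maps K Q D; x \<in> carrier X; h \<in> carrier H\<rbrakk> \<Longrightarrow> (\<lambda>q. triple x (g' q) h) \<in> linear_maps K Q Z"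
  "\<lbrakk>g'' \<in> linear_maps K Q H; x \<in> carrier X; \<theta> \<in> carrier D\<rbrakk> \<Longrightarrow> (\<lambda>q. triple x \<theta> (g'' q)) \<in> linear_maps K Q Z"
  unfolding triple_def
  by (assumption | rule module_X module_E pure_tensor_linear_left pure_tensor_linear_right pure_E_closed pure_E_linear)+

lemma triple_closed: "\<lbrakk>x \<in> carrier X; \<theta> \<in> carrier D; h \<in> carrier H\<rbrakk> \<Longrightarrow> triple x \<theta> h \<in> carrier Z"
  unfolding triple_def by (intro pure_tensor_closed module_X module_E pure_E_closed)

lemmas triple_intros = module_Z triple_linear triple_closed
  bilinear_maps_closed[OF braided_mult_bilinear] bilinear_compose_left[OF braided_mult_bilinear]
    bilinear_compose_right[OF braided_mult_bilinear] act_intros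

text \<open>In Sweedler notation this is \<open>B(x\<^sub>0, y\<^sub>0) \<otimes> \<theta> # x\<^sub>1\<close>, the common shape of the two sides of the
  Heisenberg condition.\<close>

definition spread :: "('x \<Rightarrow> 'x \<Rightarrow> 'x) \<Rightarrow> 'x \<Rightarrow> 'x \<Rightarrow> ('k, 'x, ('k, 'h \<Rightarrow> 'k, 'h) tensor) tensor"
  where "spread B x y = \<alpha>_lift Z (\<lambda>x0 x1. \<beta>_lift Z (\<lambda>\<theta> y0. triple (B x0 y0) \<theta> x1) y) x"

lemma spread_cong:
  assumes "B \<in> bilinear_maps K X X X" "x \<in> carrier X" "y \<in> carrier X"
    and "\<And>x y. \<lbrakk>x \<in> carrier X; y \<in> carrier X\<rbrakk> \<Longrightarrow> B x y = B' x y"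
  shows "spread B x y = spread B' x y"
proof -
  note rules = bilinear_compose_left[OF assms(1)] bilinear_compose_right[OF assms(1)]
    bilinear_maps_closed[OF assms(1)] assms(2,3) triple_intros
  show ?thesis
    unfolding spread_def
  proof (rule \<alpha>_cong[OF module_Z assms(2)])
    fix x0 x1 assume x01: "x0 \<in> carrier X" "x1 \<in> carrier H"
    show "\<beta>_lift Z (\<lambda>\<theta> y0. triple (B x0 y0) \<theta> x1) y = \<beta>_lift Z (\<lambda>\<theta> y0. triple (B' x0 y0) \<theta> x1) y"
      by (rule \<beta>_cong[OF module_Z assms(3)], (assumption | rule x01 rules)+) (simp add: assms(4) x01)
  qed (assumption | rule rules)+
qed

text \<open>The counits of the dual, \<open>\<theta> \<mapsto> \<theta>(1)\<close>, and of \<open>H\<close>, applied to the last two legs.\<close>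

definition contract :: "('k, 'x, ('k, 'h \<Rightarrow> 'k, 'h) tensor) tensor \<Rightarrow> 'x"
  where "contract = tensor_lift K X (\<lambda>x. tensor_lift K X (\<lambda>\<theta> h. counit H h \<odot>\<^bsub>X\<^esub> (pairing \<one>\<^bsub>H\<^esub> \<theta> \<odot>\<^bsub>X\<^esub> x)))"

lemma contract_bilinear:
  "(\<lambda>x. tensor_lift K X (\<lambda>\<theta> h. counit H h \<odot>\<^bsub>X\<^esub> (pairing \<one>\<^bsub>H\<^esub> \<theta> \<odot>\<^bsub>X\<^esub> x))) \<in> bilinear_maps K X E X"
proof -
  have "(\<lambda>x t. tensor_lift K X (\<lambda>\<theta> h. counit H h \<odot>\<^bsub>X\<^esub> (pairing \<one>\<^bsub>H\<^esub> \<theta> \<odot>\<^bsub>X\<^esub> x)) t) \<in> bilinear_maps K X V X"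
    by (assumption | rule act_intros)+
  then show ?thesis
    by (simp add: bilinear_maps_def linear_maps_heisenberg heisenberg_simps)
qed

lemma contract_linear: "contract \<in> linear_maps K Z X"
  unfolding contract_def by (rule tensor_lift_linear[OF module_X module_E module_X contract_bilinear])

lemma contract_triple:
  assumes "x \<in> carrier X" "\<theta> \<in> carrier D" "h \<in> carrier H"
  shows "contract (triple x \<theta> h) = counit H h \<odot>\<^bsub>X\<^esub> (pairing \<one>\<^bsub>H\<^esub> \<theta> \<odot>\<^bsub>X\<^esub> x)"
proof -
  have bil: "(\<lambda>\<theta> h. counit H h \<odot>\<^bsub>X\<^esub> (pairing \<one>\<^bsub>H\<^esub> \<theta> \<odot>\<^bsub>X\<^esub> x)) \<in> bilinear_maps K D H X"
    by (assumption | rule assms act_intros)+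
  show ?thesis
    unfolding contract_def triple_def
    using tensor_lift_pure[OF module_X module_E module_X contract_bilinear] pure_E_closed assms
      tensor_lift_pure[OF module_D module_H module_X bil]
    by simp
qed

text \<open>By the counit axioms of the two coactions, the legs added by \<open>spread\<close> are removed again, so
  \<open>B\<close> can be recovered from its spread.\<close>

lemma contract_spread:
  assumes B: "B \<in> bilinear_maps K X X X" and x: "x \<in> carrier X" and y: "y \<in> carrier X"
  shows "contract (spread B x y) = B x y"
proof -
  note rules = bilinear_compose_left[OF B] bilinear_compose_right[OF B]
    bilinear_maps_closed[OF B] x y triple_intros
  have "contract (spread B x y) = \<alpha>_lift X (\<lambda>x0 x1. contract (\<beta>_lift Z (\<lambda>\<theta> y0. triple (B x0 y0) \<theta> x1) y)) x"
    unfolding spread_def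
    by (rule linear_tensor_lift[OF \<alpha>_closed[OF x] module_X module_H module_Z module_X contract_linear])
       (assumption | rule rules)+
  also have "\<dots> = \<alpha>_lift X (\<lambda>x0 x1. counit H x1 \<odot>\<^bsub>X\<^esub> B x0 y) x"
  proof (rule \<alpha>_cong[OF module_X x])
    fix x0 x1 assume x01: "x0 \<in> carrier X" "x1 \<in> carrier H"
    have "contract (\<beta>_lift Z (\<lambda>\<theta> y0. triple (B x0 y0) \<theta> x1) y)
        = \<beta>_lift X (\<lambda>\<theta> y0. contract (triple (B x0 y0) \<theta> x1)) y"
      by (rule linear_tensor_lift[OF \<beta>_closed[OF y] module_D module_X module_Z module_X contract_linear])
         (assumption | rule x01 rules)+
    also have "\<dots> = \<beta>_lift X (\<lambda>\<theta> y0. counit H x1 \<odot>\<^bsub>X\<^esub> (pairing \<one>\<^bsub>H\<^esub> \<theta> \<odot>\<^bsub>X\<^esub> B x0 y0)) y"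
      by (rule \<beta>_cong[OF module_X y], (assumption | rule linear_compose[OF contract_linear] x01 rules)+)
         (simp add: contract_triple x01 bilinear_maps_closed[OF B])
    also have "\<dots> = counit H x1 \<odot>\<^bsub>X\<^esub> \<beta>_lift X (\<lambda>\<theta> y0. pairing \<one>\<^bsub>H\<^esub> \<theta> \<odot>\<^bsub>X\<^esub> B x0 y0) y"
      by (rule linear_tensor_lift[symmetric, OF \<beta>_closed[OF y] module_D module_X module_X module_X,
            where g = "\<lambda>w. counit H x1 \<odot>\<^bsub>X\<^esub> w"])
         (assumption | rule x01 rules)+
    also have "\<beta>_lift X (\<lambda>\<theta> y0. pairing \<one>\<^bsub>H\<^esub> \<theta> \<odot>\<^bsub>X\<^esub> B x0 y0) y = B x0 y"
      by (rule \<beta>_counit[OF y module_X]) (assumption | rule x01 bilinear_maps_right[OF B])+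
    finally show "contract (\<beta>_lift Z (\<lambda>\<theta> y0. triple (B x0 y0) \<theta> x1) y) = counit H x1 \<odot>\<^bsub>X\<^esub> B x0 y" .
  qed (assumption | rule linear_compose[OF contract_linear] rules)+
  also have "\<dots> = B x y"
    by (rule \<alpha>_counit[OF x module_X]) (rule bilinear_maps_left[OF B y])
  finally show ?thesis .
qed

text \<open>Commuting \<open>1 # h\<close> past \<open>\<theta> # 1\<close> produces the coproducts of \<open>h\<close> and \<open>\<theta>\<close>, with the first leg of
  \<open>h\<close> paired with the second leg of \<open>\<theta>\<close>. Coassociativity of both coactions replaces the paired legs
  by those of a second coaction on \<open>x\<^sub>0\<close> and on \<open>y\<^sub>0\<close>, and together they form \<open>braided_mult x\<^sub>0 y\<^sub>0\<close>.\<close>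

lemma heisenberg_left:
  assumes x: "x \<in> carrier X" and y: "y \<in> carrier X"
  shows "\<alpha>_lift Z (\<lambda>x0 h. \<beta>_lift Z (\<lambda>\<theta> y0. pure_tensor K X E (x0 \<otimes>\<^bsub>X\<^esub> y0)
      (pure_tensor K D H \<one>\<^bsub>D\<^esub> h \<otimes>\<^bsub>E\<^esub> pure_tensor K D H \<theta> \<one>\<^bsub>H\<^esub>)) y) x = spread braided_mult x y"
proof -
  interpret Z: module K Z by (rule module_Z)
  note rules = x y triple_intros
  let ?T = "\<lambda>x0 y0 \<theta>1 \<theta>2 h1 h2. pairing h1 \<theta>2 \<odot>\<^bsub>Z\<^esub> triple (x0 \<otimes>\<^bsub>X\<^esub> y0) \<theta>1 h2"
  have expand: "pure_tensor K X E z (pure_tensor K D H \<one>\<^bsub>D\<^esub> h \<otimes>\<^bsub>E\<^esub> pure_tensor K D H \<theta> \<one>\<^bsub>H\<^esub>)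
      = dual_sweedler Z (\<lambda>\<theta>1 \<theta>2. sweedler Z (\<lambda>h1 h2. pairing h1 \<theta>2 \<odot>\<^bsub>Z\<^esub> triple z \<theta>1 h2) h) \<theta>"
    if zh: "z \<in> carrier X" "h \<in> carrier H" "\<theta> \<in> carrier D" for z h \<theta>
  proof -
    have g: "pure_tensor K X E z \<in> linear_maps K V Z"
      using bilinear_maps_right[OF pure_tensor_bilinear[OF module_X module_E] zh(1)]
      by (simp add: linear_maps_heisenberg)
    have "pure_tensor K X E z (pure_tensor K D H \<one>\<^bsub>D\<^esub> h \<otimes>\<^bsub>E\<^esub> pure_tensor K D H \<theta> \<one>\<^bsub>H\<^esub>)
      = dual_sweedler Z (\<lambda>\<theta>1 \<theta>2. pure_tensor K X E z
          (sweedler V (\<lambda>h1 h2. pairing h1 \<theta>2 \<odot>\<^bsub>V\<^esub> pure_tensor K D H \<theta>1 h2) h)) \<theta>"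
      unfolding heisenberg_mult_dual_right[OF zh(3,2)]
      by (rule linear_tensor_lift[OF dual_comult(1)[OF zh(3)] module_D module_D module_V module_Z g])
         (assumption | rule zh rules)+
    also have "\<dots> = dual_sweedler Z (\<lambda>\<theta>1 \<theta>2. sweedler Z (\<lambda>h1 h2. pairing h1 \<theta>2 \<odot>\<^bsub>Z\<^esub> triple z \<theta>1 h2) h) \<theta>"
    proof (rule tensor_lift_cong[OF module_D module_D module_Z dual_comult(1)[OF zh(3)]])
      fix \<theta>1 \<theta>2 assume \<theta>12: "\<theta>1 \<in> carrier D" "\<theta>2 \<in> carrier D"
      have "pure_tensor K X E z (sweedler V (\<lambda>h1 h2. pairing h1 \<theta>2 \<odot>\<^bsub>V\<^esub> pure_tensor K D H \<theta>1 h2) h)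
        = sweedler Z (\<lambda>h1 h2. pure_tensor K X E z (pairing h1 \<theta>2 \<odot>\<^bsub>V\<^esub> pure_tensor K D H \<theta>1 h2)) h"
        by (rule linear_sweedler[OF zh(2) module_V module_Z g]) (assumption | rule \<theta>12 zh rules)+
      also have "\<dots> = sweedler Z (\<lambda>h1 h2. pairing h1 \<theta>2 \<odot>\<^bsub>Z\<^esub> triple z \<theta>1 h2) h"
        by (rule sweedler_cong[OF zh(2) module_Z], (assumption | rule \<theta>12 linear_compose[OF g] zh rules)+)
           (simp add: triple_def linear_maps_smult[OF g] pairing_closed \<theta>12 pure_tensor_closed[OF module_D module_H])
      finally show "pure_tensor K X E z (sweedler V (\<lambda>h1 h2. pairing h1 \<theta>2 \<odot>\<^bsub>V\<^esub> pure_tensor K D H \<theta>1 h2) h)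
        = sweedler Z (\<lambda>h1 h2. pairing h1 \<theta>2 \<odot>\<^bsub>Z\<^esub> triple z \<theta>1 h2) h" .
    qed (assumption | rule linear_compose[OF g] zh rules)+
    finally show ?thesis .
  qed
  have swap1: "\<beta>_lift Z (\<lambda>\<theta> z. sweedler Z (q \<theta> z) h) y = sweedler Z (\<lambda>a b. \<beta>_lift Z (\<lambda>\<theta> z. q \<theta> z a b) y) h"
    if "h \<in> carrier H" "y \<in> carrier X"
      "\<And>\<theta> z. \<lbrakk>\<theta> \<in> carrier D; z \<in> carrier X\<rbrakk> \<Longrightarrow> q \<theta> z \<in> bilinear_maps K H H Z"
      "\<And>a b. \<lbrakk>a \<in> carrier H; b \<in> carrier H\<rbrakk> \<Longrightarrow> (\<lambda>\<theta> z. q \<theta> z a b) \<in> bilinear_maps K D X Z" for q h y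
    by (rule tensor_lift_swap[OF \<beta>_closed[OF that(2)] comult_closed[OF that(1)]
          module_D module_X module_H module_H module_Z that(3,4)])
  have swap2: "\<alpha>_lift Z (\<lambda>u v. \<beta>_lift Z (q u v) y) x = \<beta>_lift Z (\<lambda>\<theta> z. \<alpha>_lift Z (\<lambda>u v. q u v \<theta> z) x) y"
    if "x \<in> carrier X" "y \<in> carrier X"
      "\<And>u v. \<lbrakk>u \<in> carrier X; v \<in> carrier H\<rbrakk> \<Longrightarrow> q u v \<in> bilinear_maps K D X Z"
      "\<And>\<theta> z. \<lbrakk>\<theta> \<in> carrier D; z \<in> carrier X\<rbrakk> \<Longrightarrow> (\<lambda>u v. q u v \<theta> z) \<in> bilinear_maps K X H Z" for q x y
    by (rule tensor_lift_swap[OF \<alpha>_closed[OF that(1)] \<beta>_closed[OF that(2)]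
          module_X module_H module_D module_X module_Z that(3,4)])
  have "\<alpha>_lift Z (\<lambda>x0 h. \<beta>_lift Z (\<lambda>\<theta> y0. pure_tensor K X E (x0 \<otimes>\<^bsub>X\<^esub> y0)
      (pure_tensor K D H \<one>\<^bsub>D\<^esub> h \<otimes>\<^bsub>E\<^esub> pure_tensor K D H \<theta> \<one>\<^bsub>H\<^esub>)) y) x
    = \<alpha>_lift Z (\<lambda>x0 h. \<beta>_lift Z (\<lambda>\<theta> y0.
        dual_sweedler Z (\<lambda>\<theta>1 \<theta>2. sweedler Z (\<lambda>h1 h2. ?T x0 y0 \<theta>1 \<theta>2 h1 h2) h) \<theta>) y) x"
  proof (rule \<alpha>_cong[symmetric, OF module_Z x])
    fix x0 h assume xh: "x0 \<in> carrier X" "h \<in> carrier H"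
    show "\<beta>_lift Z (\<lambda>\<theta> y0. dual_sweedler Z (\<lambda>\<theta>1 \<theta>2. sweedler Z (\<lambda>h1 h2. ?T x0 y0 \<theta>1 \<theta>2 h1 h2) h) \<theta>) y
      = \<beta>_lift Z (\<lambda>\<theta> y0. pure_tensor K X E (x0 \<otimes>\<^bsub>X\<^esub> y0)
          (pure_tensor K D H \<one>\<^bsub>D\<^esub> h \<otimes>\<^bsub>E\<^esub> pure_tensor K D H \<theta> \<one>\<^bsub>H\<^esub>)) y"
      by (rule \<beta>_cong[OF module_Z y], (assumption | rule xh rules)+) (simp add: expand xh X_mult_closed)
  qed (assumption | rule rules)+
  also have "\<dots> = \<alpha>_lift Z (\<lambda>x0 h. \<beta>_lift Z (\<lambda>\<theta> z. \<beta>_lift Z (\<lambda>\<theta>' y0. sweedler Z (\<lambda>h1 h2. ?T x0 y0 \<theta> \<theta>' h1 h2) h) z) y) x"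
    by (rule \<alpha>_cong[OF module_Z x]; (rule \<beta>_coassoc)?) (assumption | rule rules)+
  \<comment> \<open>The coproduct of \<open>h\<close> is moved outwards until it is next to the coaction on \<open>x\<close>.\<close>
  also have "\<dots> = \<alpha>_lift Z (\<lambda>x0 h. \<beta>_lift Z (\<lambda>\<theta> z. sweedler Z (\<lambda>h1 h2. \<beta>_lift Z (\<lambda>\<theta>' y0. ?T x0 y0 \<theta> \<theta>' h1 h2) z) h) y) x"
    by (rule \<alpha>_cong[OF module_Z x]; (rule \<beta>_cong[OF module_Z y]; (rule swap1)?)?) (assumption | rule rules)+
  also have "\<dots> = \<alpha>_lift Z (\<lambda>x0 h. sweedler Z (\<lambda>h1 h2. \<beta>_lift Z (\<lambda>\<theta> z. \<beta>_lift Z (\<lambda>\<theta>' y0. ?T x0 y0 \<theta> \<theta>' h1 h2) z) y) h) x"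
    by (rule \<alpha>_cong[OF module_Z x]; (rule swap1)?) (assumption | rule rules)+
  also have "\<dots> = \<alpha>_lift Z (\<lambda>w h. \<alpha>_lift Z (\<lambda>x0 h1. \<beta>_lift Z (\<lambda>\<theta> z. \<beta>_lift Z (\<lambda>\<theta>' y0. ?T x0 y0 \<theta> \<theta>' h1 h) z) y) w) x"
    by (rule \<alpha>_coassoc[symmetric, OF x module_Z]) (assumption | rule rules)+
  \<comment> \<open>The innermost sum is the action of \<open>h1\<close>.\<close>
  also have "\<dots> = \<alpha>_lift Z (\<lambda>w h. \<alpha>_lift Z (\<lambda>x0 h1. \<beta>_lift Z (\<lambda>\<theta> z. triple (x0 \<otimes>\<^bsub>X\<^esub> act z h1) \<theta> h) y) w) x"
  proof (rule \<alpha>_cong[OF module_Z x])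
    fix w h assume wh: "w \<in> carrier X" "h \<in> carrier H"
    show "\<alpha>_lift Z (\<lambda>x0 h1. \<beta>_lift Z (\<lambda>\<theta> z. \<beta>_lift Z (\<lambda>\<theta>' y0. ?T x0 y0 \<theta> \<theta>' h1 h) z) y) w
      = \<alpha>_lift Z (\<lambda>x0 h1. \<beta>_lift Z (\<lambda>\<theta> z. triple (x0 \<otimes>\<^bsub>X\<^esub> act z h1) \<theta> h) y) w"
    proof (rule \<alpha>_cong[OF module_Z wh(1)])
      fix x0 h1 assume xh: "x0 \<in> carrier X" "h1 \<in> carrier H"
      show "\<beta>_lift Z (\<lambda>\<theta> z. \<beta>_lift Z (\<lambda>\<theta>' y0. ?T x0 y0 \<theta> \<theta>' h1 h) z) y
        = \<beta>_lift Z (\<lambda>\<theta> z. triple (x0 \<otimes>\<^bsub>X\<^esub> act z h1) \<theta> h) y"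
      proof (rule \<beta>_cong[OF module_Z y])
        fix \<theta> z assume \<theta>z: "\<theta> \<in> carrier D" "z \<in> carrier X"
        have g: "(\<lambda>u. triple (x0 \<otimes>\<^bsub>X\<^esub> u) \<theta> h) \<in> linear_maps K X Z"
          by (assumption | rule xh wh \<theta>z rules)+
        have "triple (x0 \<otimes>\<^bsub>X\<^esub> act z h1) \<theta> h
          = \<beta>_lift Z (\<lambda>\<theta>' y0. triple (x0 \<otimes>\<^bsub>X\<^esub> (pairing h1 \<theta>' \<odot>\<^bsub>X\<^esub> y0)) \<theta> h) z"
          unfolding coaction_action_def
          by (rule linear_tensor_lift[OF \<beta>_closed[OF \<theta>z(2)] module_D module_X module_X module_Z g])
             (assumption | rule xh wh \<theta>z rules)+
        also have "\<dots> = \<beta>_lift Z (\<lambda>\<theta>' y0. ?T x0 y0 \<theta> \<theta>' h1 h) z"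
          by (rule \<beta>_cong[OF module_Z \<theta>z(2)], (assumption | rule xh wh \<theta>z rules)+)
             (simp add: linear_maps_smult[OF g] pairing_closed xh)
        finally show "\<beta>_lift Z (\<lambda>\<theta>' y0. ?T x0 y0 \<theta> \<theta>' h1 h) z = triple (x0 \<otimes>\<^bsub>X\<^esub> act z h1) \<theta> h" ..
      qed (assumption | rule xh wh rules)+
    qed (assumption | rule wh rules)+
  qed (assumption | rule rules)+
  \<comment> \<open>With the second coaction on \<open>x\<close> innermost, its sum is \<open>braided_mult\<close>.\<close>
  also have "\<dots> = \<alpha>_lift Z (\<lambda>w h. \<beta>_lift Z (\<lambda>\<theta> z. \<alpha>_lift Z (\<lambda>x0 h1. triple (x0 \<otimes>\<^bsub>X\<^esub> act z h1) \<theta> h) w) y) x"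
    by (rule \<alpha>_cong[OF module_Z x]; (rule swap2)?) (assumption | rule rules)+
  also have "\<dots> = spread braided_mult x y"
    unfolding spread_def
  proof (rule \<alpha>_cong[OF module_Z x])
    fix w h assume wh: "w \<in> carrier X" "h \<in> carrier H"
    show "\<beta>_lift Z (\<lambda>\<theta> z. \<alpha>_lift Z (\<lambda>x0 h1. triple (x0 \<otimes>\<^bsub>X\<^esub> act z h1) \<theta> h) w) y
      = \<beta>_lift Z (\<lambda>\<theta> z. triple (braided_mult w z) \<theta> h) y"
    proof (rule \<beta>_cong[OF module_Z y])
      fix \<theta> z assume \<theta>z: "\<theta> \<in> carrier D" "z \<in> carrier X"
      show "\<alpha>_lift Z (\<lambda>x0 h1. triple (x0 \<otimes>\<^bsub>X\<^esub> act z h1) \<theta> h) w = triple (braided_mult w z) \<theta> h"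
        unfolding braided_mult_def
        by (rule linear_tensor_lift[symmetric, OF \<alpha>_closed[OF wh(1)] module_X module_H module_X module_Z,
              where g = "\<lambda>u. triple u \<theta> h"])
           (assumption | rule wh \<theta>z rules)+
    qed (assumption | rule wh rules)+
  qed (assumption | rule rules)+
  finally show ?thesis .
qed

lemma heisenberg_right:
  assumes x: "x \<in> carrier X" and y: "y \<in> carrier X"
  shows "\<beta>_lift Z (\<lambda>\<theta> y0. \<alpha>_lift Z (\<lambda>x0 h. pure_tensor K X E (y0 \<otimes>\<^bsub>X\<^esub> x0)
      (pure_tensor K D H \<theta> \<one>\<^bsub>H\<^esub> \<otimes>\<^bsub>E\<^esub> pure_tensor K D H \<one>\<^bsub>D\<^esub> h)) x) y = spread (\<lambda>x y. y \<otimes>\<^bsub>X\<^esub> x) x y"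
proof -
  note rules = x y triple_intros
  have "spread (\<lambda>x y. y \<otimes>\<^bsub>X\<^esub> x) x y = \<beta>_lift Z (\<lambda>\<theta> y0. \<alpha>_lift Z (\<lambda>x0 h. triple (y0 \<otimes>\<^bsub>X\<^esub> x0) \<theta> h) x) y"
    unfolding spread_def
    by (rule tensor_lift_swap[OF \<alpha>_closed[OF x] \<beta>_closed[OF y] module_X module_H module_D module_X module_Z])
       (assumption | rule rules)+
  also have "\<dots> = \<beta>_lift Z (\<lambda>\<theta> y0. \<alpha>_lift Z (\<lambda>x0 h. pure_tensor K X E (y0 \<otimes>\<^bsub>X\<^esub> x0)
      (pure_tensor K D H \<theta> \<one>\<^bsub>H\<^esub> \<otimes>\<^bsub>E\<^esub> pure_tensor K D H \<one>\<^bsub>D\<^esub> h)) x) y"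
  proof (rule \<beta>_cong[OF module_Z y])
    fix \<theta> y0 assume \<theta>y: "\<theta> \<in> carrier D" "y0 \<in> carrier X"
    show "\<alpha>_lift Z (\<lambda>x0 h. triple (y0 \<otimes>\<^bsub>X\<^esub> x0) \<theta> h) x = \<alpha>_lift Z (\<lambda>x0 h. pure_tensor K X E (y0 \<otimes>\<^bsub>X\<^esub> x0)
      (pure_tensor K D H \<theta> \<one>\<^bsub>H\<^esub> \<otimes>\<^bsub>E\<^esub> pure_tensor K D H \<one>\<^bsub>D\<^esub> h)) x"
      by (rule \<alpha>_cong[OF module_Z x], (assumption | rule \<theta>y rules)+)
         (simp add: triple_def heisenberg_mult_dual_left \<theta>y)
  qed (assumption | rule rules)+
  finally show ?thesis ..
qed

lemma heisenberg_braided_commutative_iff: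
  "heisenberg_braided_commutative K H X \<alpha> \<beta>
    \<longleftrightarrow> (\<forall>x\<in>carrier X. \<forall>y\<in>carrier X. braided_mult x y = y \<otimes>\<^bsub>X\<^esub> x)"
proof -
  let ?XH = "tensor K X H" and ?XD = "tensor K X D"
  let ?i1 = "\<lambda>\<theta>. pure_tensor K D H \<theta> \<one>\<^bsub>H\<^esub>" and ?i2 = "\<lambda>h. pure_tensor K D H \<one>\<^bsub>D\<^esub> h"
  let ?I1 = "tensor_map K X E id ?i1" and ?I2 = "tensor_map K X E id ?i2"
  have XH: "module K ?XH" and XD: "module K ?XD"
    by (intro module_tensor module_X module_H module_D)+
  have id: "id \<in> linear_maps K X X"
    using linear_id by (simp add: id_def)
  have i1: "?i1 \<in> linear_maps K D E" and i2: "?i2 \<in> linear_maps K H E"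
    by (assumption | rule pure_E_linear linear_id H_one_closed dual_one_closed)+
  note I1 = tensor_map_linear[OF module_X module_D module_X module_E id i1]
    and I2 = tensor_map_linear[OF module_X module_H module_X module_E id i2]
  note mX = mult_bilinear[OF algebra_X] and mE = heisenberg_mult_bilinear
  note mZ = tensor_mult_bilinear[OF module_X module_E mX mE]
  have mop: "(\<lambda>x y. y \<otimes>\<^bsub>X\<^esub> x) \<in> bilinear_maps K X X X"
    by (assumption | rule coaction_intros)+
  have main: "mult_map K Z (tensor_map K Z Z ?I2 ?I1 (pure_tensor K ?XH ?XD (\<alpha> x) (tensor_flip K D X (\<beta> y))))
        = spread braided_mult x y"
      "mult_map K Z (tensor_map K Z Z ?I1 ?I2 (pure_tensor K ?XD ?XH (tensor_flip K D X (\<beta> y)) (\<alpha> x)))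
        = spread (\<lambda>x y. y \<otimes>\<^bsub>X\<^esub> x) x y"
    if x: "x \<in> carrier X" and y: "y \<in> carrier X" for x y
  proof -
    note rules = x y pure_E_linear pure_E_closed bilinear_maps_closed[OF mE] bilinear_compose_left[OF mE]
      bilinear_compose_right[OF mE] triple_intros
    note fl = linear_maps_closed[OF tensor_flip_linear[OF module_D module_X] \<beta>_closed[OF y]]
    note cl = linear_maps_closed[OF I2 \<alpha>_closed[OF x]] linear_maps_closed[OF I1 fl]
    have "mult_map K Z (tensor_map K Z Z ?I2 ?I1 (pure_tensor K ?XH ?XD (\<alpha> x) (tensor_flip K D X (\<beta> y))))
        = ?I2 (\<alpha> x) \<otimes>\<^bsub>Z\<^esub> ?I1 (tensor_flip K D X (\<beta> y))"
      using tensor_map_pure[OF XH XD module_Z module_Z I2 I1 \<alpha>_closed[OF x] fl] mult_map_pure[OF module_Z mZ cl]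
      by simp
    also have "\<dots> = \<alpha>_lift Z (\<lambda>x0 h. tensor_lift K Z (\<lambda>y0 \<theta>. pure_tensor K X E (id x0 \<otimes>\<^bsub>X\<^esub> id y0) (?i2 h \<otimes>\<^bsub>E\<^esub> ?i1 \<theta>))
        (tensor_flip K D X (\<beta> y))) x"
      by (rule tensor_mult_tensor_map[OF module_X module_E mX mE module_X module_H module_X module_D id i2 id i1
            \<alpha>_closed[OF x] fl])
    also have "\<dots> = \<alpha>_lift Z (\<lambda>x0 h. \<beta>_lift Z (\<lambda>\<theta> y0. pure_tensor K X E (x0 \<otimes>\<^bsub>X\<^esub> y0) (?i2 h \<otimes>\<^bsub>E\<^esub> ?i1 \<theta>)) y) x"
      unfolding id_apply
    proof (rule \<alpha>_cong[symmetric, OF module_Z x])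
      fix x0 h assume xh: "x0 \<in> carrier X" "h \<in> carrier H"
      show "\<beta>_lift Z (\<lambda>\<theta> y0. pure_tensor K X E (x0 \<otimes>\<^bsub>X\<^esub> y0) (?i2 h \<otimes>\<^bsub>E\<^esub> ?i1 \<theta>)) y
        = tensor_lift K Z (\<lambda>y0 \<theta>. pure_tensor K X E (x0 \<otimes>\<^bsub>X\<^esub> y0) (?i2 h \<otimes>\<^bsub>E\<^esub> ?i1 \<theta>)) (tensor_flip K D X (\<beta> y))"
        by (rule tensor_lift_tensor_flip[symmetric, OF \<beta>_closed[OF y] module_D module_X module_Z])
           (assumption | rule xh rules)+
    qed (assumption | rule rules)+
    also have "\<dots> = spread braided_mult x y"
      by (rule heisenberg_left[OF x y])
    finally show "mult_map K Z (tensor_map K Z Z ?I2 ?I1 (pure_tensor K ?XH ?XD (\<alpha> x) (tensor_flip K D X (\<beta> y))))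
        = spread braided_mult x y" .
    have "mult_map K Z (tensor_map K Z Z ?I1 ?I2 (pure_tensor K ?XD ?XH (tensor_flip K D X (\<beta> y)) (\<alpha> x)))
        = ?I1 (tensor_flip K D X (\<beta> y)) \<otimes>\<^bsub>Z\<^esub> ?I2 (\<alpha> x)"
      using tensor_map_pure[OF XD XH module_Z module_Z I1 I2 fl \<alpha>_closed[OF x]] mult_map_pure[OF module_Z mZ cl(2,1)]
      by simp
    also have "\<dots> = tensor_lift K Z (\<lambda>y0 \<theta>. \<alpha>_lift Z (\<lambda>x0 h. pure_tensor K X E (id y0 \<otimes>\<^bsub>X\<^esub> id x0) (?i1 \<theta> \<otimes>\<^bsub>E\<^esub> ?i2 h)) x)
        (tensor_flip K D X (\<beta> y))"
      by (rule tensor_mult_tensor_map[OF module_X module_E mX mE module_X module_D module_X module_H id i1 id i2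
            fl \<alpha>_closed[OF x]])
    also have "\<dots> = \<beta>_lift Z (\<lambda>\<theta> y0. \<alpha>_lift Z (\<lambda>x0 h. pure_tensor K X E (y0 \<otimes>\<^bsub>X\<^esub> x0) (?i1 \<theta> \<otimes>\<^bsub>E\<^esub> ?i2 h)) x) y"
      unfolding id_apply
      by (rule tensor_lift_tensor_flip[OF \<beta>_closed[OF y] module_D module_X module_Z])
         (assumption | rule rules)+
    also have "\<dots> = spread (\<lambda>x y. y \<otimes>\<^bsub>X\<^esub> x) x y"
      by (rule heisenberg_right[OF x y])
    finally show "mult_map K Z (tensor_map K Z Z ?I1 ?I2 (pure_tensor K ?XD ?XH (tensor_flip K D X (\<beta> y)) (\<alpha> x)))
        = spread (\<lambda>x y. y \<otimes>\<^bsub>X\<^esub> x) x y" .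
  qed
  have "heisenberg_braided_commutative K H X \<alpha> \<beta> \<longleftrightarrow>
      (\<forall>x\<in>carrier X. \<forall>y\<in>carrier X. spread braided_mult x y = spread (\<lambda>x y. y \<otimes>\<^bsub>X\<^esub> x) x y)"
    unfolding heisenberg_braided_commutative_def Let_def by (simp add: main)
  also have "\<dots> \<longleftrightarrow> (\<forall>x\<in>carrier X. \<forall>y\<in>carrier X. braided_mult x y = y \<otimes>\<^bsub>X\<^esub> x)"
  proof
    assume sp: "\<forall>x\<in>carrier X. \<forall>y\<in>carrier X. spread braided_mult x y = spread (\<lambda>x y. y \<otimes>\<^bsub>X\<^esub> x) x y"
    show "\<forall>x\<in>carrier X. \<forall>y\<in>carrier X. braided_mult x y = y \<otimes>\<^bsub>X\<^esub> x"
    proof (intro ballI)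
      fix x y assume "x \<in> carrier X" "y \<in> carrier X"
      then show "braided_mult x y = y \<otimes>\<^bsub>X\<^esub> x"
        using sp contract_spread[OF braided_mult_bilinear, of x y] contract_spread[OF mop, of x y] by simp
    qed
  next
    assume bm: "\<forall>x\<in>carrier X. \<forall>y\<in>carrier X. braided_mult x y = y \<otimes>\<^bsub>X\<^esub> x"
    show "\<forall>x\<in>carrier X. \<forall>y\<in>carrier X. spread braided_mult x y = spread (\<lambda>x y. y \<otimes>\<^bsub>X\<^esub> x) x y"
      by (intro ballI spread_cong braided_mult_bilinear) (use bm in simp_all)
  qed
  finally show ?thesis .
qed

end

theorem proposition4p28:
  fixes K :: "'k ring" and H :: "('k, 'h) hopf" and X :: "('k, 'x) module"
    and \<alpha> :: "'x \<Rightarrow> ('k, 'x, 'h) tensor" and \<beta> :: "'x \<Rightarrow> ('k, 'h \<Rightarrow> 'k, 'x) tensor"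
  assumes "hopf_algebra K H"
    and "bij_betw (antipode H) (carrier H) (carrier H)"
    and "finite_dimensional K H"
    and "yetter_drinfeld_algebra K H X \<alpha> \<beta>"
  shows "heisenberg_braided_commutative K H X \<alpha> \<beta> \<longleftrightarrow>
    braided_commutative K H X (coaction_action K X \<beta>) \<alpha>"
proof -
  interpret coaction_pair K H X \<alpha> \<beta>
    using assms unfolding yetter_drinfeld_algebra_def
    by (intro coaction_pair.intro finite_dimensional_hopf_algebra.intro coaction_pair_axioms.intro
        finite_dimensional_hopf_algebra_axioms.intro) auto
  show ?thesis
    using heisenberg_braided_commutative_iff braided_commutative_iff[OF assms(2)] by simp
qed

end
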